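(* At least $112$ of the $13657$ triangulations (up to isomorphism) with exactly $10$ vertices of the non-orientable closed surface $N_4$ of genus $4$ possess polyhedral realizations in $\mathbb{R}^3$ with $2$-fold rotational symmetry.
   Context: $N_h$ denotes the connected sum of $h$ projective planes (the non-orientable closed surface of genus $h$). A triangulation of a closed connected surface $S$ is a finite two-dimensional simplicial complex $\Delta$ whose underlying space $|\Delta|$ is homeomorphic to $S$; triangulations are counted up to combinatorial (simplicial) isomorphism. There are exactly $13657$ triangulations of $N_4$ with $10$ vertices, from the known enumeration. Let $V$ be the vertex set of $\Delta$. Each map $\psi\colon V\to\mathbb{R}^3$ induces a simplexwise linear map $\phi_\psi\colon|\Delta|\to\mathbb{R}^3$. Since the surface is non-orientable, a polyhedral realization of $\Delta$ in $\mathbb{R}^3$ is a map $\phi_\psi$ that is locally injective (a simplexwise linear immersion). A geometric symmetry of a polyhedral realization $\phi_\psi$ is an isometry $g$ of $\mathbb{R}^3$ that maps $\phi_\psi(|\Delta|)$ to itself and is induced by an automorphism $\alpha$ of $\Delta$, i.e. $g\circ\phi_\psi=\phi_\psi\circ|\alpha|$. The realization has $2$-fold rotational symmetry if a rotation of order $2$ about a line is a geometric symmetry of it, induced by a nontrivial automorphism. *)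

theory Defs
  imports "HOL-Analysis.Analysis"
begin

section \<open>Finite simplicial complexes of dimension two\<close>

text \<open>A complex is given by its set of nonempty faces; its vertex set is the union of the faces.\<close>

definition two_dim_complex :: "'v set set \<Rightarrow> bool" where
  "two_dim_complex \<Delta> \<longleftrightarrow>
     finite \<Delta> \<and>
     (\<forall>\<sigma>\<in>\<Delta>. finite \<sigma> \<and> \<sigma> \<noteq> {} \<and> card \<sigma> \<le> 3) \<and>
     (\<forall>\<sigma>\<in>\<Delta>. \<forall>\<tau>. \<tau> \<subseteq> \<sigma> \<and> \<tau> \<noteq> {} \<longrightarrow> \<tau> \<in> \<Delta>) \<and>
     (\<exists>\<sigma>\<in>\<Delta>. card \<sigma> = 3)"

definition vertices :: "'v set set \<Rightarrow> 'v set" where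
  "vertices \<Delta> = \<Union>\<Delta>"

definition simplicial_iso :: "'v set set \<Rightarrow> 'w set set \<Rightarrow> ('v \<Rightarrow> 'w) \<Rightarrow> bool" where
  "simplicial_iso \<Delta> \<Gamma> f \<longleftrightarrow>
     bij_betw f (vertices \<Delta>) (vertices \<Gamma>) \<and> (\<lambda>\<sigma>. f ` \<sigma>) ` \<Delta> = \<Gamma>"

definition iso_rel :: "('v set set \<times> 'v set set) set" where
  "iso_rel = {(\<Delta>, \<Gamma>). \<exists>f. simplicial_iso \<Delta> \<Gamma> f}"

text \<open>Points of the underlying space are given by barycentric coordinates. For a finite complex
  the topology induced by the product topology on functions is the usual one.\<close>

definition underlying_set :: "'v set set \<Rightarrow> ('v \<Rightarrow> real) set" where
  "underlying_set \<Delta> =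
     {x. (\<forall>v. 0 \<le> x v) \<and> {v. x v \<noteq> 0} \<in> \<Delta> \<and> (\<Sum>v\<in>vertices \<Delta>. x v) = 1}"

definition underlying_space :: "'v set set \<Rightarrow> ('v \<Rightarrow> real) topology" where
  "underlying_space \<Delta> = top_of_set (underlying_set \<Delta>)"

text \<open>The map of underlying spaces induced by a vertex map \<open>\<alpha>\<close>.\<close>

definition induced_map :: "'v set set \<Rightarrow> ('v \<Rightarrow> 'v) \<Rightarrow> ('v \<Rightarrow> real) \<Rightarrow> ('v \<Rightarrow> real)" where
  "induced_map \<Delta> \<alpha> x = (\<lambda>w. \<Sum>v | v \<in> vertices \<Delta> \<and> \<alpha> v = w. x v)"


section \<open>Non-orientable closed surfaces\<close>

text \<open>The projective plane is the 2-sphere with antipodal points identified.\<close>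

definition projective_plane :: "'a topology \<Rightarrow> bool" where
  "projective_plane X \<longleftrightarrow>
     (\<exists>q. quotient_map (top_of_set (sphere (0 :: real ^ 3) 1)) X q \<and>
          (\<forall>x \<in> sphere 0 1. \<forall>y \<in> sphere 0 1. q x = q y \<longleftrightarrow> y = x \<or> y = - x))"

text \<open>\<open>Z\<close> is a connected sum of the closed surfaces \<open>X\<close> and \<open>Y\<close>: the interiors of embedded closed
  discs \<open>d\<close> and \<open>e\<close> are removed and the boundary circles are glued, \<open>d z\<close> to \<open>e z\<close>. The gluing
  homeomorphism is no restriction, since any homeomorphism of circles extends radially to the disc
  and can be absorbed into \<open>e\<close>. In a closed surface, \<open>d ` ball 0 1\<close> is the interior of the disc by
  invariance of domain.\<close>

definition punctured_sum ::
  "'a topology \<Rightarrow> (complex \<Rightarrow> 'a) \<Rightarrow> 'a topology \<Rightarrow> (complex \<Rightarrow> 'a) \<Rightarrow> (bool \<times> 'a) topology" where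
  "punctured_sum X d Y e =
     sum_topology (\<lambda>b. if b then subtopology X (topspace X - d ` ball 0 1)
                       else subtopology Y (topspace Y - e ` ball 0 1)) UNIV"

definition connected_sum :: "'a topology \<Rightarrow> 'a topology \<Rightarrow> 'a topology \<Rightarrow> bool" where
  "connected_sum X Y Z \<longleftrightarrow>
     (\<exists>d e q.
        embedding_map (top_of_set (cball 0 1)) X d \<and>
        embedding_map (top_of_set (cball 0 1)) Y e \<and>
        quotient_map (punctured_sum X d Y e) Z q \<and>
        (\<forall>p \<in> topspace (punctured_sum X d Y e). \<forall>p' \<in> topspace (punctured_sum X d Y e).
           q p = q p' \<longleftrightarrow>
             p = p' \<or>
             (\<exists>z \<in> sphere 0 1. p = (True, d z) \<and> p' = (False, e z)) \<or>
             (\<exists>z \<in> sphere 0 1. p = (False, e z) \<and> p' = (True, d z))))"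

text \<open>\<open>nonorientable_surface h S\<close>: the space \<open>S\<close> is a connected sum of \<open>h\<close> projective planes,
  i.e. a model of \<open>N\<^sub>h\<close> (connected sums of surfaces are well defined up to homeomorphism, and
  for non-orientable summands no orientations have to be chosen).\<close>

inductive nonorientable_surface :: "nat \<Rightarrow> 'a topology \<Rightarrow> bool" where
  one: "projective_plane P \<Longrightarrow> nonorientable_surface 1 P"
| sum: "nonorientable_surface h X \<Longrightarrow> projective_plane P \<Longrightarrow> connected_sum X P Z
          \<Longrightarrow> nonorientable_surface (Suc h) Z"

text \<open>The type \<open>nat \<Rightarrow> real\<close> of points of the model surface (and of the intermediate summands) is
  no restriction: topologies on arbitrary subsets are allowed, and the type has the cardinality of
  the continuum.\<close>

definition triangulates_N :: "nat \<Rightarrow> 'v set set \<Rightarrow> bool" where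
  "triangulates_N h \<Delta> \<longleftrightarrow>
     two_dim_complex \<Delta> \<and>
     (\<exists>S :: (nat \<Rightarrow> real) topology.
        nonorientable_surface h S \<and> underlying_space \<Delta> homeomorphic_space S)"


section \<open>Polyhedral realizations and geometric symmetries\<close>

definition simplexwise_linear :: "'v set set \<Rightarrow> ('v \<Rightarrow> real ^ 3) \<Rightarrow> ('v \<Rightarrow> real) \<Rightarrow> real ^ 3" where
  "simplexwise_linear \<Delta> \<psi> x = (\<Sum>v\<in>vertices \<Delta>. x v *\<^sub>R \<psi> v)"

definition locally_injective_on :: "'a::topological_space set \<Rightarrow> ('a \<Rightarrow> 'b) \<Rightarrow> bool" where
  "locally_injective_on A f \<longleftrightarrow>
     (\<forall>x\<in>A. \<exists>U. openin (top_of_set A) U \<and> x \<in> U \<and> inj_on f U)"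

text \<open>This is the notion for non-orientable surfaces, which do not embed in 3-space: a simplexwise
  linear immersion.\<close>

definition polyhedral_realization :: "'v set set \<Rightarrow> ('v \<Rightarrow> real ^ 3) \<Rightarrow> bool" where
  "polyhedral_realization \<Delta> \<psi> \<longleftrightarrow>
     locally_injective_on (underlying_set \<Delta>) (simplexwise_linear \<Delta> \<psi>)"

definition geometric_symmetry ::
  "'v set set \<Rightarrow> ('v \<Rightarrow> real ^ 3) \<Rightarrow> (real ^ 3 \<Rightarrow> real ^ 3) \<Rightarrow> ('v \<Rightarrow> 'v) \<Rightarrow> bool" where
  "geometric_symmetry \<Delta> \<psi> g \<alpha> \<longleftrightarrow>
     (\<forall>x y. dist (g x) (g y) = dist x y) \<and>
     g ` simplexwise_linear \<Delta> \<psi> ` underlying_set \<Delta> = simplexwise_linear \<Delta> \<psi> ` underlying_set \<Delta> \<and>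
     simplicial_iso \<Delta> \<Delta> \<alpha> \<and>
     (\<forall>x\<in>underlying_set \<Delta>.
        g (simplexwise_linear \<Delta> \<psi> x) = simplexwise_linear \<Delta> \<psi> (induced_map \<Delta> \<alpha> x))"

text \<open>A rotation about the line through \<open>a\<close> with direction \<open>u\<close>.\<close>

definition rotation_about_line :: "real ^ 3 \<Rightarrow> real ^ 3 \<Rightarrow> (real ^ 3 \<Rightarrow> real ^ 3) \<Rightarrow> bool" where
  "rotation_about_line a u g \<longleftrightarrow>
     u \<noteq> 0 \<and> (\<exists>R :: real ^ 3 ^ 3. rotation_matrix R \<and> R *v u = u \<and> (\<forall>x. g x = a + R *v (x - a)))"

definition two_fold_rotation :: "(real ^ 3 \<Rightarrow> real ^ 3) \<Rightarrow> bool" where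
  "two_fold_rotation g \<longleftrightarrow> (\<exists>a u. rotation_about_line a u g) \<and> g \<noteq> id \<and> g \<circ> g = id"

definition has_two_fold_rotational_symmetry :: "'v set set \<Rightarrow> ('v \<Rightarrow> real ^ 3) \<Rightarrow> bool" where
  "has_two_fold_rotational_symmetry \<Delta> \<psi> \<longleftrightarrow>
     (\<exists>g \<alpha>. two_fold_rotation g \<and> geometric_symmetry \<Delta> \<psi> g \<alpha> \<and> (\<exists>v\<in>vertices \<Delta>. \<alpha> v \<noteq> v))"

end

theory Submission
  imports Defs
begin

text \<open>A bistellar move changes the underlying space only by a piecewise linear homeomorphism, written
  explicitly in barycentric coordinates. A triangulation of the connected sum of four projective planes
  with 19 vertices is glued from copies of the antipodal quotient of a triangulated cube surface; moves
  reduce it to 10 vertices, and a chain of edge flips then passes through 112 symmetric triangulations.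
  Each of these comes with integer coordinates of its vertices that are invariant under the half turn
  \<open>(x, y, z) \<mapsto> (- x, - y, z)\<close>. The realization is locally injective if in the star of every vertex the cones
  over distinct link edges meet only in the cone over their common face, which is read off from signs of
  determinants. An integer built from the vertex degrees tells the 112 triangulations apart.\<close>

section \<open>Bistellar moves\<close>

text \<open>The definition of \<open>nonorientable_surface\<close> asks for an iterated connected
  sum, so a complex is recognised as N_4 only through a homeomorphism with a sum that has actually
  been built. Polyhedra with vertices in \<open>nat\<close> are already topologies on
  \<open>nat \<Rightarrow> real\<close>, so the polyhedron of the glued complex itself can be the
  required model surface. The number 19 is 7 + 3 * 4, since every further seven-vertex projective
  plane shares the three vertices of the gluing triangle. Labels 0 to 9 survive the reduction and 10
  to 18 disappear. Arranging the triangulations in a single chain makes the homeomorphism to each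
  one cheap: a few moves from its predecessor suffice. The invariant need not classify
  triangulations; it only has to take 112 values. Since \<open>card\<close> is 0 on infinite sets,
  the lower bound also requires a proof that there are finitely many isomorphism classes.\<close>

definition generated_complex :: "'v set set \<Rightarrow> 'v set set" where
  "generated_complex F = {\<sigma>. \<sigma> \<noteq> {} \<and> (\<exists>t\<in>F. \<sigma> \<subseteq> t)}"

abbreviation polyhedron :: "'v set set \<Rightarrow> ('v \<Rightarrow> real) topology" where
  "polyhedron F \<equiv> underlying_space (generated_complex F)"

definition support :: "('v \<Rightarrow> real) \<Rightarrow> 'v set" where
  "support x = {v. x v \<noteq> 0}"

lemma vertices_generated_complex: "vertices (generated_complex F) = \<Union>F"
proof
  show "vertices (generated_complex F) \<subseteq> \<Union>F" by (auto simp: vertices_def generated_complex_def)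
  have "{v} \<in> generated_complex F" if "v \<in> \<Union>F" for v using that by (auto simp: generated_complex_def)
  then show "\<Union>F \<subseteq> vertices (generated_complex F)" by (auto simp: vertices_def)
qed

text \<open>Membership can be tested on one facet: the sum over a facet containing the support is
  the total mass, and the value 1 excludes the empty support, which is not a face.\<close>

lemma mem_underlying_set_generated:
  assumes "finite (\<Union>F)"
  shows "x \<in> underlying_set (generated_complex F) \<longleftrightarrow>
    (\<forall>v. 0 \<le> x v) \<and> (\<exists>t\<in>F. support x \<subseteq> t \<and> sum x t = 1)"
proof -
  have eq: "sum x (\<Union>F) = sum x t" if "t \<in> F" "support x \<subseteq> t" for t
    using that assms by (intro sum.mono_neutral_right) (auto simp: support_def)
  have ne: "support x \<noteq> {}" if "sum x t = 1" for t
    using that by (metis (mono_tags) support_def sum.neutral empty_Collect_eq zero_neq_one)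
  have "support x \<in> generated_complex F \<and> sum x (\<Union>F) = 1 \<longleftrightarrow> (\<exists>t\<in>F. support x \<subseteq> t \<and> sum x t = 1)"
    using eq ne unfolding generated_complex_def by fastforce
  then show ?thesis
    unfolding underlying_set_def vertices_generated_complex by (simp flip: support_def)
qed

lemma continuous_on_Min_image:
  assumes "finite A" "A \<noteq> {}" "\<And>v. v \<in> A \<Longrightarrow> continuous_on S (f v)"
  shows "continuous_on S (\<lambda>x. Min ((\<lambda>v. f v x) ` A) :: real)"
  using assms
proof (induction A rule: finite_ne_induct)
  case (insert v A)
  have "(\<lambda>x. Min ((\<lambda>v. f v x) ` insert v A)) = (\<lambda>x. min (f v x) (Min ((\<lambda>v. f v x) ` A)))"
    using insert.hyps by simp
  with insert show ?case by (auto intro!: continuous_on_min)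
qed simp

text \<open>The piecewise linear homeomorphism between the two balls of a bistellar move moves along the
  vector from the barycentre of the simplex \<open>A\<close> to that of the simplex \<open>B\<close>.\<close>

definition slide :: "'v set \<Rightarrow> 'v set \<Rightarrow> ('v \<Rightarrow> real) \<Rightarrow> 'v \<Rightarrow> real" where
  "slide A B x v = x v + Min (x ` A) *
     ((if v \<in> B then real (card A) / real (card B) else 0) - (if v \<in> A then 1 else 0))"

lemma continuous_on_slide:
  assumes "finite A" "A \<noteq> {}"
  shows "continuous_on S (slide A B)"
  unfolding slide_def
  by (intro continuous_on_coordinatewise_then_product continuous_intros continuous_on_Min_image assms
      continuous_on_subset[OF continuous_on_product_coordinates subset_UNIV])

text \<open>The join of \<open>A\<close> with the boundary of \<open>B\<close> is to be replaced by
  the join of the boundary of \<open>A\<close> with \<open>B\<close>; \<open>R\<close> collects the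
  other facets. \<open>RA\<close> says that no further facet contains \<open>A\<close>,
  \<open>RB\<close> that the new simplex \<open>B\<close> is not yet a face.\<close>

locale bistellar =
  fixes A B :: "'v set" and R :: "'v set set"
  assumes fin: "finite A" "finite B" "finite (\<Union>R)" and ne: "A \<noteq> {}" "B \<noteq> {}" and disj: "A \<inter> B = {}"
    and RA: "\<And>t. t \<in> R \<Longrightarrow> \<not> A \<subseteq> t" and RB: "\<And>t. t \<in> R \<Longrightarrow> \<not> B \<subseteq> t"
begin

definition before :: "'v set set" where "before = R \<union> (\<lambda>b. A \<union> B - {b}) ` B"
definition after :: "'v set set" where "after = R \<union> (\<lambda>a. A \<union> B - {a}) ` A"

lemma finite_before: "finite (\<Union>before)" and finite_after: "finite (\<Union>after)"
  using fin by (auto simp: before_def after_def)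

text \<open>Before the move some coordinate in \<open>B\<close> vanishes. Moving by the least
  coordinate \<open>m\<close> on \<open>A\<close> makes one in \<open>A\<close> vanish and raises
  those in \<open>B\<close> by \<open>m * k\<close>. The least coordinate on \<open>B\<close> is
  then exactly \<open>m * k\<close>, and from it the reverse slide reads off how far to go
  back.\<close>

lemma slide_in:
  assumes "x \<in> underlying_set (generated_complex before)"
  shows "slide A B x \<in> underlying_set (generated_complex after)"
    and "slide B A (slide A B x) = x"
proof -
  from assms obtain t where pos: "\<And>v. 0 \<le> x v" and t: "t \<in> before" "support x \<subseteq> t" "sum x t = 1"
    using mem_underlying_set_generated[OF finite_before] by auto
  have finU: "finite (A \<union> B \<union> \<Union>R)" and tU: "t \<subseteq> A \<union> B \<union> \<Union>R"
    using fin t by (auto simp: before_def)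
  define m where "m = Min (x ` A)"
  have m_le: "m \<le> x a" if "a \<in> A" for a using that fin by (simp add: m_def)
  have "m \<in> x ` A" unfolding m_def using fin ne by (intro Min_in) auto
  then obtain a0 where a0: "a0 \<in> A" "x a0 = m" by auto
  have m0: "0 \<le> m" using a0(2) pos[of a0] by simp
  have notB: "\<not> B \<subseteq> t" using t RB disj by (auto simp: before_def)
  then obtain b0 where b0: "b0 \<in> B" "x b0 = 0" using t(2) by (auto simp: support_def)
  have cA: "card A > 0" and cB: "card B > 0" using fin ne by (auto simp: card_gt_0_iff)
  let ?y = "slide A B x"
  \<comment> \<open>This factor preserves the total mass: \<open>m\<close> is lost
    \<open>card A\<close> times and \<open>m * k\<close> is gained \<open>card B\<close>
    times.\<close>
  define k where "k = real (card A) / real (card B)"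
  have k0: "k > 0" using cA cB by (simp add: k_def)
  have yA: "?y v = x v - m" if "v \<in> A" for v using that disj by (auto simp: slide_def m_def)
  have yB: "?y v = x v + m * k" if "v \<in> B" for v using that disj by (auto simp: slide_def m_def k_def)
  have yN: "?y v = x v" if "v \<notin> A" "v \<notin> B" for v using that by (auto simp: slide_def)
  have ypos: "0 \<le> ?y v" for v
    using yA[of v] yB[of v] yN[of v] m_le[of v] pos[of v] m0 k0
    by (cases "v \<in> A"; cases "v \<in> B") auto
  have sumU: "sum ?y (A \<union> B \<union> \<Union>R) = 1"
  proof -
    let ?U = "A \<union> B \<union> \<Union>R"
    have U: "?U \<inter> A = A" "?U \<inter> B = B" by auto
    have "sum x ?U = sum x t"
      using t tU finU by (intro sum.mono_neutral_right) (auto simp: support_def)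
    moreover have "(\<Sum>v\<in>?U. if v \<in> B then k else 0) = real (card A)"
      using cB sum.inter_restrict[OF finU, of "\<lambda>_. k" B] by (simp add: U k_def)
    moreover have "(\<Sum>v\<in>?U. if v \<in> A then 1 else 0) = real (card A)"
      using sum.inter_restrict[OF finU, of "\<lambda>_. 1::real" A] by (simp add: U)
    ultimately show ?thesis
      using t(3) unfolding k_def by (simp add: slide_def sum.distrib sum_subtractf flip: sum_distrib_left)
  qed
  have "\<exists>t'\<in>after. support ?y \<subseteq> t'"
  \<comment> \<open>For \<open>m = 0\<close> the point stays and its support already misses
    \<open>a0\<close>. Otherwise all of \<open>A\<close> lies in the support, so by
    \<open>RA\<close> the facet is one of those being replaced.\<close>
  proof (cases "m = 0")
    case True
    then have yx: "?y = x" by (auto simp: slide_def m_def)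
    show ?thesis
    proof (cases "t \<in> R")
      case False
      then obtain b where "t = A \<union> B - {b}" using t by (auto simp: before_def)
      then have "support x \<subseteq> A \<union> B - {a0}" using t a0 True by (auto simp: support_def)
      then show ?thesis using yx a0 by (auto simp: after_def)
    qed (use yx t in \<open>auto simp: after_def\<close>)
  next
    case False
    then have "A \<subseteq> t" using m_le m0 t(2) by (force simp: support_def)
    then obtain b where "t = A \<union> B - {b}" using t RA by (auto simp: before_def)
    then have "support ?y \<subseteq> A \<union> B - {a0}" using t yA[of a0] a0 yN by (force simp: support_def)
    then show ?thesis using a0 by (auto simp: after_def)
  qed
  then obtain t' where t': "t' \<in> after" "support ?y \<subseteq> t'" by auto
  then have "t' \<subseteq> A \<union> B \<union> \<Union>R" by (auto simp: after_def)
  then have "sum ?y t' = 1"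
    using sumU t' finU by (subst (asm) sum.mono_neutral_right[of _ t']) (auto simp: support_def)
  then show "?y \<in> underlying_set (generated_complex after)"
    using t' ypos mem_underlying_set_generated[OF finite_after] by auto
  have "Min (?y ` B) = m * k"
    using fin b0 pos k0 m0 yB by (intro Min_eqI) (force simp: image_iff)+
  then show "slide B A ?y = x"
    using yA yB yN disj cA cB by (intro ext) (auto simp: slide_def[of B] k_def)
qed

end

text \<open>The data are symmetric in \<open>A\<close> and \<open>B\<close>; after the rewrites,
  \<open>slide_in\<close> of the reversed locale is the statement about the inverse move.\<close>

sublocale bistellar \<subseteq> rev: bistellar B A R
  rewrites "rev.before = after" and "rev.after = before"
proof -
  show *: "bistellar B A R" using fin ne disj RA RB by unfold_locales auto
  show "bistellar.before B A R = after" "bistellar.after B A R = before"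
    by (auto simp: bistellar.before_def[OF *] bistellar.after_def[OF *] before_def after_def Un_commute)
qed

lemma (in bistellar) homeomorphic_move: "polyhedron before homeomorphic_space polyhedron after"
proof -
  have "continuous_map (polyhedron before) (polyhedron after) (slide A B)"
    using slide_in(1) continuous_on_slide[OF fin(1) ne(1)]
    unfolding underlying_space_def by (auto simp: continuous_map_in_subtopology)
  moreover have "continuous_map (polyhedron after) (polyhedron before) (slide B A)"
    using rev.slide_in(1) continuous_on_slide[OF fin(2) ne(2)]
    unfolding underlying_space_def by (auto simp: continuous_map_in_subtopology)
  ultimately show ?thesis
    using slide_in(2) rev.slide_in(2)
    unfolding homeomorphic_space_def homeomorphic_maps_def by (auto simp: underlying_space_def)
qed

section \<open>Compactness and discs\<close>

text \<open>With the bounds on coordinates written out, each piece is a closed subset of a cube in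
  the function space, the form in which compactness can be read off.\<close>

lemma underlying_set_eq_UN:
  assumes "finite (\<Union>F)"
  shows "underlying_set (generated_complex F) =
    (\<Union>t\<in>F. {x. (\<forall>v. x v \<in> {0..1}) \<and> (\<forall>v. v \<notin> t \<longrightarrow> x v = 0) \<and> sum x t = 1})"
proof -
  have "x v \<le> 1" if "\<forall>v. 0 \<le> x v" "support x \<subseteq> t" "sum x t = 1" "t \<in> F" for x v t
  proof (cases "v \<in> t")
    case True
    have "finite t" using that(4) assms by (meson Union_upper finite_subset)
    then have "x v \<le> sum x t" using True that(1) by (intro member_le_sum) auto
    then show ?thesis using that(3) by simp
  next
    case False
    then have "x v = 0" using that(2) by (auto simp: support_def)
    then show ?thesis by simp
  qed
  moreover have "support x \<subseteq> t \<longleftrightarrow> (\<forall>v. v \<notin> t \<longrightarrow> x v = 0)" for x :: "'a \<Rightarrow> real" and t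
    by (auto simp: support_def)
  ultimately show ?thesis
    unfolding mem_underlying_set_generated[OF assms] set_eq_iff UN_iff mem_Collect_eq atLeastAtMost_iff
    by meson
qed

text \<open>Tychonoff's theorem for a power of the unit interval.\<close>

lemma compact_cube: "compact {x :: 'v \<Rightarrow> real. \<forall>v. x v \<in> {0..1}}"
proof -
  have "compactin (product_topology (\<lambda>_::'v. euclidean) UNIV) (PiE UNIV (\<lambda>_. {0..1::real}))"
    by (simp add: compactin_PiE)
  moreover have "PiE UNIV (\<lambda>_. {0..1}) = {x :: 'v \<Rightarrow> real. \<forall>v. x v \<in> {0..1}}"
    by (auto simp: PiE_iff)
  ultimately show ?thesis by (simp add: euclidean_product_topology)
qed

lemma continuous_on_coordinate: "continuous_on S (\<lambda>x :: 'v \<Rightarrow> real. x v)"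
  by (rule continuous_on_subset[OF continuous_on_product_coordinates subset_UNIV])

lemma compact_underlying_set:
  assumes "finite F" "finite (\<Union>F)"
  shows "compact (underlying_set (generated_complex F))"
proof -
  have "compact {x :: 'a \<Rightarrow> real. (\<forall>v. x v \<in> {0..1}) \<and> (\<forall>v. v \<notin> t \<longrightarrow> x v = 0) \<and> sum x t = 1}" for t
  proof -
    have "closed {x :: 'a \<Rightarrow> real. \<forall>v. v \<notin> t \<longrightarrow> x v = 0}"
      by (intro closed_Collect_all closed_Collect_imp closed_Collect_eq continuous_on_coordinate) auto
    moreover have "closed {x :: 'a \<Rightarrow> real. sum x t = 1}"
      by (intro closed_Collect_eq continuous_on_sum continuous_on_coordinate) auto
    ultimately have "compact ({x :: 'a \<Rightarrow> real. \<forall>v. x v \<in> {0..1}} \<inter>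
        ({x. \<forall>v. v \<notin> t \<longrightarrow> x v = 0} \<inter> {x. sum x t = 1}))"
      by (intro compact_Int_closed compact_cube closed_Int)
    then show ?thesis by (simp add: Collect_conj_eq)
  qed
  then show ?thesis
    unfolding underlying_set_eq_UN[OF assms(2)] using assms(1) by (intro compact_UN) auto
qed

lemma Hausdorff_space_polyhedron:
  "Hausdorff_space (underlying_space (\<Delta> :: 'v::countable set set))"
  by (simp add: underlying_space_def Hausdorff_space_subtopology)

text \<open>The gauge of the triangle with vertices \<open>(2, -1)\<close>, \<open>(-1, 2)\<close> and \<open>(-1, -1)\<close>; the radial map
  below carries the unit disc onto that triangle.\<close>

definition gauge3 :: "complex \<Rightarrow> real" where
  "gauge3 z = max (max (- Re z) (- Im z)) (Re z + Im z)"

definition radial :: "complex \<Rightarrow> complex" where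
  "radial z = of_real (norm z / gauge3 z) * z"

definition radial_inv :: "complex \<Rightarrow> complex" where
  "radial_inv w = of_real (gauge3 w / norm w) * w"

lemma gauge3_pos: "z \<noteq> 0 \<Longrightarrow> 0 < gauge3 z"
  by (auto simp: gauge3_def complex_eq_iff max_def)

lemma gauge3_nonneg: "0 \<le> gauge3 z"
  by (auto simp: gauge3_def max_def)

text \<open>Where the gauge is 1, real and imaginary part lie between -1 and 2, so the norm is at
  most 4. The crude bound serves for the continuity of \<open>radial\<close> at 0.\<close>

lemma norm_le_gauge3: "norm z \<le> 4 * gauge3 z"
  using complex_Re_le_cmod cmod_le[of z] by (auto simp: gauge3_def max_def)

lemma gauge3_scale: "0 \<le> r \<Longrightarrow> gauge3 (of_real r * z) = r * gauge3 z"
  by (simp add: gauge3_def max_mult_distrib_left distrib_left)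

lemma gauge3_0 [simp]: "gauge3 0 = 0"
  by (simp add: gauge3_def)

lemma gauge3_radial: "gauge3 (radial z) = norm z"
  using gauge3_pos[of z] gauge3_nonneg[of z]
  by (cases "z = 0") (auto simp: radial_def gauge3_scale simp del: of_real_divide)

lemma radial_inv_radial: "radial_inv (radial z) = z"
proof (cases "z = 0")
  case False
  have "norm (radial z) = norm z * norm z / gauge3 z"
    using gauge3_nonneg[of z] by (simp add: radial_def norm_mult norm_divide)
  then show ?thesis
    using False gauge3_pos[OF False] unfolding radial_inv_def gauge3_radial
    by (simp add: radial_def)
qed (simp add: radial_def radial_inv_def)

lemma norm_radial_inv: "norm (radial_inv w) = gauge3 w"
  using gauge3_nonneg[of w]
  by (cases "w = 0") (auto simp: radial_inv_def norm_mult norm_divide gauge3_def)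

lemma radial_radial_inv: "radial (radial_inv w) = w"
proof (cases "w = 0")
  case False
  have "gauge3 (radial_inv w) = gauge3 w * gauge3 w / norm w"
    using gauge3_nonneg[of w] by (simp add: radial_inv_def gauge3_scale flip: of_real_divide)
  then show ?thesis
    using False gauge3_pos[OF False] unfolding radial_def norm_radial_inv
    by (simp add: radial_inv_def)
qed (simp add: radial_def radial_inv_def)

lemma continuous_on_gauge3: "continuous_on S gauge3"
  unfolding gauge3_def by (intro continuous_intros)

lemma continuous_on_radial: "continuous_on S radial"
proof -
  have "isCont radial z" for z
  proof (cases "z = 0")
    case True
    have "norm (radial w) \<le> 4 * norm w" for w
    proof (cases "w = 0")
      case False
      have "norm (radial w) = norm w * (norm w / gauge3 w)"
        using gauge3_nonneg[of w] by (simp add: radial_def norm_mult norm_divide)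
      also have "\<dots> \<le> norm w * 4"
        using norm_le_gauge3[of w] gauge3_pos[OF False] by (intro mult_left_mono) (auto simp: divide_simps)
      finally show ?thesis by simp
    qed (simp add: radial_def)
    moreover have "((\<lambda>w::complex. 4 * norm w) \<longlongrightarrow> 4 * norm (0::complex)) (at 0)"
      by (intro tendsto_intros)
    ultimately have "(radial \<longlongrightarrow> 0) (at 0)"
      by (intro Lim_null_comparison[of radial "\<lambda>w. 4 * norm w"]) auto
    then show ?thesis using True by (simp add: isCont_def radial_def)
  next
    case False
    have "isCont gauge3 z" using continuous_on_gauge3[of UNIV] by (simp add: continuous_on_eq_continuous_at)
    then show ?thesis
      unfolding radial_def using gauge3_pos[OF False]
      by (intro continuous_intros) auto
  qed
  then show ?thesis by (simp add: continuous_at_imp_continuous_on)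
qed

definition closed_face :: "'v set \<Rightarrow> ('v \<Rightarrow> real) set" where
  "closed_face t = {x. (\<forall>v. 0 \<le> x v) \<and> support x \<subseteq> t \<and> sum x t = 1}"

text \<open>The disc is carried radially to a plane triangle and from there affinely to barycentric
  coordinates. Describing the image of the open disc by nonzero coordinates allows the removed disc
  to be recognised later from supports.\<close>

lemma triangle_disc:
  fixes t :: "'v set"
  assumes "card t = 3"
  obtains d :: "complex \<Rightarrow> 'v \<Rightarrow> real" where "continuous_on (cball 0 1) d" "inj_on d (cball 0 1)"
    "d ` cball 0 1 = closed_face t" "d ` ball 0 1 = {x \<in> closed_face t. \<forall>v\<in>t. x v \<noteq> 0}"
proof -
  obtain a b c where t: "t = {a,b,c}" and dist: "a \<noteq> b" "a \<noteq> c" "b \<noteq> c"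
    using assms by (auto simp: card_3_iff)
  \<comment> \<open>The origin goes to the barycentre, and the three numerators are nonnegative
    exactly where \<open>gauge3 w \<le> 1\<close>.\<close>
  define l where "l = (\<lambda>w v. if v = a then (1 + Re w) / 3 else if v = b then (1 + Im w) / 3
    else if v = c then (1 - Re w - Im w) / 3 else 0)"
  define d where "d = l \<circ> radial"
  have lin: "l w \<in> closed_face t \<longleftrightarrow> gauge3 w \<le> 1" for w
  proof -
    have "support (l w) \<subseteq> t" "sum (l w) t = 1"
      using dist by (auto simp: t l_def support_def field_simps)
    then show ?thesis
      using dist by (auto simp: closed_face_def l_def gauge3_def field_simps split: if_splits)
  qed
  have lopen: "(\<forall>v\<in>t. l w v \<noteq> 0) \<longleftrightarrow> gauge3 w < 1" if "gauge3 w \<le> 1" for w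
    using that dist by (auto simp: t l_def gauge3_def max_def field_simps split: if_splits)
  have lsurj: "\<exists>w. x = l w" if "x \<in> closed_face t" for x
  proof -
    have "x = l (Complex (3 * x a - 1) (3 * x b - 1))"
      using that dist by (auto simp: closed_face_def t l_def support_def field_simps intro!: ext)
    then show ?thesis by blast
  qed
  have linj: "w = w'" if "l w = l w'" for w w'
    using fun_cong[OF that, of a] fun_cong[OF that, of b] dist by (simp add: l_def complex_eq_iff)
  have "continuous_on (cball 0 1) d"
    unfolding d_def l_def o_def
    by (intro continuous_on_coordinatewise_then_product, rename_tac v, case_tac "v = a"; case_tac "v = b"; case_tac "v = c")
       (auto intro!: continuous_intros continuous_on_radial)
  moreover have "inj_on d (cball 0 1)"
    by (rule inj_onI) (metis d_def comp_apply linj radial_inv_radial)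
  moreover have "d ` cball 0 1 = closed_face t"
  proof (intro equalityI subsetI)
    fix x assume "x \<in> closed_face t"
    then obtain w where w: "x = l w" "gauge3 w \<le> 1" using lsurj lin by metis
    then have "x = d (radial_inv w)" "norm (radial_inv w) \<le> 1"
      by (auto simp: d_def radial_radial_inv norm_radial_inv)
    then show "x \<in> d ` cball 0 1" by auto
  qed (auto simp: d_def lin gauge3_radial)
  moreover have "d ` ball 0 1 = {x \<in> closed_face t. \<forall>v\<in>t. x v \<noteq> 0}"
  proof (intro equalityI subsetI)
    fix x assume x: "x \<in> {x \<in> closed_face t. \<forall>v\<in>t. x v \<noteq> 0}"
    then obtain w where w: "x = l w" "gauge3 w \<le> 1" using lsurj lin by blast
    then have "x = d (radial_inv w)" "norm (radial_inv w) < 1"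
      using lopen x by (auto simp: d_def radial_radial_inv norm_radial_inv)
    then show "x \<in> d ` ball 0 1" by auto
  next
    fix x assume "x \<in> d ` ball 0 1"
    then obtain z where "norm z < 1" "x = l (radial z)" by (auto simp: d_def)
    then show "x \<in> {x \<in> closed_face t. \<forall>v\<in>t. x v \<noteq> 0}"
      using lin[of "radial z"] lopen[of "radial z"] by (simp add: gauge3_radial)
  qed
  ultimately show thesis by (rule that)
qed

section \<open>Connected sums\<close>

lemma sum_eq_if_support_subset:
  assumes "finite s" "finite t" "support x \<subseteq> s" "support x \<subseteq> t"
  shows "sum x s = sum x t"
proof -
  have "sum x s = sum x (s \<inter> t)" "sum x t = sum x (s \<inter> t)"
    using assms by (auto intro!: sum.mono_neutral_right simp: support_def)
  then show ?thesis by simp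
qed

text \<open>Both polyhedra lie in one function space and overlap exactly in the triangle
  \<open>t0\<close>. One disc \<open>d\<close> therefore serves for both, and gluing merely forgets
  the side: the quotient map is \<open>snd\<close>. The hypothesis \<open>edges\<close> keeps the
  boundary circle of \<open>t0\<close> in the new complex after the triangle has gone.\<close>

lemma connected_sum_polyhedra:
  fixes F G :: "'v::countable set set"
  assumes fin: "finite F" "finite G" and card3: "\<And>t. t \<in> F \<union> G \<Longrightarrow> card t = 3"
    and t0: "t0 \<in> F" "t0 \<in> G" "\<Union>F \<inter> \<Union>G = t0"
    and edges: "\<And>v. v \<in> t0 \<Longrightarrow> \<exists>t\<in>F - {t0}. t0 - {v} \<subseteq> t"
  shows "connected_sum (polyhedron F) (polyhedron G) (polyhedron (F \<union> G - {t0}))"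
proof -
  let ?H = "F \<union> G - {t0}"
  let ?XF = "underlying_set (generated_complex F)" and ?XG = "underlying_set (generated_complex G)"
  let ?XH = "underlying_set (generated_complex ?H)"
  have fint: "finite t" if "t \<in> F \<union> G" for t using card3[OF that] card.infinite by fastforce
  then have finU: "finite (\<Union>F)" "finite (\<Union>G)" "finite (\<Union>?H)" using fin by auto
  note mem = mem_underlying_set_generated[OF finU(1)] mem_underlying_set_generated[OF finU(2)]
    mem_underlying_set_generated[OF finU(3)]
  have subt: "t = t0" if "t \<in> F \<union> G" "t0 \<subseteq> t" for t
    using card3[OF that(1)] card3[of t0] fint[OF that(1)] t0 that(2) by (metis UnI1 card_subset_eq)
  have "card t0 = 3" using card3 t0 by blast
  then obtain d :: "complex \<Rightarrow> 'v \<Rightarrow> real" where d: "continuous_on (cball 0 1) d" "inj_on d (cball 0 1)"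
    "d ` cball 0 1 = closed_face t0" "d ` ball 0 1 = {x \<in> closed_face t0. \<forall>v\<in>t0. x v \<noteq> 0}"
    by (rule triangle_disc)
  have sub: "closed_face t0 \<subseteq> ?XF" "closed_face t0 \<subseteq> ?XG"
    using t0(1,2) unfolding subset_iff mem closed_face_def mem_Collect_eq by blast+
  have emb: "embedding_map (top_of_set (cball 0 1)) (underlying_space \<Delta>) d"
    if "closed_face t0 \<subseteq> underlying_set \<Delta>" for \<Delta>
  proof (rule continuous_imp_embedding_map)
    show "continuous_map (top_of_set (cball 0 1)) (underlying_space \<Delta>) d"
      unfolding underlying_space_def continuous_map_in_subtopology using d(1,3) that by auto
  qed (use d(2) in \<open>simp_all add: compact_space_subtopology Hausdorff_space_polyhedron\<close>)
  \<comment> \<open>No facet other than \<open>t0\<close> contains all of \<open>t0\<close>, because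
    all facets have three vertices.\<close>
  have openface: "x \<in> d ` ball 0 1 \<longleftrightarrow> t0 \<subseteq> support x" if xFG: "x \<in> ?XF \<union> ?XG" for x
  proof
    assume "t0 \<subseteq> support x"
    moreover obtain t where "t \<in> F \<union> G" "support x \<subseteq> t" "sum x t = 1" "\<forall>v. 0 \<le> x v"
      using xFG unfolding Un_iff mem by blast
    ultimately show "x \<in> d ` ball 0 1"
      using subt[of t] unfolding d(4) closed_face_def support_def by auto
  qed (auto simp: d(4) support_def)
  have H_eq: "?XH = (?XF \<union> ?XG) - d ` ball 0 1"
  proof (intro equalityI subsetI)
    fix x assume "x \<in> ?XH"
    then obtain t where t: "t \<in> F \<union> G" "t \<noteq> t0" "support x \<subseteq> t" "sum x t = 1" "\<forall>v. 0 \<le> x v"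
      unfolding mem by blast
    then have "x \<in> ?XF \<union> ?XG" unfolding Un_iff mem by blast
    moreover have "\<not> t0 \<subseteq> support x" using t subt by blast
    ultimately show "x \<in> (?XF \<union> ?XG) - d ` ball 0 1" using openface by blast
  next
    fix x assume x: "x \<in> (?XF \<union> ?XG) - d ` ball 0 1"
    then obtain t where t: "t \<in> F \<union> G" "support x \<subseteq> t" "sum x t = 1" "\<forall>v. 0 \<le> x v"
      unfolding Un_iff Diff_iff mem by blast
    have "\<exists>t'\<in>?H. support x \<subseteq> t'"
    \<comment> \<open>A point of \<open>t0\<close> outside the open disc lies on an edge, and
      \<open>edges\<close> provides another triangle with that edge.\<close>
    proof (cases "t = t0")
      case True
      then obtain v where "v \<in> t0" "v \<notin> support x" using x openface by blast
      then show ?thesis using edges[of v] t True by blast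
    qed (use t in auto)
    then obtain t' where t': "t' \<in> ?H" "support x \<subseteq> t'" by blast
    have "sum x t' = 1" using sum_eq_if_support_subset[of t t' x] t t' fint by simp
    then show "x \<in> ?XH" using t(4) t' unfolding mem by blast
  qed
  define Y where "Y = punctured_sum (polyhedron F) d (polyhedron G) d"
  have subtop: "subtopology (polyhedron F) (topspace (polyhedron F) - d ` ball 0 1) = top_of_set (?XF - d ` ball 0 1)"
    "subtopology (polyhedron G) (topspace (polyhedron G) - d ` ball 0 1) = top_of_set (?XG - d ` ball 0 1)"
    by (auto simp: underlying_space_def subtopology_subtopology Int_Diff intro!: arg_cong[of _ _ "subtopology _"])
  have Y: "Y = sum_topology (\<lambda>b. top_of_set ((if b then ?XF else ?XG) - d ` ball 0 1)) UNIV"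
    unfolding Y_def punctured_sum_def subtop by (rule arg_cong[of _ _ "\<lambda>X. sum_topology X UNIV"]) auto
  have topY: "topspace Y = {True} \<times> (?XF - d ` ball 0 1) \<union> {False} \<times> (?XG - d ` ball 0 1)"
    unfolding Y by (auto split: if_splits)
  \<comment> \<open>Outside the open triangle one of the three coordinates of \<open>t0\<close>
    vanishes, which is a closed condition.\<close>
  have closed_part: "compact (X - d ` ball 0 1)" if "X = ?XF \<or> X = ?XG" for X
  proof -
    have "X - d ` ball 0 1 = X \<inter> (\<Union>v\<in>t0. {x. x v = 0})"
      using that openface by (auto simp: support_def)
    moreover have "closed (\<Union>v\<in>t0. {x :: 'v \<Rightarrow> real. x v = 0})"
      using fint t0 by (intro closed_UN ballI closed_Collect_eq continuous_on_coordinate) auto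
    ultimately show ?thesis
      using that compact_underlying_set[OF fin(1) finU(1)] compact_underlying_set[OF fin(2) finU(2)]
      by (auto intro: compact_Int_closed)
  qed
  have cont: "continuous_map Y euclidean snd"
    unfolding continuous_map_def
  proof (intro conjI allI impI)
    fix U :: "('v \<Rightarrow> real) set" assume "openin euclidean U"
    then have "openin (top_of_set S) (S \<inter> U)" for S by (auto simp: openin_open)
    moreover have "{x. (b, x) \<in> {p \<in> topspace Y. snd p \<in> U}} = ((if b then ?XF else ?XG) - d ` ball 0 1) \<inter> U" for b
      by (auto simp: topY)
    ultimately show "openin Y {p \<in> topspace Y. snd p \<in> U}"
      unfolding Y openin_sum_topology by (auto simp: topY)
  qed auto
  have "compactin Y (Pair b ` ((if b then ?XF else ?XG) - d ` ball 0 1))" for b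
  proof -
    let ?S = "(if b then ?XF else ?XG) - d ` ball 0 1"
    have "compactin (top_of_set ?S) ?S" using closed_part by (auto simp: compactin_subtopology)
    then show ?thesis
      unfolding Y by (rule image_compactin) (rule continuous_map_component_injection, simp)
  qed
  from compactin_Un[OF this[of True] this[of False]] have comp: "compact_space Y"
    unfolding compact_space_def by (rule back_subst[of "compactin Y"]) (auto simp: topY)
  \<comment> \<open>A continuous surjection from a compact space onto a Hausdorff space is a
    quotient map.\<close>
  have "quotient_map Y (polyhedron ?H) snd"
  proof (rule continuous_imp_quotient_map)
    show "continuous_map Y (polyhedron ?H) snd"
      using cont unfolding underlying_space_def continuous_map_in_subtopology H_eq by (auto simp: topY)
    show "snd ` topspace Y = topspace (polyhedron ?H)"
      unfolding underlying_space_def topspace_euclidean_subtopology H_eq topY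
      by (simp add: image_Un Un_Diff)
  qed (use comp Hausdorff_space_polyhedron in auto)
  moreover have "snd p = snd p' \<longleftrightarrow> p = p' \<or>
        (\<exists>z\<in>sphere 0 1. p = (True, d z) \<and> p' = (False, d z)) \<or>
        (\<exists>z\<in>sphere 0 1. p = (False, d z) \<and> p' = (True, d z))"
    if pp: "p \<in> topspace Y" "p' \<in> topspace Y" for p p'
  proof -
    \<comment> \<open>A point on both sides has its support in both vertex sets, hence in
      \<open>t0\<close>; it is on the closed disc but not in the open one.\<close>
    have boundary: "\<exists>z\<in>sphere 0 1. x = d z" if x: "x \<in> ?XF" "x \<in> ?XG" "x \<notin> d ` ball 0 1" for x
    proof -
      obtain t t' where t: "t \<in> F" "support x \<subseteq> t" "sum x t = 1" "\<forall>v. 0 \<le> x v" "t' \<in> G" "support x \<subseteq> t'"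
        using x unfolding mem by blast
      then have "support x \<subseteq> t0" using t0 by blast
      moreover have "sum x t0 = 1"
        using sum_eq_if_support_subset[of t t0 x] calculation t fint t0(1) by simp
      ultimately have "x \<in> closed_face t0" using t by (auto simp: closed_face_def)
      then have "x \<in> d ` cball 0 1" using d(3) by simp
      then obtain z where z: "z \<in> cball 0 1" "x = d z" by blast
      moreover have "z \<notin> ball 0 1" using x(3) z by blast
      ultimately show ?thesis by (intro bexI[of _ z]) auto
    qed
    obtain b x b' x' where p: "p = (b, x)" "p' = (b', x')" by (metis surj_pair)
    show ?thesis using pp boundary[of x] unfolding topY p by (cases b; cases b') auto
  qed
  ultimately show ?thesis
    unfolding connected_sum_def Y_def using emb[OF sub(1)] emb[OF sub(2)] by blast
qed

lemma quotient_map_homeomorphic: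
  assumes "quotient_map X Y q" "homeomorphic_map Y Z h"
  shows "quotient_map X Z (h \<circ> q)"
  using assms quotient_map_compose by (auto simp: homeomorphic_map_def)

lemma projective_plane_homeomorphic:
  assumes "projective_plane X" "X homeomorphic_space Y"
  shows "projective_plane Y"
proof -
  from assms(2) obtain h where h: "homeomorphic_map X Y h" by (auto simp: homeomorphic_space)
  from assms(1) obtain q where q: "quotient_map (top_of_set (sphere (0 :: real ^ 3) 1)) X q"
    "\<forall>x \<in> sphere 0 1. \<forall>y \<in> sphere 0 1. q x = q y \<longleftrightarrow> y = x \<or> y = - x"
    by (auto simp: projective_plane_def)
  have "q x \<in> topspace X" if "x \<in> sphere 0 1" for x
    using quotient_imp_surjective_map[OF q(1)] that by auto
  then have "(h \<circ> q) x = (h \<circ> q) y \<longleftrightarrow> q x = q y" if "x \<in> sphere 0 1" "y \<in> sphere 0 1" for x y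
    using homeomorphic_imp_injective_map[OF h] that by (auto simp: inj_on_def)
  then show ?thesis
    unfolding projective_plane_def using quotient_map_homeomorphic[OF q(1) h] q(2) by metis
qed

section \<open>The projective plane with seven vertices\<close>

definition cube_norm :: "real \<Rightarrow> real \<Rightarrow> real \<Rightarrow> real" where
  "cube_norm x y z = max \<bar>x\<bar> (max \<bar>y\<bar> \<bar>z\<bar>)"

text \<open>The boundary of the cube \<open>[-1, 1]\<^sup>3\<close>, each face coned from its centre, is a triangulated sphere
  invariant under \<open>p \<mapsto> - p\<close>. In the quotient the numbers 0, 1, 2 are the face centres \<open>\<plusminus>e\<^sub>i\<close> and
  3, 4, 5, 6 the pairs of opposite corners; the following are barycentric coordinates, up to scaling.\<close>

definition cube_coord :: "real \<Rightarrow> real \<Rightarrow> real \<Rightarrow> nat \<Rightarrow> real" where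
  "cube_coord x y z v =
    (if v = 0 then 2 * max 0 (abs x - max (abs y) (abs z))
     else if v = 1 then 2 * max 0 (abs y - max (abs x) (abs z))
     else if v = 2 then 2 * max 0 (abs z - max (abs x) (abs y))
     else if v = 3 then max 0 (abs (x + y + z) - cube_norm x y z)
     else if v = 4 then max 0 (abs (x + y - z) - cube_norm x y z)
     else if v = 5 then max 0 (abs (x - y + z) - cube_norm x y z)
     else if v = 6 then max 0 (abs (x - y - z) - cube_norm x y z)
     else 0)"

definition rp2_triangles :: "nat set set" where
  "rp2_triangles = {{0,3,4}, {0,4,6}, {0,5,6}, {0,3,5}, {1,3,4}, {1,4,5}, {1,5,6}, {1,3,6},
     {2,3,5}, {2,4,5}, {2,4,6}, {2,3,6}}"

lemma cube_coord_nonneg: "0 \<le> cube_coord x y z v"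
  by (simp add: cube_coord_def)

text \<open>Here \<open>m\<close> is the cube norm, attained by one coordinate, and \<open>u\<close>
  a signed sum of the other two. Where \<open>m + u\<close> is negative, both positive parts vanish
  because \<open>abs u \<le> 2 * m\<close>.\<close>

lemma max_abs_diff: "abs u \<le> 2 * m \<Longrightarrow> w = m + u \<or> w = - m - u \<Longrightarrow> max 0 (abs w - m) = max 0 (u :: real)"
  by (auto simp: abs_if max_def split: if_splits)

text \<open>On the cone over the face \<open>x = 1\<close> the corners 3, 4, 5, 6 are represented by
  (1,1,1), (1,1,-1), (1,-1,1), (1,-1,-1), and the general formulas become positive parts of linear
  forms in \<open>y\<close> and \<open>z\<close>.\<close>

lemma cube_coord_x:
  assumes "abs y \<le> x" "abs z \<le> x"
  shows "cube_coord x y z = (\<lambda>v. if v = 0 then 2 * (x - max (abs y) (abs z)) else if v = 3 then max 0 (y + z)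
     else if v = 4 then max 0 (y - z) else if v = 5 then max 0 (z - y) else if v = 6 then max 0 (- y - z) else 0)"
proof -
  have n: "cube_norm x y z = x" using assms by (auto simp: cube_norm_def)
  have a: "max 0 (abs x - max (abs y) (abs z)) = x - max (abs y) (abs z)"
    "max 0 (abs y - max (abs x) (abs z)) = 0"
    "max 0 (abs z - max (abs x) (abs y)) = 0"
    using assms by (auto simp: max_def)
  have c: "max 0 (abs (x + y + z) - x) = max 0 (y + z)"
    "max 0 (abs (x + y - z) - x) = max 0 (y - z)"
    "max 0 (abs (x - y + z) - x) = max 0 (z - y)"
    "max 0 (abs (x - y - z) - x) = max 0 (- y - z)"
    using assms by (auto intro!: max_abs_diff)
  show ?thesis unfolding cube_coord_def n a c by (intro ext) simp
qed

lemma cube_coord_y: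
  assumes "abs x \<le> y" "abs z \<le> y"
  shows "cube_coord x y z = (\<lambda>v. if v = 1 then 2 * (y - max (abs x) (abs z)) else if v = 3 then max 0 (x + z)
     else if v = 4 then max 0 (x - z) else if v = 5 then max 0 (- x - z) else if v = 6 then max 0 (z - x) else 0)"
proof -
  have n: "cube_norm x y z = y" using assms by (auto simp: cube_norm_def)
  have a: "max 0 (abs x - max (abs y) (abs z)) = 0"
    "max 0 (abs y - max (abs x) (abs z)) = y - max (abs x) (abs z)"
    "max 0 (abs z - max (abs x) (abs y)) = 0"
    using assms by (auto simp: max_def)
  have c: "max 0 (abs (x + y + z) - y) = max 0 (x + z)"
    "max 0 (abs (x + y - z) - y) = max 0 (x - z)"
    "max 0 (abs (x - y + z) - y) = max 0 (- x - z)"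
    "max 0 (abs (x - y - z) - y) = max 0 (z - x)"
    using assms by (auto intro!: max_abs_diff)
  show ?thesis unfolding cube_coord_def n a c by (intro ext) simp
qed

lemma cube_coord_z:
  assumes "abs x \<le> z" "abs y \<le> z"
  shows "cube_coord x y z = (\<lambda>v. if v = 2 then 2 * (z - max (abs x) (abs y)) else if v = 3 then max 0 (x + y)
     else if v = 4 then max 0 (- x - y) else if v = 5 then max 0 (x - y) else if v = 6 then max 0 (y - x) else 0)"
proof -
  have n: "cube_norm x y z = z" using assms by (auto simp: cube_norm_def)
  have a: "max 0 (abs x - max (abs y) (abs z)) = 0"
    "max 0 (abs y - max (abs x) (abs z)) = 0"
    "max 0 (abs z - max (abs x) (abs y)) = z - max (abs x) (abs y)"
    using assms by (auto simp: max_def)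
  have c: "max 0 (abs (x + y + z) - z) = max 0 (x + y)"
    "max 0 (abs (x + y - z) - z) = max 0 (- x - y)"
    "max 0 (abs (x - y + z) - z) = max 0 (x - y)"
    "max 0 (abs (x - y - z) - z) = max 0 (y - x)"
    using assms by (auto intro!: max_abs_diff)
  show ?thesis unfolding cube_coord_def n a c by (intro ext) simp
qed

lemma cube_norm_minus: "cube_norm (- x) (- y) (- z) = cube_norm x y z"
  by (simp add: cube_norm_def)

lemma cube_coord_minus: "cube_coord (- x) (- y) (- z) = cube_coord x y z"
proof -
  have "abs (- x + - y + - z) = abs (x + y + z)" "abs (- x + - y - - z) = abs (x + y - z)"
    "abs (- x - - y + - z) = abs (x - y + z)" "abs (- x - - y - - z) = abs (x - y - z)"
    by linarith+
  then show ?thesis unfolding cube_coord_def cube_norm_minus abs_minus_cancel by (simp only:)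
qed

text \<open>Some coordinate has the largest absolute value, and up to the antipode it is
  nonnegative. Statements invariant under \<open>p \<mapsto> - p\<close> thus reduce to three
  faces.\<close>

lemma cube_cases [case_names x y z minus]:
  assumes "\<And>x y z. abs y \<le> x \<Longrightarrow> abs z \<le> x \<Longrightarrow> P x y z"
    and "\<And>x y z. abs x \<le> y \<Longrightarrow> abs z \<le> y \<Longrightarrow> P x y z"
    and "\<And>x y z. abs x \<le> z \<Longrightarrow> abs y \<le> z \<Longrightarrow> P x y z"
    and "\<And>x y z. P x y z \<Longrightarrow> P (- x) (- y) (- z :: real)"
  shows "P x y z"
proof -
  have "abs y \<le> abs x \<and> abs z \<le> abs x \<or> abs x \<le> abs y \<and> abs z \<le> abs y \<or> abs x \<le> abs z \<and> abs y \<le> abs z"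
    by linarith
  then show ?thesis
    using assms(1)[of y x z] assms(1)[of "- y" "- x" "- z"] assms(2)[of x y z] assms(2)[of "- x" "- y" "- z"]
      assms(3)[of x z y] assms(3)[of "- x" "- z" "- y"] assms(4)[of "- x" "- y" "- z"]
    by (cases "0 \<le> x"; cases "0 \<le> y"; cases "0 \<le> z") auto
qed

text \<open>The factor 2 reflects the scaling, in which a face centre or a corner of the cube has
  the single nonzero coordinate 2.\<close>

lemma cube_coord_sum: "(\<Sum>v\<le>6. cube_coord x y z v) = 2 * cube_norm x y z"
proof (induction x y z rule: cube_cases)
  case (x x y z) then show ?case
    by (simp add: cube_coord_x cube_norm_def numeral_eq_Suc atMost_Suc)
next
  case (y x y z) then show ?case
    by (simp add: cube_coord_y cube_norm_def numeral_eq_Suc atMost_Suc)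
next
  case (z x y z) then show ?case
    by (simp add: cube_coord_z cube_norm_def numeral_eq_Suc atMost_Suc)
qed (simp add: cube_coord_minus cube_norm_minus)

section \<open>Recovering a point from its coordinates up to sign\<close>

text \<open>For nonzero arguments this is the sign of \<open>x * y\<close> times the smaller
  absolute value. It does not change when both arguments change sign, so it makes sense on antipodal
  pairs, and its sign tells whether two coordinates agree in sign.\<close>

definition smin :: "real \<Rightarrow> real \<Rightarrow> real" where
  "smin x y = (if 0 \<le> x \<longleftrightarrow> 0 \<le> y then min (abs x) (abs y) else - min (abs x) (abs y))"

lemma smin_0 [simp]: "smin 0 y = 0" "smin x 0 = 0"
  by (auto simp: smin_def)

lemma smin_minus [simp]: "smin (- x) (- y) = smin x y"
  by (cases "x = 0"; cases "y = 0") (auto simp: smin_def)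

lemma smin_left: "abs y \<le> x \<Longrightarrow> smin x y = y"
  and smin_right: "abs x \<le> y \<Longrightarrow> smin x y = x"
  by (auto simp: smin_def)

lemma smin_pos_parts:
  "2 * smin x y = max 0 (x + y) - max 0 (x - y) - max 0 (y - x) + max 0 (- x - y)"
proof (cases "abs x \<le> abs y")
  case True
  then show ?thesis by (auto simp: smin_def min_def max_def)
next
  case False
  then show ?thesis by (auto simp: smin_def min_def max_def)
qed

lemma diff_pos_parts:
  fixes x y :: real
  shows "2 * x = max 0 (x + y) + max 0 (x - y) - max 0 (y - x) - max 0 (- x - y)"
    "2 * y = max 0 (x + y) - max 0 (x - y) + max 0 (y - x) - max 0 (- x - y)"
  by (auto simp: max_def)

text \<open>On each face every equation is one of the positive-part identities above. The three
  values of \<open>smin\<close> are thus recovered from the corner coordinates alone.\<close>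

lemma smin_cube_coord:
  "2 * smin x y = cube_coord x y z 3 + cube_coord x y z 4 - cube_coord x y z 5 - cube_coord x y z 6 \<and>
   2 * smin x z = cube_coord x y z 3 - cube_coord x y z 4 + cube_coord x y z 5 - cube_coord x y z 6 \<and>
   2 * smin y z = cube_coord x y z 3 - cube_coord x y z 4 - cube_coord x y z 5 + cube_coord x y z 6"
proof (induction x y z rule: cube_cases)
  case (x x y z) then show ?case
    by (simp add: cube_coord_x smin_left smin_pos_parts[of y z] diff_pos_parts[of y z])
next
  case (y x y z) then show ?case
    by (simp add: cube_coord_y smin_left smin_right smin_pos_parts[of x z] diff_pos_parts[of x z])
next
  case (z x y z) then show ?case
    by (simp add: cube_coord_z smin_right smin_pos_parts[of x y] diff_pos_parts[of x y])
qed (simp add: cube_coord_minus)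

lemma abs_smin: "abs (smin x y) = min (abs x) (abs y)"
  by (simp add: smin_def min_def)

text \<open>The maximum of \<open>min (abs x) (abs y)\<close> and \<open>min (abs x) (abs z)\<close>
  is \<open>min (abs x) (max (abs y) (abs z))\<close>; what is missing to \<open>abs x\<close> is
  half the centre coordinate.\<close>

lemma abs_cube_coord:
  "2 * abs x = cube_coord x y z 0 + 2 * max (abs (smin x y)) (abs (smin x z))"
  "2 * abs y = cube_coord x y z 1 + 2 * max (abs (smin x y)) (abs (smin y z))"
  "2 * abs z = cube_coord x y z 2 + 2 * max (abs (smin x z)) (abs (smin y z))"
  unfolding abs_smin cube_coord_def by (simp_all add: max_def min_def)

text \<open>Corner coordinates give the \<open>smin\<close> values, these and the centre coordinates
  give the absolute values, and the signs of \<open>smin\<close> give the relative signs. Only a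
  common sign stays open.\<close>

lemma cube_coord_inj:
  assumes "cube_coord x y z = cube_coord x' y' z'"
  shows "x' = x \<and> y' = y \<and> z' = z \<or> x' = - x \<and> y' = - y \<and> z' = - z"
proof -
  have s: "smin x y = smin x' y'" "smin x z = smin x' z'" "smin y z = smin y' z'"
    using smin_cube_coord[of x y z] smin_cube_coord[of x' y' z'] assms by auto
  have "2 * abs x = 2 * abs x'" by (simp only: abs_cube_coord(1)[of x y z] abs_cube_coord(1)[of x' y' z'] assms s)
  moreover have "2 * abs y = 2 * abs y'" by (simp only: abs_cube_coord(2)[of y x z] abs_cube_coord(2)[of y' x' z'] assms s)
  moreover have "2 * abs z = 2 * abs z'" by (simp only: abs_cube_coord(3)[of z x y] abs_cube_coord(3)[of z' x' y'] assms s)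
  ultimately show ?thesis using s unfolding smin_def by (smt (verit) min_def)
qed

text \<open>The diagonals of a cube face cut it into four triangles over its centre, and in each of
  them two corner coordinates vanish.\<close>

lemma support_cube_coord: "\<exists>t\<in>rp2_triangles. support (cube_coord x y z) \<subseteq> t"
proof (induction x y z rule: cube_cases)
  case (x x y z)
  consider "abs z \<le> y" | "abs z \<le> - y" | "abs y \<le> z" | "abs y \<le> - z" by linarith
  then show ?case
  proof cases
    case 1
    then have "max 0 (z - y) = 0" "max 0 (- y - z) = 0" by linarith+
    then have "support (cube_coord x y z) \<subseteq> {0,3,4}"
      unfolding cube_coord_x[OF x] support_def by auto
    then show ?thesis by (rule bexI) (simp add: rp2_triangles_def)
  next
    case 2
    then have "max 0 (y + z) = 0" "max 0 (y - z) = 0" by linarith+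
    then have "support (cube_coord x y z) \<subseteq> {0,5,6}"
      unfolding cube_coord_x[OF x] support_def by auto
    then show ?thesis by (rule bexI) (simp add: rp2_triangles_def)
  next
    case 3
    then have "max 0 (y - z) = 0" "max 0 (- y - z) = 0" by linarith+
    then have "support (cube_coord x y z) \<subseteq> {0,3,5}"
      unfolding cube_coord_x[OF x] support_def by auto
    then show ?thesis by (rule bexI) (simp add: rp2_triangles_def)
  next
    case 4
    then have "max 0 (y + z) = 0" "max 0 (z - y) = 0" by linarith+
    then have "support (cube_coord x y z) \<subseteq> {0,4,6}"
      unfolding cube_coord_x[OF x] support_def by auto
    then show ?thesis by (rule bexI) (simp add: rp2_triangles_def)
  qed
next
  case (y x y z)
  consider "abs z \<le> x" | "abs z \<le> - x" | "abs x \<le> z" | "abs x \<le> - z" by linarith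
  then show ?case
  proof cases
    case 1
    then have "max 0 (- x - z) = 0" "max 0 (z - x) = 0" by linarith+
    then have "support (cube_coord x y z) \<subseteq> {1,3,4}"
      unfolding cube_coord_y[OF y] support_def by auto
    then show ?thesis by (rule bexI) (simp add: rp2_triangles_def)
  next
    case 2
    then have "max 0 (x + z) = 0" "max 0 (x - z) = 0" by linarith+
    then have "support (cube_coord x y z) \<subseteq> {1,5,6}"
      unfolding cube_coord_y[OF y] support_def by auto
    then show ?thesis by (rule bexI) (simp add: rp2_triangles_def)
  next
    case 3
    then have "max 0 (x - z) = 0" "max 0 (- x - z) = 0" by linarith+
    then have "support (cube_coord x y z) \<subseteq> {1,3,6}"
      unfolding cube_coord_y[OF y] support_def by auto
    then show ?thesis by (rule bexI) (simp add: rp2_triangles_def)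
  next
    case 4
    then have "max 0 (x + z) = 0" "max 0 (z - x) = 0" by linarith+
    then have "support (cube_coord x y z) \<subseteq> {1,4,5}"
      unfolding cube_coord_y[OF y] support_def by auto
    then show ?thesis by (rule bexI) (simp add: rp2_triangles_def)
  qed
next
  case (z x y z)
  consider "abs y \<le> x" | "abs y \<le> - x" | "abs x \<le> y" | "abs x \<le> - y" by linarith
  then show ?case
  proof cases
    case 1
    then have "max 0 (- x - y) = 0" "max 0 (y - x) = 0" by linarith+
    then have "support (cube_coord x y z) \<subseteq> {2,3,5}"
      unfolding cube_coord_z[OF z] support_def by auto
    then show ?thesis by (rule bexI) (simp add: rp2_triangles_def)
  next
    case 2
    then have "max 0 (x + y) = 0" "max 0 (x - y) = 0" by linarith+
    then have "support (cube_coord x y z) \<subseteq> {2,4,6}"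
      unfolding cube_coord_z[OF z] support_def by auto
    then show ?thesis by (rule bexI) (simp add: rp2_triangles_def)
  next
    case 3
    then have "max 0 (- x - y) = 0" "max 0 (x - y) = 0" by linarith+
    then have "support (cube_coord x y z) \<subseteq> {2,3,6}"
      unfolding cube_coord_z[OF z] support_def by auto
    then show ?thesis by (rule bexI) (simp add: rp2_triangles_def)
  next
    case 4
    then have "max 0 (x + y) = 0" "max 0 (y - x) = 0" by linarith+
    then have "support (cube_coord x y z) \<subseteq> {2,4,5}"
      unfolding cube_coord_z[OF z] support_def by auto
    then show ?thesis by (rule bexI) (simp add: rp2_triangles_def)
  qed
qed (simp add: cube_coord_minus)

section \<open>The quotient map from the round sphere\<close>

text \<open>Dividing by the total mass makes the map homogeneous of degree 0, so the round sphere
  can take the place of the cube surface without a separate radial projection.\<close>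

definition cube_point :: "real ^ 3 \<Rightarrow> nat \<Rightarrow> real" where
  "cube_point p v = cube_coord (p $ 1) (p $ 2) (p $ 3) v / (2 * cube_norm (p $ 1) (p $ 2) (p $ 3))"

lemma cube_norm_scale: "cube_norm (r * x) (r * y) (r * z) = abs r * cube_norm x y z"
  by (simp add: cube_norm_def abs_mult max_mult_distrib_left)

lemma cube_coord_scale: "cube_coord (r * x) (r * y) (r * z) v = abs r * cube_coord x y z v"
proof -
  have m: "max 0 (abs r * a) = abs r * max 0 a" for a
    using max_mult_distrib_left[of "abs r" 0 a] by simp
  have s: "r * x + r * y + r * z = r * (x + y + z)" "r * x + r * y - r * z = r * (x + y - z)"
    "r * x - r * y + r * z = r * (x - y + z)" "r * x - r * y - r * z = r * (x - y - z)"
    by (simp_all add: algebra_simps)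
  have d: "abs r * a - max (abs r * b) (abs r * c) = abs r * (a - max b c)" for a b c
    by (simp add: right_diff_distrib max_mult_distrib_left)
  have e: "abs r * a - abs r * b = abs r * (a - b)" for a b
    by (simp add: right_diff_distrib)
  show ?thesis
    unfolding cube_coord_def cube_norm_scale s abs_mult d e m by simp
qed

lemma cube_point_scale: "r \<noteq> 0 \<Longrightarrow> cube_point (r *\<^sub>R p) = cube_point p"
  by (intro ext) (simp add: cube_point_def cube_norm_scale cube_coord_scale)

lemma cube_norm_pos: "p \<noteq> (0 :: real ^ 3) \<Longrightarrow> 0 < cube_norm (p $ 1) (p $ 2) (p $ 3)"
  by (auto simp: cube_norm_def vec_eq_iff forall_3 less_max_iff_disj)

lemma continuous_on_cube_point: "continuous_on (- {0}) cube_point"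
proof (rule continuous_on_coordinatewise_then_product)
  fix v
  have c: "continuous_on (- {0}) (\<lambda>p :: real ^ 3. p $ i)" for i
    by (intro continuous_intros)
  have n: "continuous_on (- {0}) (\<lambda>p :: real ^ 3. cube_norm (p $ 1) (p $ 2) (p $ 3))"
    unfolding cube_norm_def by (intro continuous_intros c)
  have "continuous_on (- {0}) (\<lambda>p :: real ^ 3. cube_coord (p $ 1) (p $ 2) (p $ 3) v)"
    unfolding cube_coord_def
    by (cases "v = 0"; cases "v = 1"; cases "v = 2"; cases "v = 3"; cases "v = 4"; cases "v = 5"; cases "v = 6")
       (auto intro!: continuous_intros c n)
  then show "continuous_on (- {0}) (\<lambda>p. cube_point p v)"
    unfolding cube_point_def using cube_norm_pos by (intro continuous_intros n) (force simp: less_le)+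
qed

lemma finite_rp2_triangles: "finite rp2_triangles" "finite (\<Union>rp2_triangles)"
  by (simp_all add: rp2_triangles_def)

lemma cube_point_in:
  assumes "p \<noteq> 0"
  shows "cube_point p \<in> underlying_set (generated_complex rp2_triangles)"
proof -
  let ?n = "cube_norm (p $ 1) (p $ 2) (p $ 3)"
  have n: "0 < ?n" by (rule cube_norm_pos[OF assms])
  obtain t where t: "t \<in> rp2_triangles" "support (cube_coord (p $ 1) (p $ 2) (p $ 3)) \<subseteq> t"
    using support_cube_coord by blast
  have t': "t \<subseteq> {..6}" using t(1) by (auto simp: rp2_triangles_def)
  have s: "support (cube_point p) \<subseteq> t"
    using t(2) n by (auto simp: support_def cube_point_def)
  have "sum (cube_point p) {..6} = 1"
    unfolding cube_point_def sum_divide_distrib[symmetric] cube_coord_sum using n by simp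
  then have "sum (cube_point p) t = 1"
    using sum_eq_if_support_subset[of t "{..6}" "cube_point p"] s t' by (simp add: finite_subset)
  then show ?thesis
    using t(1) s n cube_coord_nonneg
    unfolding mem_underlying_set_generated[OF finite_rp2_triangles(2)] by (auto simp: cube_point_def)
qed

text \<open>After scaling each vector by the cube norm of the other one, their
  \<open>cube_coord\<close> values agree and \<open>cube_coord_inj\<close> applies.\<close>

lemma cube_point_inj:
  assumes "p \<noteq> 0" "q \<noteq> 0" "cube_point p = cube_point q"
  obtains r where "r \<noteq> 0" "q = r *\<^sub>R p"
proof -
  define m n where "m = cube_norm (p $ 1) (p $ 2) (p $ 3)" and "n = cube_norm (q $ 1) (q $ 2) (q $ 3)"
  have mn: "0 < m" "0 < n" using cube_norm_pos assms by (auto simp: m_def n_def)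
  have "cube_coord (n * p $ 1) (n * p $ 2) (n * p $ 3) = cube_coord (m * q $ 1) (m * q $ 2) (m * q $ 3)"
    using assms(3) mn unfolding cube_coord_scale fun_eq_iff cube_point_def m_def[symmetric] n_def[symmetric]
    by (simp add: field_simps)
  from cube_coord_inj[OF this] have "m *\<^sub>R q = n *\<^sub>R p \<or> m *\<^sub>R q = - (n *\<^sub>R p)"
    by (auto simp: vec_eq_iff forall_3)
  then have "q = (n / m) *\<^sub>R p \<or> q = (- n / m) *\<^sub>R p"
    using mn by (auto simp: vec_eq_iff field_simps)
  then show thesis using that[of "n / m"] that[of "- n / m"] mn by auto
qed

lemma cube_point_vector:
  assumes "cube_coord x y z = (\<lambda>v. 2 * f v)" "cube_norm x y z = 1"
  shows "\<exists>p. p \<noteq> 0 \<and> cube_point p = f"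
proof (intro exI conjI)
  show "vector [x, y, z] \<noteq> (0 :: real ^ 3)"
    using assms(2) by (auto simp: vec_eq_iff forall_3 cube_norm_def)
  show "cube_point (vector [x, y, z]) = f"
    by (intro ext) (simp add: cube_point_def assms)
qed

text \<open>The witness is the convex combination, with weights \<open>f\<close>, of the three
  vertices of a triangle on the cube surface. Each corner pair is represented by its member on the
  face in question, which gives one formula for each of the twelve triangles.\<close>

lemma cube_point_surj:
  assumes "f \<in> underlying_set (generated_complex rp2_triangles)"
  shows "\<exists>p. p \<noteq> 0 \<and> cube_point p = f"
proof -
  from assms obtain t where f: "\<And>v. 0 \<le> f v" and t: "t \<in> rp2_triangles" and s: "support f \<subseteq> t" "sum f t = 1"
    unfolding mem_underlying_set_generated[OF finite_rp2_triangles(2)] by blast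
  have zero: "f v = 0" if "v \<notin> t" for v using s(1) that by (auto simp: support_def)
  from t consider "t = {0,3,4}"
    | "t = {0,5,6}"
    | "t = {0,3,5}"
    | "t = {0,4,6}"
    | "t = {1,3,4}"
    | "t = {1,5,6}"
    | "t = {1,3,6}"
    | "t = {1,4,5}"
    | "t = {2,3,5}"
    | "t = {2,4,6}"
    | "t = {2,3,6}"
    | "t = {2,4,5}"
    unfolding rp2_triangles_def by (elim insertE emptyE) (erule that)+
  then show ?thesis
  proof cases
    case 1
    \<comment> \<open>The combination of (1,0,0), (1,1,1) and (1,1,-1) with weights
      \<open>f 0\<close>, \<open>f 3\<close>, \<open>f 4\<close>; the first coordinate is 1 because
      the weights sum to 1.\<close>
    define x y z :: real where xyz: "x = 1" "y = (0 + f 3 + f 4)" "z = (0 + f 3 - f 4)"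
    have n: "f 0 \<ge> 0" "f 3 \<ge> 0" "f 4 \<ge> 0" "f 0 + f 3 + f 4 = 1" using f s(2) 1 by simp_all
    then have le: "abs y \<le> x" "abs z \<le> x" and
      m: "2 * (x - max (abs y) (abs z)) = 2 * f 0" "max 0 (y + z) = 2 * f 3" "max 0 (y - z) = 2 * f 4"
      "max 0 (z - y) = 2 * f 5" "max 0 (- y - z) = 2 * f 6"
      using zero 1 unfolding xyz by simp_all
    have "cube_coord x y z = (\<lambda>v. 2 * f v)"
      unfolding cube_coord_x[OF le] m using zero 1 by (intro ext) simp
    moreover have "cube_norm x y z = 1" using le xyz by (simp add: cube_norm_def)
    ultimately show ?thesis by (rule cube_point_vector)
  next
    case 2
    define x y z :: real where xyz: "x = 1" "y = (0 - f 5 - f 6)" "z = (0 + f 5 - f 6)"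
    have n: "f 0 \<ge> 0" "f 5 \<ge> 0" "f 6 \<ge> 0" "f 0 + f 5 + f 6 = 1" using f s(2) 2 by simp_all
    then have le: "abs y \<le> x" "abs z \<le> x" and
      m: "2 * (x - max (abs y) (abs z)) = 2 * f 0" "max 0 (y + z) = 2 * f 3" "max 0 (y - z) = 2 * f 4"
      "max 0 (z - y) = 2 * f 5" "max 0 (- y - z) = 2 * f 6"
      using zero 2 unfolding xyz by simp_all
    have "cube_coord x y z = (\<lambda>v. 2 * f v)"
      unfolding cube_coord_x[OF le] m using zero 2 by (intro ext) simp
    moreover have "cube_norm x y z = 1" using le xyz by (simp add: cube_norm_def)
    ultimately show ?thesis by (rule cube_point_vector)
  next
    case 3
    define x y z :: real where xyz: "x = 1" "y = (0 + f 3 - f 5)" "z = (0 + f 3 + f 5)"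
    have n: "f 0 \<ge> 0" "f 3 \<ge> 0" "f 5 \<ge> 0" "f 0 + f 3 + f 5 = 1" using f s(2) 3 by simp_all
    then have le: "abs y \<le> x" "abs z \<le> x" and
      m: "2 * (x - max (abs y) (abs z)) = 2 * f 0" "max 0 (y + z) = 2 * f 3" "max 0 (y - z) = 2 * f 4"
      "max 0 (z - y) = 2 * f 5" "max 0 (- y - z) = 2 * f 6"
      using zero 3 unfolding xyz by simp_all
    have "cube_coord x y z = (\<lambda>v. 2 * f v)"
      unfolding cube_coord_x[OF le] m using zero 3 by (intro ext) simp
    moreover have "cube_norm x y z = 1" using le xyz by (simp add: cube_norm_def)
    ultimately show ?thesis by (rule cube_point_vector)
  next
    case 4
    define x y z :: real where xyz: "x = 1" "y = (0 + f 4 - f 6)" "z = (0 - f 4 - f 6)"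
    have n: "f 0 \<ge> 0" "f 4 \<ge> 0" "f 6 \<ge> 0" "f 0 + f 4 + f 6 = 1" using f s(2) 4 by simp_all
    then have le: "abs y \<le> x" "abs z \<le> x" and
      m: "2 * (x - max (abs y) (abs z)) = 2 * f 0" "max 0 (y + z) = 2 * f 3" "max 0 (y - z) = 2 * f 4"
      "max 0 (z - y) = 2 * f 5" "max 0 (- y - z) = 2 * f 6"
      using zero 4 unfolding xyz by simp_all
    have "cube_coord x y z = (\<lambda>v. 2 * f v)"
      unfolding cube_coord_x[OF le] m using zero 4 by (intro ext) simp
    moreover have "cube_norm x y z = 1" using le xyz by (simp add: cube_norm_def)
    ultimately show ?thesis by (rule cube_point_vector)
  next
    case 5
    define x y z :: real where xyz: "x = (0 + f 3 + f 4)" "y = 1" "z = (0 + f 3 - f 4)"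
    have n: "f 1 \<ge> 0" "f 3 \<ge> 0" "f 4 \<ge> 0" "f 1 + f 3 + f 4 = 1" using f s(2) 5 by simp_all
    then have le: "abs x \<le> y" "abs z \<le> y" and
      m: "2 * (y - max (abs x) (abs z)) = 2 * f 1" "max 0 (x + z) = 2 * f 3" "max 0 (x - z) = 2 * f 4"
      "max 0 (- x - z) = 2 * f 5" "max 0 (z - x) = 2 * f 6"
      using zero 5 unfolding xyz by simp_all
    have "cube_coord x y z = (\<lambda>v. 2 * f v)"
      unfolding cube_coord_y[OF le] m using zero 5 by (intro ext) simp
    moreover have "cube_norm x y z = 1" using le xyz by (simp add: cube_norm_def)
    ultimately show ?thesis by (rule cube_point_vector)
  next
    case 6
    \<comment> \<open>On the face \<open>y = 1\<close> the corner pairs 5 and 6 are represented by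
      (-1,1,-1) and (-1,1,1).\<close>
    define x y z :: real where xyz: "x = (0 - f 5 - f 6)" "y = 1" "z = (0 - f 5 + f 6)"
    have n: "f 1 \<ge> 0" "f 5 \<ge> 0" "f 6 \<ge> 0" "f 1 + f 5 + f 6 = 1" using f s(2) 6 by simp_all
    then have le: "abs x \<le> y" "abs z \<le> y" and
      m: "2 * (y - max (abs x) (abs z)) = 2 * f 1" "max 0 (x + z) = 2 * f 3" "max 0 (x - z) = 2 * f 4"
      "max 0 (- x - z) = 2 * f 5" "max 0 (z - x) = 2 * f 6"
      using zero 6 unfolding xyz by simp_all
    have "cube_coord x y z = (\<lambda>v. 2 * f v)"
      unfolding cube_coord_y[OF le] m using zero 6 by (intro ext) simp
    moreover have "cube_norm x y z = 1" using le xyz by (simp add: cube_norm_def)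
    ultimately show ?thesis by (rule cube_point_vector)
  next
    case 7
    define x y z :: real where xyz: "x = (0 + f 3 - f 6)" "y = 1" "z = (0 + f 3 + f 6)"
    have n: "f 1 \<ge> 0" "f 3 \<ge> 0" "f 6 \<ge> 0" "f 1 + f 3 + f 6 = 1" using f s(2) 7 by simp_all
    then have le: "abs x \<le> y" "abs z \<le> y" and
      m: "2 * (y - max (abs x) (abs z)) = 2 * f 1" "max 0 (x + z) = 2 * f 3" "max 0 (x - z) = 2 * f 4"
      "max 0 (- x - z) = 2 * f 5" "max 0 (z - x) = 2 * f 6"
      using zero 7 unfolding xyz by simp_all
    have "cube_coord x y z = (\<lambda>v. 2 * f v)"
      unfolding cube_coord_y[OF le] m using zero 7 by (intro ext) simp
    moreover have "cube_norm x y z = 1" using le xyz by (simp add: cube_norm_def)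
    ultimately show ?thesis by (rule cube_point_vector)
  next
    case 8
    define x y z :: real where xyz: "x = (0 + f 4 - f 5)" "y = 1" "z = (0 - f 4 - f 5)"
    have n: "f 1 \<ge> 0" "f 4 \<ge> 0" "f 5 \<ge> 0" "f 1 + f 4 + f 5 = 1" using f s(2) 8 by simp_all
    then have le: "abs x \<le> y" "abs z \<le> y" and
      m: "2 * (y - max (abs x) (abs z)) = 2 * f 1" "max 0 (x + z) = 2 * f 3" "max 0 (x - z) = 2 * f 4"
      "max 0 (- x - z) = 2 * f 5" "max 0 (z - x) = 2 * f 6"
      using zero 8 unfolding xyz by simp_all
    have "cube_coord x y z = (\<lambda>v. 2 * f v)"
      unfolding cube_coord_y[OF le] m using zero 8 by (intro ext) simp
    moreover have "cube_norm x y z = 1" using le xyz by (simp add: cube_norm_def)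
    ultimately show ?thesis by (rule cube_point_vector)
  next
    case 9
    define x y z :: real where xyz: "x = (0 + f 3 + f 5)" "y = (0 + f 3 - f 5)" "z = 1"
    have n: "f 2 \<ge> 0" "f 3 \<ge> 0" "f 5 \<ge> 0" "f 2 + f 3 + f 5 = 1" using f s(2) 9 by simp_all
    then have le: "abs x \<le> z" "abs y \<le> z" and
      m: "2 * (z - max (abs x) (abs y)) = 2 * f 2" "max 0 (x + y) = 2 * f 3" "max 0 (- x - y) = 2 * f 4"
      "max 0 (x - y) = 2 * f 5" "max 0 (y - x) = 2 * f 6"
      using zero 9 unfolding xyz by simp_all
    have "cube_coord x y z = (\<lambda>v. 2 * f v)"
      unfolding cube_coord_z[OF le] m using zero 9 by (intro ext) simp
    moreover have "cube_norm x y z = 1" using le xyz by (simp add: cube_norm_def)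
    ultimately show ?thesis by (rule cube_point_vector)
  next
    case 10
    define x y z :: real where xyz: "x = (0 - f 4 - f 6)" "y = (0 - f 4 + f 6)" "z = 1"
    have n: "f 2 \<ge> 0" "f 4 \<ge> 0" "f 6 \<ge> 0" "f 2 + f 4 + f 6 = 1" using f s(2) 10 by simp_all
    then have le: "abs x \<le> z" "abs y \<le> z" and
      m: "2 * (z - max (abs x) (abs y)) = 2 * f 2" "max 0 (x + y) = 2 * f 3" "max 0 (- x - y) = 2 * f 4"
      "max 0 (x - y) = 2 * f 5" "max 0 (y - x) = 2 * f 6"
      using zero 10 unfolding xyz by simp_all
    have "cube_coord x y z = (\<lambda>v. 2 * f v)"
      unfolding cube_coord_z[OF le] m using zero 10 by (intro ext) simp
    moreover have "cube_norm x y z = 1" using le xyz by (simp add: cube_norm_def)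
    ultimately show ?thesis by (rule cube_point_vector)
  next
    case 11
    define x y z :: real where xyz: "x = (0 + f 3 - f 6)" "y = (0 + f 3 + f 6)" "z = 1"
    have n: "f 2 \<ge> 0" "f 3 \<ge> 0" "f 6 \<ge> 0" "f 2 + f 3 + f 6 = 1" using f s(2) 11 by simp_all
    then have le: "abs x \<le> z" "abs y \<le> z" and
      m: "2 * (z - max (abs x) (abs y)) = 2 * f 2" "max 0 (x + y) = 2 * f 3" "max 0 (- x - y) = 2 * f 4"
      "max 0 (x - y) = 2 * f 5" "max 0 (y - x) = 2 * f 6"
      using zero 11 unfolding xyz by simp_all
    have "cube_coord x y z = (\<lambda>v. 2 * f v)"
      unfolding cube_coord_z[OF le] m using zero 11 by (intro ext) simp
    moreover have "cube_norm x y z = 1" using le xyz by (simp add: cube_norm_def)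
    ultimately show ?thesis by (rule cube_point_vector)
  next
    case 12
    define x y z :: real where xyz: "x = (0 - f 4 + f 5)" "y = (0 - f 4 - f 5)" "z = 1"
    have n: "f 2 \<ge> 0" "f 4 \<ge> 0" "f 5 \<ge> 0" "f 2 + f 4 + f 5 = 1" using f s(2) 12 by simp_all
    then have le: "abs x \<le> z" "abs y \<le> z" and
      m: "2 * (z - max (abs x) (abs y)) = 2 * f 2" "max 0 (x + y) = 2 * f 3" "max 0 (- x - y) = 2 * f 4"
      "max 0 (x - y) = 2 * f 5" "max 0 (y - x) = 2 * f 6"
      using zero 12 unfolding xyz by simp_all
    have "cube_coord x y z = (\<lambda>v. 2 * f v)"
      unfolding cube_coord_z[OF le] m using zero 12 by (intro ext) simp
    moreover have "cube_norm x y z = 1" using le xyz by (simp add: cube_norm_def)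
    ultimately show ?thesis by (rule cube_point_vector)
  qed
qed

text \<open>Two points of the sphere on a common line through 0 differ by the factor 1 or -1, so the
  fibres are the antipodal pairs. The quotient property again follows from compactness.\<close>

lemma projective_plane_rp2: "projective_plane (polyhedron rp2_triangles)"
proof -
  let ?S = "sphere (0 :: real ^ 3) 1"
  have "quotient_map (top_of_set ?S) (polyhedron rp2_triangles) cube_point"
  proof (rule continuous_imp_quotient_map)
    have "continuous_on ?S cube_point"
      by (rule continuous_on_subset[OF continuous_on_cube_point]) auto
    then show "continuous_map (top_of_set ?S) (polyhedron rp2_triangles) cube_point"
      unfolding underlying_space_def continuous_map_in_subtopology by (auto intro!: cube_point_in)
    have "f \<in> cube_point ` ?S" if f: "f \<in> underlying_set (generated_complex rp2_triangles)" for f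
    proof -
      obtain p where p: "p \<noteq> 0" "cube_point p = f" using cube_point_surj[OF f] by blast
      then have "cube_point (inverse (norm p) *\<^sub>R p) = f" using cube_point_scale by simp
      moreover have "inverse (norm p) *\<^sub>R p \<in> ?S" using p(1) by simp
      ultimately show ?thesis by blast
    qed
    then show "cube_point ` topspace (top_of_set ?S) = topspace (polyhedron rp2_triangles)"
      unfolding underlying_space_def by (auto intro!: cube_point_in)
  qed (simp_all add: compact_space_subtopology Hausdorff_space_polyhedron)
  moreover have "cube_point p = cube_point q \<longleftrightarrow> q = p \<or> q = - p" if pq: "p \<in> ?S" "q \<in> ?S" for p q
  proof
    assume "cube_point p = cube_point q"
    moreover have "p \<noteq> 0" "q \<noteq> 0" using pq by auto
    ultimately obtain r where "q = r *\<^sub>R p" by (metis cube_point_inj)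
    moreover from this have "abs r = 1" using pq by simp
    ultimately show "q = p \<or> q = - p" by (auto simp: abs_if split: if_splits)
  next
    assume "q = p \<or> q = - p"
    then show "cube_point p = cube_point q" using cube_point_scale[of "-1" p] by auto
  qed
  ultimately show ?thesis unfolding projective_plane_def by blast
qed

text \<open>This allows copies of the seven-vertex complex to be placed on prescribed labels, so
  that they share just a triangle.\<close>

lemma homeomorphic_relabel:
  assumes "inj_on f (\<Union>F)" "finite (\<Union>F)"
  shows "polyhedron F homeomorphic_space polyhedron ((`) f ` F)"
proof -
  define V where "V = \<Union>F"
  let ?F = "(`) f ` F"
  have inj: "inj_on f V" using assms(1) by (simp add: V_def)
  have fin: "finite (\<Union>?F)" using assms(2) by (simp flip: image_Union)
  define g where "g = inv_into V f"
  \<comment> \<open>The default 0 is the true value there, since supports lie in the vertex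
    set.\<close>
  define push pull where "push = (\<lambda>(x :: 'a \<Rightarrow> real) w. if w \<in> f ` V then x (g w) else 0)"
    and "pull = (\<lambda>(y :: 'b \<Rightarrow> real) v. if v \<in> V then y (f v) else 0)"
  have gf: "g (f v) = v" if "v \<in> V" for v using that inj by (simp add: g_def)
  have fg: "w \<in> f ` V \<Longrightarrow> f (g w) = w" "w \<in> f ` V \<Longrightarrow> g w \<in> V" for w
    unfolding g_def by (rule f_inv_into_f, assumption) (rule inv_into_into, assumption)
  have "push x \<in> underlying_set (generated_complex ?F) \<and> pull (push x) = x"
    if x: "x \<in> underlying_set (generated_complex F)" for x
  proof -
    obtain t where t: "\<forall>v. 0 \<le> x v" "t \<in> F" "support x \<subseteq> t" "sum x t = 1"
      using x unfolding mem_underlying_set_generated[OF assms(2)] by blast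
    have tV: "t \<subseteq> V" using t(2) by (auto simp: V_def)
    have pf: "push x (f v) = x v" if "v \<in> V" for v using that gf by (simp add: push_def)
    have "support (push x) \<subseteq> f ` t"
    proof
      fix w assume "w \<in> support (push x)"
      then have "w \<in> f ` V" "g w \<in> support x" by (auto simp: support_def push_def split: if_splits)
      then show "w \<in> f ` t" using fg(1)[of w] t(3) by (metis imageI subsetD)
    qed
    moreover have "sum (push x) (f ` t) = sum x t"
      unfolding sum.reindex[OF inj_on_subset[OF inj tV]] using tV pf
      by (intro sum.cong) auto
    ultimately have "push x \<in> underlying_set (generated_complex ?F)"
      unfolding mem_underlying_set_generated[OF fin] using t by (auto simp: push_def)
    moreover have "x v = 0" if "v \<notin> V" for v using that t(3) tV by (auto simp: support_def)
    then have "pull (push x) = x"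
      using pf by (intro ext) (auto simp: pull_def)
    ultimately show ?thesis by blast
  qed
  moreover have "pull y \<in> underlying_set (generated_complex F) \<and> push (pull y) = y"
    if y: "y \<in> underlying_set (generated_complex ?F)" for y
  proof -
    obtain t where t: "\<forall>v. 0 \<le> y v" "t \<in> F" "support y \<subseteq> f ` t" "sum y (f ` t) = 1"
      using y unfolding mem_underlying_set_generated[OF fin] by blast
    have tV: "t \<subseteq> V" using t(2) by (auto simp: V_def)
    have "support (pull y) \<subseteq> t"
    proof
      fix v assume "v \<in> support (pull y)"
      then have v: "v \<in> V" "f v \<in> support y" by (auto simp: support_def pull_def split: if_splits)
      then obtain u where u: "u \<in> t" "f v = f u" using t(3) by blast
      have "v = u" by (rule inj_onD[OF inj u(2) v(1)]) (use u(1) tV in blast)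
      then show "v \<in> t" using u(1) by simp
    qed
    moreover have "sum (pull y) t = sum y (f ` t)"
      unfolding sum.reindex[OF inj_on_subset[OF inj tV]] using tV
      by (intro sum.cong) (auto simp: pull_def)
    ultimately have "pull y \<in> underlying_set (generated_complex F)"
      unfolding mem_underlying_set_generated[OF assms(2)] using t by (auto simp: pull_def)
    moreover have "y w = 0" if "w \<notin> f ` V" for w using that t(3) tV by (auto simp: support_def)
    then have "push (pull y) = y"
      using fg by (intro ext) (auto simp: pull_def push_def)
    ultimately show ?thesis by blast
  qed
  moreover have "continuous_on S push" "continuous_on S' pull" for S S'
    unfolding push_def pull_def
    by (intro continuous_on_coordinatewise_then_product, rename_tac v, case_tac "v \<in> f ` V"; simp add: continuous_on_coordinate)
       (intro continuous_on_coordinatewise_then_product, rename_tac v, case_tac "v \<in> V"; simp add: continuous_on_coordinate)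
  ultimately show ?thesis
    unfolding homeomorphic_space_def homeomorphic_maps_def underlying_space_def
    by (intro exI[of _ push] exI[of _ pull]) (auto simp: continuous_map_in_subtopology)
qed

section \<open>Lists of triangles\<close>

type_synonym tri = "nat \<times> nat \<times> nat"

fun tri_set :: "tri \<Rightarrow> nat set" where
  "tri_set (a, b, c) = {a, b, c}"

fun mem :: "nat \<Rightarrow> tri \<Rightarrow> bool" where
  "mem v (a, b, c) \<longleftrightarrow> v = a \<or> v = b \<or> v = c"

definition tris :: "tri list \<Rightarrow> nat set set" where
  "tris T = tri_set ` set T"

text \<open>For distinct entries an increasing triple is a normal form of its vertex set, so
  comparing triangles becomes comparing triples.\<close>

fun sort3 :: "nat \<Rightarrow> nat \<Rightarrow> nat \<Rightarrow> tri" where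
  "sort3 a b c =
    (if a < b then if b < c then (a, b, c) else if a < c then (a, c, b) else (c, a, b)
     else if a < c then (b, a, c) else if b < c then (b, c, a) else (c, b, a))"

text \<open>\<open>Flip a b c d\<close> replaces the edge \<open>ab\<close> by \<open>cd\<close>; \<open>Remove v a b c\<close> deletes the vertex \<open>v\<close> whose
  link is the triangle \<open>abc\<close>.\<close>

datatype move = Flip nat nat nat nat | Remove nat nat nat nat

text \<open>The tests are the hypotheses of \<open>bistellar\<close> in executable form: the
  filtered star must consist of exactly the facets to be replaced, and the new face must be absent
  from the rest. An inadmissible move yields \<open>None\<close>.\<close>

fun apply_move :: "move \<Rightarrow> tri list \<Rightarrow> tri list option" where
  "apply_move (Flip a b c d) T =
    (let S = filter (\<lambda>t. mem a t \<and> mem b t) T; R = filter (\<lambda>t. \<not> (mem a t \<and> mem b t)) T in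
     if distinct [a, b, c, d] \<and> list_all (\<lambda>t. mem c t \<or> mem d t) S \<and> list_ex (mem c) S \<and> list_ex (mem d) S
       \<and> list_all (\<lambda>t. \<not> (mem c t \<and> mem d t)) R
     then Some (sort3 a c d # sort3 b c d # R) else None)"
| "apply_move (Remove v a b c) T =
    (let S = filter (mem v) T; R = filter (\<lambda>t. \<not> mem v t) T in
     if distinct [v, a, b, c]
       \<and> list_all (\<lambda>t. mem a t \<and> mem b t \<or> mem a t \<and> mem c t \<or> mem b t \<and> mem c t) S
       \<and> list_ex (\<lambda>t. mem a t \<and> mem b t) S \<and> list_ex (\<lambda>t. mem a t \<and> mem c t) S
       \<and> list_ex (\<lambda>t. mem b t \<and> mem c t) S
       \<and> list_all (\<lambda>t. \<not> (mem a t \<and> mem b t \<and> mem c t)) R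
     then Some (sort3 a b c # R) else None)"

fun apply_moves :: "move list \<Rightarrow> tri list \<Rightarrow> tri list option" where
  "apply_moves [] T = Some T"
| "apply_moves (m # ms) T = (case apply_move m T of None \<Rightarrow> None | Some T' \<Rightarrow> apply_moves ms T')"

lemma mem_iff: "mem v t \<longleftrightarrow> v \<in> tri_set t"
  by (cases t) auto

lemma tri_set_sort3 [simp]: "tri_set (sort3 a b c) = {a, b, c}"
  by auto

lemma tri_set_eqI: "distinct [a, b, c] \<Longrightarrow> a \<in> tri_set t \<Longrightarrow> b \<in> tri_set t \<Longrightarrow> c \<in> tri_set t \<Longrightarrow> tri_set t = {a, b, c}"
  by (cases t) auto

lemma tris_Cons: "tris (t # T) = insert (tri_set t) (tris T)"
  by (auto simp: tris_def)

lemma finite_Union_tris: "finite (\<Union>(tris T))"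
proof -
  have "finite (tri_set t)" for t by (cases t) auto
  then show ?thesis by (auto simp: tris_def)
qed

lemma tris_split: "tris T = tris (filter P T) \<union> tris (filter (\<lambda>t. \<not> P t) T)"
  by (auto simp: tris_def)

text \<open>A flip is the bistellar move with \<open>A = {a, b}\<close> and
  \<open>B = {c, d}\<close>, a removal the one with \<open>A = {v}\<close> and
  \<open>B = {a, b, c}\<close>.\<close>

lemma apply_move_homeomorphic:
  assumes "apply_move m T = Some T'"
  shows "polyhedron (tris T) homeomorphic_space polyhedron (tris T')"
proof (cases m)
  case (Flip a b c d)
  define S R where "S = filter (\<lambda>t. mem a t \<and> mem b t) T" and "R = filter (\<lambda>t. \<not> (mem a t \<and> mem b t)) T"
  from assms have ok: "distinct [a, b, c, d]" "list_all (\<lambda>t. mem c t \<or> mem d t) S" "list_ex (mem c) S"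
    "list_ex (mem d) S" "list_all (\<lambda>t. \<not> (mem c t \<and> mem d t)) R" and T': "T' = sort3 a c d # sort3 b c d # R"
    unfolding Flip apply_move.simps Let_def S_def[symmetric] R_def[symmetric] by (auto split: if_splits)
  interpret bistellar "{a, b}" "{c, d}" "tris R"
  proof
    fix t assume "t \<in> tris R"
    then obtain s where s: "s \<in> set R" "t = tri_set s" unfolding tris_def by blast
    then have "\<not> (mem a s \<and> mem b s)" "\<not> (mem c s \<and> mem d s)"
      using ok(5) unfolding list_all_iff R_def set_filter mem_Collect_eq by blast+
    then show "\<not> {a, b} \<subseteq> t" "\<not> {c, d} \<subseteq> t" by (simp_all add: s(2) mem_iff)
  qed (use ok(1) finite_Union_tris in auto)
  have in_S: "tri_set t = {a, b, e}" if "t \<in> set S" "mem e t" "e \<in> {c, d}" for t e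
    using tri_set_eqI[of a b e t] that ok(1) by (auto simp: S_def mem_iff)
  have "tris S = {{a, b, c}, {a, b, d}}"
  proof
    show "tris S \<subseteq> {{a, b, c}, {a, b, d}}"
    proof
      fix s assume "s \<in> tris S"
      then obtain t where t: "t \<in> set S" "s = tri_set t" unfolding tris_def by blast
      then have "mem c t \<or> mem d t" using ok(2) unfolding list_all_iff by blast
      then show "s \<in> {{a, b, c}, {a, b, d}}" using in_S[OF t(1), of c] in_S[OF t(1), of d] t(2) by auto
    qed
    obtain s t where "s \<in> set S" "mem c s" "t \<in> set S" "mem d t" using ok(3,4) unfolding list_ex_iff by blast
    then have "tri_set s = {a, b, c}" "tri_set t = {a, b, d}" "s \<in> set S" "t \<in> set S" using in_S by blast+
    then show "{{a, b, c}, {a, b, d}} \<subseteq> tris S" unfolding tris_def by blast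
  qed
  moreover have "{a, b} \<union> {c, d} - {c} = {a, b, d}" "{a, b} \<union> {c, d} - {d} = {a, b, c}"
    "{a, b} \<union> {c, d} - {a} = {b, c, d}" "{a, b} \<union> {c, d} - {b} = {a, c, d}"
    using ok(1) by auto
  moreover have "tris T = tris S \<union> tris R" unfolding S_def R_def by (rule tris_split)
  ultimately have "tris T = before" "tris T' = after"
    unfolding before_def after_def T' tris_Cons tri_set_sort3 by (simp_all add: insert_commute)
  then show ?thesis using homeomorphic_move by simp
next
  case (Remove v a b c)
  define S R where "S = filter (mem v) T" and "R = filter (\<lambda>t. \<not> mem v t) T"
  from assms have ok: "distinct [v, a, b, c]"
    "list_all (\<lambda>t. mem a t \<and> mem b t \<or> mem a t \<and> mem c t \<or> mem b t \<and> mem c t) S"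
    "list_ex (\<lambda>t. mem a t \<and> mem b t) S" "list_ex (\<lambda>t. mem a t \<and> mem c t) S"
    "list_ex (\<lambda>t. mem b t \<and> mem c t) S"
    "list_all (\<lambda>t. \<not> (mem a t \<and> mem b t \<and> mem c t)) R" and T': "T' = sort3 a b c # R"
    unfolding Remove apply_move.simps Let_def S_def[symmetric] R_def[symmetric] by (auto split: if_splits)
  interpret bistellar "{v}" "{a, b, c}" "tris R"
  proof
    fix t assume "t \<in> tris R"
    then obtain s where s: "s \<in> set R" "t = tri_set s" unfolding tris_def by blast
    then have "\<not> mem v s" "\<not> (mem a s \<and> mem b s \<and> mem c s)"
      using ok(6) unfolding list_all_iff R_def set_filter mem_Collect_eq by blast+
    then show "\<not> {v} \<subseteq> t" "\<not> {a, b, c} \<subseteq> t" by (simp_all add: s(2) mem_iff)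
  qed (use ok(1) finite_Union_tris in auto)
  have in_S: "tri_set t = {v, x, y}" if "t \<in> set S" "mem x t" "mem y t" "distinct [v, x, y]" for t x y
    using tri_set_eqI[of v x y t] that by (auto simp: S_def mem_iff)
  have "tris S = {{v, a, b}, {v, a, c}, {v, b, c}}"
  proof
    show "tris S \<subseteq> {{v, a, b}, {v, a, c}, {v, b, c}}"
    proof
      fix s assume "s \<in> tris S"
      then obtain t where t: "t \<in> set S" "s = tri_set t" unfolding tris_def by blast
      then have "mem a t \<and> mem b t \<or> mem a t \<and> mem c t \<or> mem b t \<and> mem c t"
        using ok(2) unfolding list_all_iff by blast
      then show "s \<in> {{v, a, b}, {v, a, c}, {v, b, c}}"
        using in_S[OF t(1), of a b] in_S[OF t(1), of a c] in_S[OF t(1), of b c] t(2) ok(1) by auto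
    qed
    obtain s t u where *: "s \<in> set S" "mem a s" "mem b s" "t \<in> set S" "mem a t" "mem c t" "u \<in> set S" "mem b u" "mem c u"
      using ok(3-5) unfolding list_ex_iff by blast
    then have "tri_set s = {v, a, b}" "tri_set t = {v, a, c}" "tri_set u = {v, b, c}"
      using in_S ok(1) by auto
    then show "{{v, a, b}, {v, a, c}, {v, b, c}} \<subseteq> tris S" using * unfolding tris_def by blast
  qed
  moreover have "{v} \<union> {a, b, c} - {a} = {v, b, c}" "{v} \<union> {a, b, c} - {b} = {v, a, c}"
    "{v} \<union> {a, b, c} - {c} = {v, a, b}" "{v} \<union> {a, b, c} - {v} = {a, b, c}"
    using ok(1) by auto
  moreover have "tris T = tris S \<union> tris R" unfolding S_def R_def by (rule tris_split)
  ultimately have "tris T = before" "tris T' = after"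
    unfolding before_def after_def T' tris_Cons tri_set_sort3 by (simp_all add: insert_commute)
  then show ?thesis using homeomorphic_move by simp
qed

lemma apply_moves_homeomorphic:
  "apply_moves ms T = Some T' \<Longrightarrow> polyhedron (tris T) homeomorphic_space polyhedron (tris T')"
proof (induction ms arbitrary: T)
  case (Cons m ms)
  then obtain T1 where "apply_move m T = Some T1" "apply_moves ms T1 = Some T'"
    by (auto split: option.splits)
  then show ?case
    using Cons.IH apply_move_homeomorphic homeomorphic_space_trans by blast
qed auto

section \<open>A triangulation of the connected sum of four projective planes\<close>

fun distinct3 :: "tri \<Rightarrow> bool" where
  "distinct3 (a, b, c) \<longleftrightarrow> a \<noteq> b \<and> a \<noteq> c \<and> b \<noteq> c"

definition glue :: "nat \<Rightarrow> nat \<Rightarrow> nat \<Rightarrow> tri list \<Rightarrow> tri list \<Rightarrow> tri list" where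
  "glue a b c T G = filter (\<lambda>t. \<not> (mem a t \<and> mem b t \<and> mem c t)) (T @ G)"

text \<open>An executable form of the hypotheses of \<open>connected_sum_polyhedra\<close> with
  \<open>t0 = {a, b, c}\<close>; the last three tests put each edge of this triangle into a second
  triangle of \<open>T\<close>.\<close>

definition glueable :: "nat \<Rightarrow> nat \<Rightarrow> nat \<Rightarrow> tri list \<Rightarrow> tri list \<Rightarrow> bool" where
  "glueable a b c T G \<longleftrightarrow>
     distinct [a, b, c] \<and> list_all distinct3 T \<and> list_all distinct3 G \<and>
     list_ex (\<lambda>t. mem a t \<and> mem b t \<and> mem c t) T \<and> list_ex (\<lambda>t. mem a t \<and> mem b t \<and> mem c t) G \<and>
     list_all (\<lambda>(x, y, z). list_all (\<lambda>v. v = a \<or> v = b \<or> v = c \<or> list_all (\<lambda>u. \<not> mem v u) G) [x, y, z]) T \<and>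
     list_ex (\<lambda>t. mem a t \<and> mem b t \<and> \<not> mem c t) T \<and> list_ex (\<lambda>t. mem a t \<and> mem c t \<and> \<not> mem b t) T \<and>
     list_ex (\<lambda>t. mem b t \<and> mem c t \<and> \<not> mem a t) T"

lemma card_tri_set: "distinct3 t \<Longrightarrow> card (tri_set t) = 3"
  by (cases t) auto

lemma connected_sum_glue:
  assumes "glueable a b c T G"
  shows "connected_sum (polyhedron (tris T)) (polyhedron (tris G)) (polyhedron (tris (glue a b c T G)))"
proof -
  let ?t = "{a, b, c}"
  from assms have abc: "distinct [a, b, c]" and d: "\<forall>t\<in>set T. distinct3 t" "\<forall>t\<in>set G. distinct3 t"
    and ex: "\<exists>t\<in>set T. mem a t \<and> mem b t \<and> mem c t" "\<exists>t\<in>set G. mem a t \<and> mem b t \<and> mem c t"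
    and edges: "\<exists>t\<in>set T. mem a t \<and> mem b t \<and> \<not> mem c t" "\<exists>t\<in>set T. mem a t \<and> mem c t \<and> \<not> mem b t"
      "\<exists>t\<in>set T. mem b t \<and> mem c t \<and> \<not> mem a t"
    unfolding glueable_def list_all_iff list_ex_iff by blast+
  have common: "v \<in> ?t" if "t \<in> set T" "v \<in> tri_set t" "u \<in> set G" "v \<in> tri_set u" for t u v
  proof -
    obtain x y z where t: "t = (x, y, z)" by (cases t)
    have "list_all (\<lambda>v. v = a \<or> v = b \<or> v = c \<or> list_all (\<lambda>u. \<not> mem v u) G) [x, y, z]"
      using assms that(1) unfolding glueable_def list_all_iff t by blast
    then show ?thesis using that unfolding list_all_iff t mem_iff by auto
  qed
  have eq: "tri_set t = ?t" if "mem a t" "mem b t" "mem c t" for t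
    using tri_set_eqI[OF abc] that unfolding mem_iff by blast
  have mem_T: "?t \<in> tris T" "?t \<in> tris G" using ex eq unfolding tris_def by (metis imageI)+
  have "tris (glue a b c T G) = tris T \<union> tris G - {?t}"
  proof (intro equalityI subsetI)
    fix s assume "s \<in> tris (glue a b c T G)"
    then obtain t where t: "t \<in> set T \<union> set G" "s = tri_set t" "\<not> (mem a t \<and> mem b t \<and> mem c t)"
      unfolding tris_def glue_def set_filter set_append by blast
    then have "s \<noteq> ?t" unfolding mem_iff by blast
    then show "s \<in> tris T \<union> tris G - {?t}" using t unfolding tris_def by blast
  next
    fix s assume s: "s \<in> tris T \<union> tris G - {?t}"
    then obtain t where t: "t \<in> set T \<union> set G" "s = tri_set t" unfolding tris_def by blast
    then have "\<not> (mem a t \<and> mem b t \<and> mem c t)" using eq s by blast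
    then show "s \<in> tris (glue a b c T G)" using t unfolding tris_def glue_def set_filter set_append by blast
  qed
  moreover have "connected_sum (polyhedron (tris T)) (polyhedron (tris G)) (polyhedron (tris T \<union> tris G - {?t}))"
  proof (rule connected_sum_polyhedra)
    show "finite (tris T)" "finite (tris G)" by (simp_all add: tris_def)
    show "card t = 3" if "t \<in> tris T \<union> tris G" for t
      using that d card_tri_set unfolding tris_def by blast
    show "\<Union> (tris T) \<inter> \<Union> (tris G) = ?t"
    proof (intro equalityI subsetI)
      fix v assume "v \<in> \<Union> (tris T) \<inter> \<Union> (tris G)"
      then show "v \<in> ?t" using common unfolding tris_def by blast
    qed (use mem_T in blast)
    show "\<exists>t\<in>tris T - {?t}. ?t - {v} \<subseteq> t" if v: "v \<in> ?t" for v
    proof -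
      \<comment> \<open>The vertex \<open>r\<close>, missing from the triangle found, shows that it
        is not the removed one.\<close>
      have *: "\<exists>s\<in>tris T - {?t}. {p, q} \<subseteq> s" if pqr: "\<exists>t\<in>set T. mem p t \<and> mem q t \<and> \<not> mem r t" "r \<in> ?t" for p q r
      proof -
        obtain t where "t \<in> set T" "p \<in> tri_set t" "q \<in> tri_set t" "r \<notin> tri_set t"
          using pqr(1) unfolding mem_iff by blast
        then show ?thesis using pqr(2) by (intro bexI[of _ "tri_set t"]) (auto simp: tris_def)
      qed
      consider "v = a" | "v = b" | "v = c" using v by blast
      then show ?thesis
      proof cases
        case 1
        have "?t - {v} = {b, c}" using abc 1 by auto
        then show ?thesis using *[OF edges(3)] by simp
      next
        case 2
        have "?t - {v} = {a, c}" using abc 2 by auto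
        then show ?thesis using *[OF edges(2)] by simp
      next
        case 3
        have "?t - {v} = {a, b}" using abc 3 by auto
        then show ?thesis using *[OF edges(1)] by simp
      qed
    qed
  qed (use mem_T in blast)+
  ultimately show ?thesis by simp
qed

definition rp2_copy :: "nat list \<Rightarrow> tri list" where
  "rp2_copy l = map (\<lambda>(a, b, c). sort3 (l ! a) (l ! b) (l ! c))
    [(0,3,4), (0,4,6), (0,5,6), (0,3,5), (1,3,4), (1,4,5), (1,5,6), (1,3,6), (2,3,5), (2,4,5), (2,4,6), (2,3,6)]"

lemma projective_plane_rp2_copy:
  assumes "distinct l" "length l = 7"
  shows "projective_plane (polyhedron (tris (rp2_copy l)))"
proof -
  have "inj_on ((!) l) (\<Union>rp2_triangles)"
    by (rule inj_on_subset[of _ "{..<7}"]) (use assms in \<open>auto simp: inj_on_def nth_eq_iff_index_eq rp2_triangles_def\<close>)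
  from homeomorphic_relabel[OF this finite_rp2_triangles(2)]
  have "projective_plane (polyhedron ((`) ((!) l) ` rp2_triangles))"
    using projective_plane_homeomorphic[OF projective_plane_rp2] by blast
  moreover have "tris (rp2_copy l) = (`) ((!) l) ` rp2_triangles"
    unfolding tris_def rp2_copy_def rp2_triangles_def list.map list.set image_insert image_empty prod.case tri_set_sort3
    by (rule refl)
  ultimately show ?thesis by simp
qed

text \<open>In all three gluings the new copy is attached along its triangle (0,3,4), in the
  numbering of \<open>rp2_triangles\<close>. In the first copy the triangles used are (0,3,4) here
  and then (1,5,6) and (2,4,6).\<close>

definition N4_start_1 :: "tri list" where
  "N4_start_1 = glue 0 1 2 (rp2_copy [0,10,11,1,2,3,4]) (rp2_copy [0,12,13,1,2,5,14])"

definition N4_start_2 :: "tri list" where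
  "N4_start_2 = glue 3 4 10 N4_start_1 (rp2_copy [10,15,16,3,4,6,7])"

definition N4_start :: "tri list" where
  "N4_start = glue 2 4 11 N4_start_2 (rp2_copy [11,17,18,2,4,8,9])"

lemma nonorientable_surface_N4_start: "nonorientable_surface 4 (polyhedron (tris N4_start))"
proof -
  have g: "glueable 0 1 2 (rp2_copy [0,10,11,1,2,3,4]) (rp2_copy [0,12,13,1,2,5,14])"
    "glueable 3 4 10 N4_start_1 (rp2_copy [10,15,16,3,4,6,7])"
    "glueable 2 4 11 N4_start_2 (rp2_copy [11,17,18,2,4,8,9])"
    by code_simp+
  have "nonorientable_surface 1 (polyhedron (tris (rp2_copy [0,10,11,1,2,3,4])))"
    by (rule nonorientable_surface.one[OF projective_plane_rp2_copy]) simp_all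
  then have "nonorientable_surface (Suc 1) (polyhedron (tris N4_start_1))"
    unfolding N4_start_1_def
    by (rule nonorientable_surface.sum[OF _ projective_plane_rp2_copy connected_sum_glue[OF g(1)]]) simp_all
  then have "nonorientable_surface (Suc (Suc 1)) (polyhedron (tris N4_start_2))"
    unfolding N4_start_2_def
    by (rule nonorientable_surface.sum[OF _ projective_plane_rp2_copy connected_sum_glue[OF g(2)]]) simp_all
  then have "nonorientable_surface (Suc (Suc (Suc 1))) (polyhedron (tris N4_start))"
    unfolding N4_start_def
    by (rule nonorientable_surface.sum[OF _ projective_plane_rp2_copy connected_sum_glue[OF g(3)]]) simp_all
  then show ?thesis by (simp add: numeral_eq_Suc)
qed

section \<open>Separation of cones in the star of a vertex\<close>

type_synonym point = "int \<times> int \<times> int"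

fun diff :: "point \<Rightarrow> point \<Rightarrow> point" where
  "diff (a, b, c) (x, y, z) = (a - x, b - y, c - z)"

fun cross_prod :: "point \<Rightarrow> point \<Rightarrow> point" where
  "cross_prod (a, b, c) (x, y, z) = (b * z - c * y, c * x - a * z, a * y - b * x)"

fun dot_prod :: "point \<Rightarrow> point \<Rightarrow> int" where
  "dot_prod (a, b, c) (x, y, z) = a * x + b * y + c * z"

fun vec3 :: "point \<Rightarrow> real ^ 3" where
  "vec3 (x, y, z) = vector [real_of_int x, real_of_int y, real_of_int z]"

lemma vec3_diff: "vec3 (diff p q) = vec3 p - vec3 q"
  by (cases p; cases q) (simp add: vec_eq_iff forall_3)

lemma vec3_cross: "vec3 (cross_prod p q) = cross3 (vec3 p) (vec3 q)"
  by (cases p; cases q) (simp add: vec_eq_iff forall_3 cross3_def)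

lemma vec3_dot: "of_int (dot_prod p q) = vec3 p \<bullet> vec3 q"
  by (cases p; cases q) (simp add: inner_vec_def sum_3)

definition mixed_signs :: "int \<Rightarrow> int \<Rightarrow> int \<Rightarrow> int \<Rightarrow> bool" where
  "mixed_signs a b c d \<longleftrightarrow> (0 < a \<or> 0 < b \<or> 0 < c \<or> 0 < d) \<and> (a < 0 \<or> b < 0 \<or> c < 0 \<or> d < 0)"

text \<open>The equations \<open>pr\<close> say that the two vectors are parallel. Two entries of
  opposite sign in the second force the matching entries of the nonnegative first one to vanish, and
  a nonzero entry then kills the remaining ones.\<close>

lemma proportional_mixed_signs:
  fixes \<alpha> \<beta> \<gamma> \<delta> :: real
  assumes nonneg: "0 \<le> \<alpha>" "0 \<le> \<beta>" "0 \<le> \<gamma>" "0 \<le> \<delta>"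
    and pr: "\<alpha> * q = \<beta> * p" "\<alpha> * r = \<gamma> * p" "\<alpha> * s = \<delta> * p" "\<beta> * r = \<gamma> * q" "\<beta> * s = \<delta> * q" "\<gamma> * s = \<delta> * r"
    and "0 < p \<or> 0 < q \<or> 0 < r \<or> 0 < s" "p < 0 \<or> q < 0 \<or> r < 0 \<or> s < 0"
  shows "\<alpha> = 0 \<and> \<beta> = 0 \<and> \<gamma> = 0 \<and> \<delta> = 0"
proof -
  have *: "u = 0 \<and> v = 0" if "0 \<le> u" "0 \<le> v" "u * y = v * x" "x < 0 \<and> 0 < y \<or> y < 0 \<and> 0 < x" for u v x y :: real
  proof -
    have "u * y = 0"
      using that(4)
    proof
      assume "x < 0 \<and> 0 < y"
      then have "0 \<le> u * y" "v * x \<le> 0" using that(1,2) by (auto intro: mult_nonneg_nonpos)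
      then show ?thesis using that(3) by simp
    next
      assume "y < 0 \<and> 0 < x"
      then have "u * y \<le> 0" "0 \<le> v * x" using that(1,2) by (auto intro: mult_nonneg_nonpos)
      then show ?thesis using that(3) by simp
    qed
    then show ?thesis using that(3,4) by auto
  qed
  have **: "v = 0" if "u * y = v * x" "u = 0" "x \<noteq> 0" for u v x y :: real
    using that by simp
  show ?thesis
    using assms(11,12) *[OF nonneg(1,2) pr(1)] *[OF nonneg(1,3) pr(2)] *[OF nonneg(1,4) pr(3)]
      *[OF nonneg(2,3) pr(4)] *[OF nonneg(2,4) pr(5)] *[OF nonneg(3,4) pr(6)] pr
    by (elim disjE) (auto simp: less_imp_neq[THEN not_sym] less_imp_neq)
qed

text \<open>For vectors in general position the coefficients of a linear relation among four of them are
  proportional to the signed \<open>3 \<times> 3\<close> determinants.\<close>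

lemma disjoint_cones:
  fixes A B C D :: "real ^ 3"
  assumes "0 \<le> \<alpha>" "0 \<le> \<beta>" "0 \<le> \<gamma>" "0 \<le> \<delta>" and eq: "\<alpha> *\<^sub>R A + \<beta> *\<^sub>R B = \<gamma> *\<^sub>R C + \<delta> *\<^sub>R D"
    and "p = B \<bullet> cross3 C D" "q = - (A \<bullet> cross3 C D)" "r = - (D \<bullet> cross3 A B)" "s = C \<bullet> cross3 A B"
    and "0 < p \<or> 0 < q \<or> 0 < r \<or> 0 < s" "p < 0 \<or> q < 0 \<or> r < 0 \<or> s < 0"
  shows "\<alpha> = 0 \<and> \<beta> = 0 \<and> \<gamma> = 0 \<and> \<delta> = 0"
proof -
  have dot: "\<alpha> * (A \<bullet> n) + \<beta> * (B \<bullet> n) = \<gamma> * (C \<bullet> n) + \<delta> * (D \<bullet> n)" for n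
    using arg_cong[OF eq, of "\<lambda>v. v \<bullet> n"] by (simp add: inner_add_left)
  note expand = inner_vec_def sum_3 cross3_def algebra_simps
  show ?thesis
  proof (rule proportional_mixed_signs[of \<alpha> \<beta> \<gamma> \<delta> q p r s])
    \<comment> \<open>Each equation pairs the relation with the normal of two of the four vectors,
      which leaves only the other two coefficients.\<close>
    show "\<alpha> * q = \<beta> * p" using dot[of "cross3 C D"] unfolding assms(6-9) by (simp add: dot_cross_self)
    show "\<gamma> * s = \<delta> * r" using dot[of "cross3 A B"] unfolding assms(6-9) by (simp add: dot_cross_self)
    show "\<alpha> * r = \<gamma> * p" using dot[of "cross3 B D"] unfolding assms(6-9) by (simp add: expand)
    show "\<alpha> * s = \<delta> * p" using dot[of "cross3 B C"] unfolding assms(6-9) by (simp add: expand)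
    show "\<beta> * r = \<gamma> * q" using dot[of "cross3 A D"] unfolding assms(6-9) by (simp add: expand)
    show "\<beta> * s = \<delta> * q" using dot[of "cross3 A C"] unfolding assms(6-9) by (simp add: expand)
  qed (use assms in auto)
qed

text \<open>The cross product with \<open>A\<close> turns the relation into one between the normals
  of the two cones. If \<open>D\<close> is outside the plane of \<open>A\<close> and
  \<open>B\<close>, the normals are independent. Otherwise \<open>B\<close> and \<open>D\<close> are
  on opposite sides of the line of \<open>A\<close>, and the normals point in opposite
  directions.\<close>

lemma adjacent_cones:
  fixes A B D :: "real ^ 3"
  assumes "0 \<le> \<beta>" "0 \<le> \<delta>" and eq: "\<alpha> *\<^sub>R A + \<beta> *\<^sub>R B = \<gamma> *\<^sub>R A + \<delta> *\<^sub>R D"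
    and sep: "cross3 A B \<bullet> D \<noteq> 0 \<or> cross3 A B \<bullet> cross3 A D < 0"
  shows "\<alpha> = \<gamma> \<and> \<beta> = 0 \<and> \<delta> = 0"
proof -
  let ?n = "cross3 A B" and ?m = "cross3 A D"
  have "\<beta> *\<^sub>R ?n = \<delta> *\<^sub>R ?m"
    using arg_cong[OF eq, of "cross3 A"] by (simp add: cross_add_right cross_mult_right)
  then have nm: "\<beta> * (?n \<bullet> v) = \<delta> * (?m \<bullet> v)" for v by (metis inner_scaleR_left)
  have "\<beta> = 0 \<and> \<delta> = 0"
  proof (cases "?n \<bullet> D = 0")
    case False
    have "?m \<bullet> B = - (?n \<bullet> D)" by (simp add: inner_vec_def sum_3 cross3_def algebra_simps)
    then show ?thesis using nm[of D] nm[of B] False by (simp add: dot_cross_self)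
  next
    case True
    with sep have neg: "?n \<bullet> ?m < 0" by simp
    have "\<beta> * (?n \<bullet> ?n) = \<delta> * (?n \<bullet> ?m)" using nm[of ?n] by (simp add: inner_commute)
    moreover have "0 \<le> \<beta> * (?n \<bullet> ?n)" "\<delta> * (?n \<bullet> ?m) \<le> 0"
      using assms(1,2) neg by (simp_all add: mult_nonneg_nonpos)
    ultimately have "\<beta> * (?n \<bullet> ?n) = 0" "\<delta> * (?n \<bullet> ?m) = 0" by simp_all
    moreover have "?n \<noteq> 0" using neg by auto
    ultimately show ?thesis using neg by simp
  qed
  moreover have "A \<noteq> 0" using sep by auto
  ultimately show ?thesis using eq by simp
qed

fun link :: "nat \<Rightarrow> tri list \<Rightarrow> (nat \<times> nat) list" where
  "link v [] = []"
| "link v ((a, b, c) # T) =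
    (if v = a then (b, c) # link v T else if v = b then (a, c) # link v T
     else if v = c then (a, b) # link v T else link v T)"

fun sorted3 :: "tri \<Rightarrow> bool" where
  "sorted3 (a, b, c) \<longleftrightarrow> a < b \<and> b < c"

text \<open>From an increasing triple the link edge comes out as an increasing pair, whichever
  position \<open>v\<close> has, so each edge has just one possible entry.\<close>

lemma set_link:
  assumes "\<forall>t\<in>set T. sorted3 t"
  shows "(x, y) \<in> set (link v T) \<longleftrightarrow> x < y \<and> v \<noteq> x \<and> v \<noteq> y \<and> {v, x, y} \<in> tris T"
  using assms
proof (induction T)
  case (Cons t T)
  obtain a b c where t: "t = (a, b, c)" "a < b" "b < c" using Cons.prems by (cases t) auto
  have e1: "(x, y) \<in> set (link v (t # T)) \<longleftrightarrow>
      v = a \<and> x = b \<and> y = c \<or> v = b \<and> x = a \<and> y = c \<or> v = c \<and> x = a \<and> y = b \<or> (x, y) \<in> set (link v T)"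
    using t by auto
  have e2: "v = a \<and> x = b \<and> y = c \<or> v = b \<and> x = a \<and> y = c \<or> v = c \<and> x = a \<and> y = b"
    if "x < y" "v \<noteq> x" "v \<noteq> y" "{v, x, y} = {a, b, c}"
  proof -
    have "v = a \<or> v = b \<or> v = c" "x = a \<or> x = b \<or> x = c" "y = a \<or> y = b \<or> y = c"
      using that(4) by blast+
    then show ?thesis using that(1-3) t(2,3) by (elim disjE) simp_all
  qed
  have e3: "x < y \<and> v \<noteq> x \<and> v \<noteq> y \<and> {v, x, y} = {a, b, c}"
    if "v = a \<and> x = b \<and> y = c \<or> v = b \<and> x = a \<and> y = c \<or> v = c \<and> x = a \<and> y = b"
    using that t(2,3) by (elim disjE) (simp_all add: insert_commute)
  have IH: "(x, y) \<in> set (link v T) \<longleftrightarrow> x < y \<and> v \<noteq> x \<and> v \<noteq> y \<and> {v, x, y} \<in> tris T"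
    using Cons.IH Cons.prems by simp
  have "{v, x, y} \<in> tris (t # T) \<longleftrightarrow> {v, x, y} = {a, b, c} \<or> {v, x, y} \<in> tris T"
    unfolding tris_Cons t(1) by simp
  then show ?case unfolding e1 IH using e2 e3 by blast
qed (simp add: tris_def)

type_synonym link_edge = "nat \<times> nat \<times> point \<times> point \<times> point"

text \<open>Vectors start at \<open>p v\<close>; the cross product is stored because every
  comparison with another link edge uses it.\<close>

fun link_edge_of :: "(nat \<Rightarrow> point) \<Rightarrow> nat \<Rightarrow> nat \<times> nat \<Rightarrow> link_edge" where
  "link_edge_of p v (a, b) =
    (let A = diff (p a) (p v); B = diff (p b) (p v) in (a, b, A, B, cross_prod A B))"

text \<open>A shared endpoint calls for the test of \<open>adjacent_cones\<close>. The sign of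
  \<open>dot_prod n m\<close> is reversed when the shared vertex is first in one edge and second in
  the other, since one normal then has the opposite orientation. For disjoint edges the four numbers
  are the determinants of \<open>disjoint_cones\<close>.\<close>

fun separated :: "link_edge \<Rightarrow> link_edge \<Rightarrow> bool" where
  "separated (a, b, A, B, n) (c, d, C, D, m) =
    (if a = c then dot_prod n D \<noteq> 0 \<or> dot_prod n m < 0
     else if a = d then dot_prod n C \<noteq> 0 \<or> 0 < dot_prod n m
     else if b = c then dot_prod n D \<noteq> 0 \<or> 0 < dot_prod n m
     else if b = d then dot_prod n C \<noteq> 0 \<or> dot_prod n m < 0
     else mixed_signs (- dot_prod A m) (dot_prod B m) (- dot_prod D n) (dot_prod C n))"

fun nondegenerate :: "link_edge \<Rightarrow> bool" where
  "nondegenerate (a, b, A, B, n) \<longleftrightarrow> n \<noteq> (0, 0, 0)"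

definition star_ok :: "(nat \<Rightarrow> point) \<Rightarrow> nat \<Rightarrow> tri list \<Rightarrow> bool" where
  "star_ok p v T \<longleftrightarrow> (let L = map (link_edge_of p v) (link v T) in list_all nondegenerate L \<and> sorted_wrt separated L)"

lemma sorted_wrt_cases:
  assumes "sorted_wrt R xs" "x \<in> set xs" "y \<in> set xs"
  shows "x = y \<or> R x y \<or> R y x"
  using assms by (induction xs) auto

text \<open>The conclusion compares the two coefficient functions at an arbitrary label
  \<open>w\<close>. This form treats shared and disjoint endpoints alike and accepts barycentric
  coordinates directly.\<close>

lemma separated_cones:
  assumes "separated (link_edge_of p v (a, b)) (link_edge_of p v (c, d))"
    and dist: "a \<noteq> b" "c \<noteq> d" "(a, b) \<noteq> (c, d)" "(a, b) \<noteq> (d, c)"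
    and nonneg: "0 \<le> \<alpha>" "0 \<le> \<beta>" "0 \<le> \<gamma>" "0 \<le> \<delta>"
    and eq: "\<alpha> *\<^sub>R (vec3 (p a) - vec3 (p v)) + \<beta> *\<^sub>R (vec3 (p b) - vec3 (p v)) =
      \<gamma> *\<^sub>R (vec3 (p c) - vec3 (p v)) + \<delta> *\<^sub>R (vec3 (p d) - vec3 (p v))"
  shows "(if w = a then \<alpha> else if w = b then \<beta> else 0) = (if w = c then \<gamma> else if w = d then \<delta> else 0)"
proof -
  define V where "V = (\<lambda>w. vec3 (p w) - vec3 (p v))"
  have pos: "0 < k \<longleftrightarrow> 0 < real_of_int k" "k < 0 \<longleftrightarrow> real_of_int k < 0" "k \<noteq> 0 \<longleftrightarrow> real_of_int k \<noteq> 0" for k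
    by simp_all
  have V: "vec3 (p w) - vec3 (p v) = V w" for w by (simp add: V_def)
  note conv = vec3_dot vec3_cross vec3_diff of_int_minus V
  note sep = assms(1)[unfolded link_edge_of.simps Let_def separated.simps mixed_signs_def]
  have eq': "\<alpha> *\<^sub>R V a + \<beta> *\<^sub>R V b = \<gamma> *\<^sub>R V c + \<delta> *\<^sub>R V d" using eq by (simp add: V_def)
  consider "a = c" | "a = d" "a \<noteq> c" | "b = c" "a \<noteq> d" | "b = d" "a \<noteq> c" | "a \<noteq> c" "a \<noteq> d" "b \<noteq> c" "b \<noteq> d" by blast
  then show ?thesis
  proof cases
    case 1
    have "\<alpha> = \<gamma> \<and> \<beta> = 0 \<and> \<delta> = 0"
    proof (rule adjacent_cones[of _ _ _ "V a" "V b" _ "V d"])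
      show "cross3 (V a) (V b) \<bullet> V d \<noteq> 0 \<or> cross3 (V a) (V b) \<bullet> cross3 (V a) (V d) < 0"
        using sep 1 unfolding pos conv by simp
    qed (use nonneg eq' 1 in auto)
    then show ?thesis using 1 by auto
  next
    case 2
    have "\<alpha> = \<delta> \<and> \<beta> = 0 \<and> \<gamma> = 0"
    proof (rule adjacent_cones[of _ _ _ "V a" "V b" _ "V c"])
      show "cross3 (V a) (V b) \<bullet> V c \<noteq> 0 \<or> cross3 (V a) (V b) \<bullet> cross3 (V a) (V c) < 0"
        using sep 2 cross_skew[of "V c" "V a"] unfolding pos conv by simp
    qed (use nonneg eq' 2 in \<open>auto simp: add.commute\<close>)
    then show ?thesis using 2 dist by auto
  next
    case 3
    have ac: "a \<noteq> c" using 3 dist by auto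
    have "\<beta> = \<gamma> \<and> \<alpha> = 0 \<and> \<delta> = 0"
    proof (rule adjacent_cones[of _ _ _ "V b" "V a" _ "V d"])
      show "cross3 (V b) (V a) \<bullet> V d \<noteq> 0 \<or> cross3 (V b) (V a) \<bullet> cross3 (V b) (V d) < 0"
        using sep 3 ac cross_skew[of "V a" "V b"] unfolding pos conv by simp
    qed (use nonneg eq' 3 in \<open>auto simp: add.commute\<close>)
    then show ?thesis using 3 ac dist by auto
  next
    case 4
    have bc: "b \<noteq> c" "a \<noteq> d" using 4 dist by auto
    have "\<beta> = \<delta> \<and> \<alpha> = 0 \<and> \<gamma> = 0"
    proof (rule adjacent_cones[of _ _ _ "V b" "V a" _ "V c"])
      show "cross3 (V b) (V a) \<bullet> V c \<noteq> 0 \<or> cross3 (V b) (V a) \<bullet> cross3 (V b) (V c) < 0"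
        using sep 4 bc cross_skew[of "V a" "V b"] cross_skew[of "V c" "V b"] unfolding pos conv by simp
    qed (use nonneg eq' 4 in \<open>auto simp: add.commute\<close>)
    then show ?thesis using 4 bc dist by auto
  next
    case 5
    have "\<alpha> = 0 \<and> \<beta> = 0 \<and> \<gamma> = 0 \<and> \<delta> = 0"
    proof (rule disjoint_cones[OF nonneg eq' refl refl refl refl])
      show "0 < V b \<bullet> cross3 (V c) (V d) \<or> 0 < - (V a \<bullet> cross3 (V c) (V d)) \<or>
          0 < - (V d \<bullet> cross3 (V a) (V b)) \<or> 0 < V c \<bullet> cross3 (V a) (V b)"
        "V b \<bullet> cross3 (V c) (V d) < 0 \<or> - (V a \<bullet> cross3 (V c) (V d)) < 0 \<or>
          - (V d \<bullet> cross3 (V a) (V b)) < 0 \<or> V c \<bullet> cross3 (V a) (V b) < 0"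
        using sep 5 unfolding pos conv by argo+
    qed
    then show ?thesis by simp
  qed
qed

section \<open>Realizations with a half turn\<close>

lemma simplexwise_linear_eq:
  assumes "finite (\<Union>F)" "t \<in> F" "support x \<subseteq> t"
  shows "simplexwise_linear (generated_complex F) \<psi> x = (\<Sum>w\<in>t. x w *\<^sub>R \<psi> w)"
  unfolding simplexwise_linear_def vertices_generated_complex
  using assms by (intro sum.mono_neutral_right) (auto simp: support_def)

text \<open>Substituting \<open>x v = 1 - x a - x b\<close> makes \<open>\<psi> v\<close> the apex,
  so the image appears as a point of the cone over a link edge.\<close>

lemma star_point:
  assumes T: "\<forall>t\<in>set T. sorted3 t" and x: "x \<in> underlying_set (generated_complex (tris T))" "x v \<noteq> 0"
  obtains a b where "(a, b) \<in> set (link v T)" "a < b" "v \<noteq> a" "v \<noteq> b" "support x \<subseteq> {v, a, b}"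
    "\<forall>w. 0 \<le> x w" "sum x {v, a, b} = 1"
    "simplexwise_linear (generated_complex (tris T)) \<psi> x
      = \<psi> v + (x a *\<^sub>R (\<psi> a - \<psi> v) + x b *\<^sub>R (\<psi> b - \<psi> v))"
proof -
  obtain t where t: "\<forall>w. 0 \<le> x w" "t \<in> tris T" "support x \<subseteq> t" "sum x t = 1"
    using x(1) unfolding mem_underlying_set_generated[OF finite_Union_tris] by blast
  then obtain s where s: "s \<in> set T" "t = tri_set s" unfolding tris_def by blast
  obtain p q r where pqr: "s = (p, q, r)" by (cases s)
  have lt: "p < q" "q < r" using T s pqr by auto
  have v: "v \<in> t" using x(2) t(3) by (auto simp: support_def)
  have "\<exists>a b. a < b \<and> v \<noteq> a \<and> v \<noteq> b \<and> t = {v, a, b}"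
  proof -
    consider "v = p" | "v = q" | "v = r" using v s(2) pqr by auto
    then show ?thesis
    proof cases
      case 1 then show ?thesis using lt s(2) pqr by (intro exI[of _ q] exI[of _ r]) auto
    next
      case 2 then show ?thesis using lt s(2) pqr by (intro exI[of _ p] exI[of _ r]) auto
    next
      case 3 then show ?thesis using lt s(2) pqr by (intro exI[of _ p] exI[of _ q]) auto
    qed
  qed
  then obtain a b where ab: "a < b" "v \<noteq> a" "v \<noteq> b" "t = {v, a, b}" by blast
  then have "(a, b) \<in> set (link v T)" using set_link[OF T] t(2) by simp
  moreover have one: "x v = 1 - x a - x b" using t(4) ab by simp
  have "simplexwise_linear (generated_complex (tris T)) \<psi> x = x v *\<^sub>R \<psi> v + (x a *\<^sub>R \<psi> a + x b *\<^sub>R \<psi> b)"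
    using simplexwise_linear_eq[OF finite_Union_tris t(2,3)] ab by simp
  then have "simplexwise_linear (generated_complex (tris T)) \<psi> x
      = \<psi> v + (x a *\<^sub>R (\<psi> a - \<psi> v) + x b *\<^sub>R (\<psi> b - \<psi> v))"
    unfolding one by (simp add: algebra_simps)
  ultimately show thesis using that[of a b] ab t by blast
qed

lemma nondegenerate_coeff:
  fixes A B :: "real ^ 3"
  assumes "cross3 A B \<noteq> 0" "\<alpha> *\<^sub>R A + \<beta> *\<^sub>R B = \<gamma> *\<^sub>R A + \<delta> *\<^sub>R B"
  shows "\<alpha> = \<gamma>" "\<beta> = \<delta>"
proof -
  have "\<beta> *\<^sub>R cross3 A B = \<delta> *\<^sub>R cross3 A B"
    using arg_cong[OF assms(2), of "cross3 A"] by (simp add: cross_add_right cross_mult_right)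
  then show "\<beta> = \<delta>" using assms(1) by simp
  then have "\<alpha> *\<^sub>R A = \<gamma> *\<^sub>R A" using assms(2) by simp
  moreover have "A \<noteq> 0" using assms(1) by auto
  ultimately show "\<alpha> = \<gamma>" by simp
qed

text \<open>Two points with the same image are compared in their cones: over the same link edge
  nondegeneracy equates the coefficients, over different edges separation does. The coordinate at
  \<open>v\<close> then follows from the total mass.\<close>

lemma star_injective:
  assumes T: "\<forall>t\<in>set T. sorted3 t" and ok: "star_ok p v T"
    and x: "x \<in> underlying_set (generated_complex (tris T))" "x v \<noteq> 0"
    and y: "y \<in> underlying_set (generated_complex (tris T))" "y v \<noteq> 0"
    and eq: "simplexwise_linear (generated_complex (tris T)) (\<lambda>w. vec3 (p w)) x
      = simplexwise_linear (generated_complex (tris T)) (\<lambda>w. vec3 (p w)) y"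
  shows "x = y"
proof -
  let ?V = "\<lambda>w. vec3 (p w) - vec3 (p v)"
  obtain a b where ab: "(a, b) \<in> set (link v T)" "a < b" "v \<noteq> a" "v \<noteq> b" "support x \<subseteq> {v, a, b}"
    "\<forall>w. 0 \<le> x w" "sum x {v, a, b} = 1"
    "simplexwise_linear (generated_complex (tris T)) (\<lambda>w. vec3 (p w)) x = vec3 (p v) + (x a *\<^sub>R ?V a + x b *\<^sub>R ?V b)"
    by (rule star_point[OF T x, where \<psi> = "\<lambda>w. vec3 (p w)"])
  obtain c d where cd: "(c, d) \<in> set (link v T)" "c < d" "v \<noteq> c" "v \<noteq> d" "support y \<subseteq> {v, c, d}"
    "\<forall>w. 0 \<le> y w" "sum y {v, c, d} = 1"
    "simplexwise_linear (generated_complex (tris T)) (\<lambda>w. vec3 (p w)) y = vec3 (p v) + (y c *\<^sub>R ?V c + y d *\<^sub>R ?V d)"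
    by (rule star_point[OF T y, where \<psi> = "\<lambda>w. vec3 (p w)"])
  have comb: "x a *\<^sub>R ?V a + x b *\<^sub>R ?V b = y c *\<^sub>R ?V c + y d *\<^sub>R ?V d"
    using eq unfolding ab(8) cd(8) by simp
  let ?L = "map (link_edge_of p v) (link v T)"
  have L: "list_all nondegenerate ?L" "sorted_wrt separated ?L" using ok by (simp_all add: star_ok_def Let_def)
  have xw: "x w = (if w = a then x a else if w = b then x b else 0)" if "w \<noteq> v" for w
    using that ab(5) by (auto simp: support_def)
  have yw: "y w = (if w = c then y c else if w = d then y d else 0)" if "w \<noteq> v" for w
    using that cd(5) by (auto simp: support_def)
  have off: "x w = y w" if w: "w \<noteq> v" for w
  proof (cases "(a, b) = (c, d)")
    case True
    have "nondegenerate (link_edge_of p v (a, b))" using L(1) ab(1) unfolding list_all_iff set_map by blast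
    then have "cross_prod (diff (p a) (p v)) (diff (p b) (p v)) \<noteq> (0, 0, 0)"
      by (simp add: Let_def)
    moreover have "vec3 q \<noteq> 0" if "q \<noteq> (0, 0, 0)" for q
      using that by (cases q) (auto simp: vec_eq_iff forall_3)
    ultimately have "cross3 (?V a) (?V b) \<noteq> 0" by (metis vec3_cross vec3_diff)
    from nondegenerate_coeff[OF this] comb True have "x a = y a" "x b = y b" by auto
    then show ?thesis using xw[OF w] yw[OF w] True by simp
  next
    case False
    have "link_edge_of p v (a, b) \<in> set ?L" "link_edge_of p v (c, d) \<in> set ?L"
      unfolding set_map using imageI[OF ab(1)] imageI[OF cd(1)] by blast+
    from sorted_wrt_cases[OF L(2) this] False
    have sp: "separated (link_edge_of p v (a, b)) (link_edge_of p v (c, d)) \<or>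
      separated (link_edge_of p v (c, d)) (link_edge_of p v (a, b))" by (auto simp: Let_def)
    have ne: "a \<noteq> b" "c \<noteq> d" "(a, b) \<noteq> (d, c)" "(c, d) \<noteq> (b, a)" "(c, d) \<noteq> (a, b)"
      using ab(2) cd(2) False by auto
    have nn: "0 \<le> x a" "0 \<le> x b" "0 \<le> y c" "0 \<le> y d" using ab(6) cd(6) by auto
    from sp show ?thesis
      unfolding xw[OF w] yw[OF w]
    proof
      assume "separated (link_edge_of p v (a, b)) (link_edge_of p v (c, d))"
      from separated_cones[OF this ne(1,2) False ne(3) nn comb]
      show "(if w = a then x a else if w = b then x b else 0) = (if w = c then y c else if w = d then y d else 0)" .
    next
      assume "separated (link_edge_of p v (c, d)) (link_edge_of p v (a, b))"
      from separated_cones[OF this ne(2,1,5,4) nn(3,4,1,2) comb[symmetric]]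
      show "(if w = a then x a else if w = b then x b else 0) = (if w = c then y c else if w = d then y d else 0)"
        by (rule sym)
    qed
  qed
  \<comment> \<open>A common index set for both points, so that the two sums can be
    subtracted.\<close>
  let ?S = "{v, a, b, c, d}"
  have "sum x ?S = 1" "sum y ?S = 1"
    using sum_eq_if_support_subset[of "{v, a, b}" ?S x] sum_eq_if_support_subset[of "{v, c, d}" ?S y] ab(5,7) cd(5,7)
    by auto
  moreover have "sum x ?S = x v + sum x (?S - {v})" "sum y ?S = y v + sum y (?S - {v})"
    by (rule sum.remove; simp)+
  moreover have "sum x (?S - {v}) = sum y (?S - {v})" by (rule sum.cong) (use off in auto)
  ultimately have "x v = y v" by simp
  then show ?thesis using off by (intro ext) metis
qed

text \<open>Some coordinate of every point is nonzero, so the open stars, given by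
  \<open>y v \<noteq> 0\<close>, cover the space; they are the neighbourhoods on which injectivity
  is known.\<close>

lemma polyhedral_realizationI:
  assumes T: "\<forall>t\<in>set T. sorted3 t" and ok: "\<And>v. v \<in> \<Union>(tris T) \<Longrightarrow> star_ok p v T"
  shows "polyhedral_realization (generated_complex (tris T)) (\<lambda>w. vec3 (p w))"
  unfolding polyhedral_realization_def locally_injective_on_def
proof
  let ?U = "underlying_set (generated_complex (tris T))"
  fix x assume x: "x \<in> ?U"
  then obtain t where t: "t \<in> tris T" "support x \<subseteq> t" "sum x t = 1"
    unfolding mem_underlying_set_generated[OF finite_Union_tris] by blast
  then obtain v where v: "v \<in> t" "x v \<noteq> 0" by (metis sum.neutral zero_neq_one)
  have "open {y :: nat \<Rightarrow> real. y v \<noteq> 0}"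
    by (intro open_Collect_neq continuous_on_coordinate continuous_on_const)
  then have "openin (top_of_set ?U) (?U \<inter> {y. y v \<noteq> 0})" by blast
  moreover have "inj_on (simplexwise_linear (generated_complex (tris T)) (\<lambda>w. vec3 (p w))) (?U \<inter> {y. y v \<noteq> 0})"
    by (intro inj_onI) (use star_injective[OF T ok] t v in blast)
  ultimately show "\<exists>W. openin (top_of_set ?U) W \<and> x \<in> W \<and>
      inj_on (simplexwise_linear (generated_complex (tris T)) (\<lambda>w. vec3 (p w))) W"
    using x v by blast
qed

section \<open>The half turn as a geometric symmetry\<close>

fun half_turn :: "point \<Rightarrow> point" where
  "half_turn (x, y, z) = (- x, - y, z)"

definition half_turn_matrix :: "real ^ 3 ^ 3" where
  "half_turn_matrix = vector [vector [- 1, 0, 0], vector [0, - 1, 0], vector [0, 0, 1]]"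

lemma half_turn_matrix_vector: "half_turn_matrix *v x = vector [- x $ 1, - x $ 2, x $ 3]"
  by (simp add: half_turn_matrix_def vec_eq_iff forall_3 matrix_vector_mult_def sum_3)

lemma vec3_half_turn: "vec3 (half_turn p) = half_turn_matrix *v vec3 p"
  by (cases p) (simp add: half_turn_matrix_vector vec_eq_iff forall_3)

lemma rotation_half_turn: "rotation_matrix half_turn_matrix"
  unfolding rotation_matrix_def orthogonal_matrix
  by (simp add: half_turn_matrix_def det_3 vec_eq_iff forall_3 matrix_matrix_mult_def transpose_def sum_3 mat_def)

lemma two_fold_half_turn: "two_fold_rotation ((*v) half_turn_matrix)"
  unfolding two_fold_rotation_def rotation_about_line_def
proof (intro conjI)
  show "\<exists>a u. u \<noteq> 0 \<and> (\<exists>R. rotation_matrix R \<and> R *v u = u \<and> (\<forall>x. half_turn_matrix *v x = a + R *v (x - a)))"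
    by (intro exI[of _ 0] exI[of _ "vector [0, 0, 1]"] exI[of _ half_turn_matrix] conjI rotation_half_turn)
       (auto simp: half_turn_matrix_vector vec_eq_iff forall_3)
  show "(*v) half_turn_matrix \<noteq> id"
  proof
    assume "(*v) half_turn_matrix = id"
    then have "(half_turn_matrix *v vector [1, 0, 0]) $ 1 = (vector [1, 0, 0] :: real ^ 3) $ 1" by simp
    then show False by (simp add: half_turn_matrix_vector)
  qed
  show "(*v) half_turn_matrix \<circ> (*v) half_turn_matrix = id"
    by (auto simp: half_turn_matrix_vector vec_eq_iff forall_3)
qed

lemma dist_half_turn: "dist (half_turn_matrix *v x) (half_turn_matrix *v y) = dist x y"
  by (simp add: half_turn_matrix_vector dist_norm norm_eq_sqrt_inner inner_vec_def sum_3 power2_commute algebra_simps)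

text \<open>Since \<open>\<alpha>\<close> is its own inverse, the induced map is composition with
  \<open>\<alpha>\<close>; linearity of the half turn and reindexing of the sum then give
  equivariance.\<close>

lemma has_symmetryI:
  fixes \<alpha> :: "nat \<Rightarrow> nat" and T :: "tri list"
  defines "\<Delta> \<equiv> generated_complex (tris T)"
  assumes inv: "\<And>v. \<alpha> (\<alpha> v) = v" and aut: "\<And>t. t \<in> tris T \<Longrightarrow> \<alpha> ` t \<in> tris T"
    and rot: "\<And>v. v \<in> \<Union>(tris T) \<Longrightarrow> p (\<alpha> v) = half_turn (p v)"
    and moved: "v0 \<in> \<Union>(tris T)" "\<alpha> v0 \<noteq> v0"
  shows "has_two_fold_rotational_symmetry \<Delta> (\<lambda>w. vec3 (p w))"
proof -
  let ?g = "(*v) half_turn_matrix" and ?\<psi> = "\<lambda>w. vec3 (p w)" and ?V = "\<Union>(tris T)"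
  have vert: "vertices \<Delta> = ?V" by (simp add: \<Delta>_def vertices_generated_complex)
  have inj: "inj \<alpha>" by (rule injI) (metis inv)
  have aV: "\<alpha> v \<in> ?V" if "v \<in> ?V" for v using aut that by blast
  have imV: "\<alpha> ` ?V = ?V" using aV inv by (metis image_subset_iff subsetI subset_antisym image_iff)
  have aut_face: "\<alpha> ` \<sigma> \<in> \<Delta>" if "\<sigma> \<in> \<Delta>" for \<sigma>
    using that aut unfolding \<Delta>_def generated_complex_def by blast
  have invim: "\<alpha> ` \<alpha> ` \<sigma> = \<sigma>" for \<sigma> by (simp add: image_image inv)
  have "(`) \<alpha> ` \<Delta> = \<Delta>"
  proof
    show "\<Delta> \<subseteq> (`) \<alpha> ` \<Delta>" using aut_face invim by (metis imageI subsetI)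
  qed (use aut_face in blast)
  moreover have "bij_betw \<alpha> ?V ?V" using inj imV by (auto simp: bij_betw_def inj_on_def)
  ultimately have iso: "simplicial_iso \<Delta> \<Delta> \<alpha>" by (simp add: simplicial_iso_def vert)
  have ind: "induced_map \<Delta> \<alpha> x = x \<circ> \<alpha>" and ind_in: "x \<circ> \<alpha> \<in> underlying_set \<Delta>"
    and lin: "?g (simplexwise_linear \<Delta> ?\<psi> x) = simplexwise_linear \<Delta> ?\<psi> (x \<circ> \<alpha>)"
    if x: "x \<in> underlying_set \<Delta>" for x
  proof -
    have sup: "support x \<subseteq> ?V"
      using x unfolding \<Delta>_def mem_underlying_set_generated[OF finite_Union_tris] by blast
    show "induced_map \<Delta> \<alpha> x = x \<circ> \<alpha>"
    proof
      fix w
      \<comment> \<open>The only preimage of \<open>w\<close> under the involution is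
        \<open>\<alpha> w\<close>.\<close>
      have "{v \<in> ?V. \<alpha> v = w} = (if w \<in> ?V then {\<alpha> w} else {})"
        using inv aV by (auto; metis)
      moreover have "x (\<alpha> w) = 0" if "w \<notin> ?V"
        using that sup aV inv by (metis (mono_tags, lifting) support_def mem_Collect_eq subsetD)
      ultimately show "induced_map \<Delta> \<alpha> x w = (x \<circ> \<alpha>) w"
        by (simp add: induced_map_def vert)
    qed
    have supp: "support (x \<circ> \<alpha>) = \<alpha> ` support x"
      using inv by (auto simp: support_def image_iff; metis)
    have reidx: "(\<Sum>v\<in>\<alpha> ` A. h v) = (\<Sum>v\<in>A. h (\<alpha> v))" for h :: "nat \<Rightarrow> 'c::comm_monoid_add" and A
      using inj by (subst sum.reindex) (auto simp: inj_on_def)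
    show "x \<circ> \<alpha> \<in> underlying_set \<Delta>"
    proof -
      have "sum (x \<circ> \<alpha>) ?V = sum x ?V"
        using reidx[of x ?V] imV by (simp add: o_def)
      then show ?thesis
        using x aut_face supp unfolding underlying_set_def vert support_def[symmetric] by auto
    qed
    have "?g (simplexwise_linear \<Delta> ?\<psi> x) = (\<Sum>v\<in>?V. x v *\<^sub>R ?g (?\<psi> v))"
      by (simp add: simplexwise_linear_def vert linear_sum[OF matrix_vector_mul_linear] matrix_vector_mult_scaleR)
    also have "\<dots> = (\<Sum>v\<in>?V. x v *\<^sub>R ?\<psi> (\<alpha> v))"
      by (intro sum.cong refl) (simp add: rot vec3_half_turn)
    also have "\<dots> = (\<Sum>v\<in>\<alpha> ` ?V. x v *\<^sub>R ?\<psi> (\<alpha> v))" by (simp only: imV)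
    also have "\<dots> = simplexwise_linear \<Delta> ?\<psi> (x \<circ> \<alpha>)"
      by (simp add: reidx inv simplexwise_linear_def vert)
    finally show "?g (simplexwise_linear \<Delta> ?\<psi> x) = simplexwise_linear \<Delta> ?\<psi> (x \<circ> \<alpha>)" .
  qed
  have oo: "x = (x \<circ> \<alpha>) \<circ> \<alpha>" for x :: "nat \<Rightarrow> real" by (simp add: o_def inv)
  have "?g ` simplexwise_linear \<Delta> ?\<psi> ` underlying_set \<Delta> = simplexwise_linear \<Delta> ?\<psi> ` underlying_set \<Delta>"
  proof (intro equalityI subsetI)
    fix z assume "z \<in> simplexwise_linear \<Delta> ?\<psi> ` underlying_set \<Delta>"
    then obtain x where x: "x \<in> underlying_set \<Delta>" "z = simplexwise_linear \<Delta> ?\<psi> x" by blast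
    then have "z = ?g (simplexwise_linear \<Delta> ?\<psi> (x \<circ> \<alpha>))" using lin[OF ind_in[OF x(1)]] oo by metis
    then show "z \<in> ?g ` simplexwise_linear \<Delta> ?\<psi> ` underlying_set \<Delta>" using ind_in[OF x(1)] by blast
  qed (use lin ind_in in auto)
  then have "geometric_symmetry \<Delta> ?\<psi> ?g \<alpha>"
    using iso lin ind dist_half_turn unfolding geometric_symmetry_def by simp
  then show ?thesis
    unfolding has_two_fold_rotational_symmetry_def using two_fold_half_turn moved vert by blast
qed

section \<open>An isomorphism invariant\<close>

definition link_of :: "'v set set \<Rightarrow> 'v \<Rightarrow> 'v set set" where
  "link_of \<Delta> v = {e. v \<notin> e \<and> card e = 2 \<and> insert v e \<in> \<Delta>}"

text \<open>Two link edges with one common end form a path of length two, and the symmetric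
  difference is the pair of its outer ends. Their degrees, as numbers of link edges, are multiplied,
  and the product is doubled if the ends are adjacent in the complex.\<close>

definition corner_weight :: "'v set set \<Rightarrow> 'v set \<Rightarrow> 'v set \<Rightarrow> int" where
  "corner_weight \<Delta> e f =
    (if card (e \<inter> f) = 1 then (if (e - f) \<union> (f - e) \<in> \<Delta> then 2 else 1) *
       (\<Prod>w\<in>(e - f) \<union> (f - e). int (card (link_of \<Delta> w))) else 0)"

text \<open>Squaring lets the total depend on how the weights are spread over the vertices, not only
  on their sum.\<close>

definition complex_invariant :: "'v set set \<Rightarrow> int" where
  "complex_invariant \<Delta> =
    (\<Sum>v\<in>vertices \<Delta>. (\<Sum>e\<in>link_of \<Delta> v. \<Sum>f\<in>link_of \<Delta> v. corner_weight \<Delta> e f)\<^sup>2)"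

lemma link_of_subset: "e \<in> link_of \<Delta> v \<Longrightarrow> e \<subseteq> vertices \<Delta>"
  by (auto simp: link_of_def vertices_def)

text \<open>All ingredients come from membership of vertex sets in the complex, which
  \<open>im_mem\<close> shows to be preserved and reflected; links, degrees and weights follow in
  turn.\<close>

lemma complex_invariant_iso:
  assumes "simplicial_iso \<Delta> \<Gamma> f"
  shows "complex_invariant \<Gamma> = complex_invariant \<Delta>"
proof -
  let ?V = "vertices \<Delta>"
  have inj: "inj_on f ?V" and V: "vertices \<Gamma> = f ` ?V" and \<Gamma>: "\<Gamma> = (`) f ` \<Delta>"
    using assms by (auto simp: simplicial_iso_def bij_betw_def)
  have im_mem: "f ` \<sigma> \<in> \<Gamma> \<longleftrightarrow> \<sigma> \<in> \<Delta>" if "\<sigma> \<subseteq> ?V" for \<sigma>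
  proof
    assume "f ` \<sigma> \<in> \<Gamma>"
    then obtain \<tau> where \<tau>: "\<tau> \<in> \<Delta>" "f ` \<sigma> = f ` \<tau>" using \<Gamma> by blast
    moreover have "\<tau> \<subseteq> ?V" using \<tau>(1) by (auto simp: vertices_def)
    ultimately show "\<sigma> \<in> \<Delta>" using inj_on_image_eq_iff[OF inj that] by metis
  qed (use \<Gamma> in blast)
  have link: "link_of \<Gamma> (f v) = (`) f ` link_of \<Delta> v" if v: "v \<in> ?V" for v
  proof (intro equalityI subsetI)
    fix e assume e: "e \<in> link_of \<Gamma> (f v)"
    then have "e \<subseteq> f ` ?V" using link_of_subset V by metis
    then obtain d where d: "d \<subseteq> ?V" "e = f ` d" by (meson subset_imageE)
    then have "v \<notin> d" "card d = 2" "insert v d \<in> \<Delta>"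
      using e im_mem[of "insert v d"] v card_image[OF inj_on_subset[OF inj d(1)]] by (auto simp: link_of_def)
    then show "e \<in> (`) f ` link_of \<Delta> v" using d(2) by (auto simp: link_of_def)
  next
    fix e assume "e \<in> (`) f ` link_of \<Delta> v"
    then obtain d where d: "d \<in> link_of \<Delta> v" "e = f ` d" by blast
    then have dV: "d \<subseteq> ?V" by (simp add: link_of_subset)
    have "f v \<notin> e" using d dV v inj by (auto simp: link_of_def inj_on_def)
    then show "e \<in> link_of \<Gamma> (f v)"
      using d card_image[OF inj_on_subset[OF inj dV]] im_mem[of "insert v d"] dV v by (auto simp: link_of_def)
  qed
  have inj_im: "inj_on ((`) f) (Pow ?V)" by (rule inj_on_image_Pow[OF inj])
  have card_link: "card (link_of \<Gamma> (f v)) = card (link_of \<Delta> v)" if v: "v \<in> ?V" for v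
    unfolding link[OF v] by (rule card_image, rule inj_on_subset[OF inj_im]) (meson PowI link_of_subset subsetI)
  have weight: "corner_weight \<Gamma> (f ` d) (f ` e) = corner_weight \<Delta> d e" if de: "d \<subseteq> ?V" "e \<subseteq> ?V" for d e
  proof -
    have sub: "(d - e) \<union> (e - d) \<subseteq> ?V" using de by blast
    have 1: "f ` d \<inter> f ` e = f ` (d \<inter> e)" using inj_on_image_Int[OF inj de] by simp
    have 2: "(f ` d - f ` e) \<union> (f ` e - f ` d) = f ` ((d - e) \<union> (e - d))"
      using inj_on_image_set_diff[OF inj] de by (simp add: image_Un Diff_subset[THEN subset_trans])
    have 3: "(\<Prod>w\<in>f ` ((d - e) \<union> (e - d)). int (card (link_of \<Gamma> w))) =
        (\<Prod>w\<in>(d - e) \<union> (e - d). int (card (link_of \<Delta> w)))"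
      unfolding prod.reindex[OF inj_on_subset[OF inj sub]] o_def
      by (rule prod.cong) (use card_link sub in auto)
    have 4: "card (f ` (d \<inter> e)) = card (d \<inter> e)"
      by (rule card_image, rule inj_on_subset[OF inj]) (use de in auto)
    show ?thesis unfolding corner_weight_def 1 2 3 4 im_mem[OF sub] ..
  qed
  have "complex_invariant \<Gamma> =
      (\<Sum>v\<in>?V. (\<Sum>e\<in>link_of \<Gamma> (f v). \<Sum>d\<in>link_of \<Gamma> (f v). corner_weight \<Gamma> e d)\<^sup>2)"
    unfolding complex_invariant_def V by (simp add: sum.reindex[OF inj])
  also have "\<dots> = complex_invariant \<Delta>"
    unfolding complex_invariant_def
  proof (rule sum.cong[OF refl], rule arg_cong[of _ _ "\<lambda>z. z\<^sup>2"])
    fix v assume v: "v \<in> ?V"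
    have inj_link: "inj_on ((`) f) (link_of \<Delta> v)"
      by (rule inj_on_subset[OF inj_im]) (meson PowI link_of_subset subsetI)
    show "(\<Sum>e\<in>link_of \<Gamma> (f v). \<Sum>d\<in>link_of \<Gamma> (f v). corner_weight \<Gamma> e d) =
        (\<Sum>e\<in>link_of \<Delta> v. \<Sum>d\<in>link_of \<Delta> v. corner_weight \<Delta> e d)"
      unfolding link[OF v] sum.reindex[OF inj_link] o_def
      by (intro sum.cong refl weight link_of_subset)
  qed
  finally show ?thesis .
qed

section \<open>Counting isomorphism classes by an invariant\<close>

lemma equiv_iso_rel: "equiv UNIV (iso_rel :: ('v set set \<times> 'v set set) set)"
proof (rule equivI)
  show "(iso_rel :: ('v set set \<times> 'v set set) set) \<subseteq> UNIV \<times> UNIV" by simp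
  show "refl (iso_rel :: ('v set set \<times> 'v set set) set)"
    by (rule refl_onI) (auto simp: iso_rel_def simplicial_iso_def intro!: exI[of _ id])
  have "(\<Gamma>, \<Delta>) \<in> iso_rel" if "(\<Delta>, \<Gamma>) \<in> iso_rel" for \<Delta> \<Gamma> :: "'v set set"
  proof -
    obtain f where f: "bij_betw f (vertices \<Delta>) (vertices \<Gamma>)" "(`) f ` \<Delta> = \<Gamma>"
      using \<open>(\<Delta>, \<Gamma>) \<in> iso_rel\<close> by (auto simp: iso_rel_def simplicial_iso_def)
    let ?g = "inv_into (vertices \<Delta>) f"
    have "?g ` f ` \<sigma> = \<sigma>" if "\<sigma> \<in> \<Delta>" for \<sigma>
    proof -
      have "\<sigma> \<subseteq> vertices \<Delta>" using that by (auto simp: vertices_def)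
      then show ?thesis using f(1) by (simp add: bij_betw_def inv_into_image_cancel)
    qed
    then have "(`) ?g ` \<Gamma> = \<Delta>" unfolding f(2)[symmetric] image_image by simp
    then show ?thesis using bij_betw_inv_into[OF f(1)] by (auto simp: iso_rel_def simplicial_iso_def)
  qed
  then show "sym (iso_rel :: ('v set set \<times> 'v set set) set)" by (rule symI)
  have "(\<Delta>, \<Theta>) \<in> iso_rel" if iso: "(\<Delta>, \<Gamma>) \<in> iso_rel" "(\<Gamma>, \<Theta>) \<in> iso_rel" for \<Delta> \<Gamma> \<Theta> :: "'v set set"
  proof -
    obtain f g where fg: "bij_betw f (vertices \<Delta>) (vertices \<Gamma>)" "bij_betw g (vertices \<Gamma>) (vertices \<Theta>)"
      "(`) f ` \<Delta> = \<Gamma>" "(`) g ` \<Gamma> = \<Theta>"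
      using iso unfolding iso_rel_def simplicial_iso_def by blast
    have "(`) (g \<circ> f) ` \<Delta> = \<Theta>" unfolding fg(4)[symmetric] fg(3)[symmetric] by (auto simp: image_image image_comp)
    then show ?thesis using bij_betw_trans[OF fg(1,2)] unfolding iso_rel_def simplicial_iso_def by blast
  qed
  then show "trans (iso_rel :: ('v set set \<times> 'v set set) set)" by (rule transI)
qed

text \<open>An isomorphism invariant is a function on classes, so its values bound their number from
  below. Finiteness of the set of classes holds because each has a representative on the labels
  below \<open>n\<close>.\<close>

lemma card_le_card_quotient_iso_rel:
  fixes S :: "nat set set set"
  assumes "\<And>\<Delta>. \<Delta> \<in> S \<Longrightarrow> card (vertices \<Delta>) = n" "0 < n" "N \<subseteq> complex_invariant ` S"
  shows "card N \<le> card (S // iso_rel)"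
proof -
  note eqv = equiv_iso_rel[where 'v = nat]
  have "S // iso_rel \<subseteq> (\<lambda>\<Gamma>. iso_rel `` {\<Gamma>}) ` Pow (Pow {0..<n})"
  proof
    fix C assume "C \<in> S // iso_rel"
    then obtain \<Delta> where \<Delta>: "\<Delta> \<in> S" "C = iso_rel `` {\<Delta>}" by (auto simp: quotient_def)
    \<comment> \<open>A positive cardinality excludes an infinite vertex set.\<close>
    have "finite (vertices \<Delta>)" using assms(1)[OF \<Delta>(1)] assms(2) by (metis card.infinite less_irrefl)
    then obtain h where h: "bij_betw h (vertices \<Delta>) {0..<n}"
      using ex_bij_betw_finite_nat assms(1)[OF \<Delta>(1)] by blast
    define \<Gamma> where "\<Gamma> = (`) h ` \<Delta>"
    have "vertices \<Gamma> = h ` vertices \<Delta>" by (auto simp: \<Gamma>_def vertices_def)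
    then have V: "vertices \<Gamma> = {0..<n}" using h by (simp add: bij_betw_def)
    then have "(\<Delta>, \<Gamma>) \<in> iso_rel" using h by (auto simp: iso_rel_def simplicial_iso_def \<Gamma>_def)
    then have "C = iso_rel `` {\<Gamma>}" using equiv_class_eq[OF eqv] \<Delta>(2) by simp
    moreover have "\<Gamma> \<in> Pow (Pow {0..<n})" using V by (auto simp: vertices_def)
    ultimately show "C \<in> (\<lambda>\<Gamma>. iso_rel `` {\<Gamma>}) ` Pow (Pow {0..<n})" by blast
  qed
  then have fin: "finite (S // iso_rel)" by (rule finite_subset) simp
  \<comment> \<open>The member chosen may lie outside \<open>S\<close>;
    \<open>complex_invariant_iso\<close> makes the value independent of the choice.\<close>
  define h where "h C = complex_invariant (SOME \<Delta>. \<Delta> \<in> C)" for C :: "nat set set set"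
  have h: "h (iso_rel `` {\<Delta>}) = complex_invariant \<Delta>" for \<Delta>
  proof -
    have "\<Delta> \<in> iso_rel `` {\<Delta>}" using equiv_class_self[OF eqv] by simp
    then have "(SOME \<Delta>'. \<Delta>' \<in> iso_rel `` {\<Delta>}) \<in> iso_rel `` {\<Delta>}" by (rule someI)
    then show ?thesis using complex_invariant_iso by (auto simp: h_def iso_rel_def)
  qed
  have "N \<subseteq> h ` (S // iso_rel)"
  proof
    fix k assume "k \<in> N"
    then obtain \<Delta> where \<Delta>: "\<Delta> \<in> S" "k = complex_invariant \<Delta>" using assms(3) by blast
    have "iso_rel `` {\<Delta>} \<in> S // iso_rel" by (rule quotientI[OF \<Delta>(1)])
    then show "k \<in> h ` (S // iso_rel)" using h[of \<Delta>] \<Delta>(2) by (metis imageI)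
  qed
  then show ?thesis using fin by (meson card_image_le card_mono finite_imageI le_trans)
qed

section \<open>Certificates\<close>

fun corner :: "int list \<Rightarrow> tri list \<Rightarrow> nat \<times> nat \<Rightarrow> nat \<times> nat \<Rightarrow> int" where
  "corner ds T (a, b) (c, d) =
    (let w = \<lambda>x y. (if list_ex (\<lambda>t. mem x t \<and> mem y t) T then 2 else 1) * ds ! x * ds ! y in
     if a = c then w b d else if a = d then w b c else if b = c then w a d else if b = d then w a c else 0)"

fun pair_sum :: "('a \<Rightarrow> 'a \<Rightarrow> int) \<Rightarrow> 'a list \<Rightarrow> int" where
  "pair_sum F [] = 0"
| "pair_sum F (x # xs) = sum_list (map (F x) xs) + pair_sum F xs"

text \<open>Running over unordered pairs halves each inner sum of \<open>complex_invariant\<close>;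
  after squaring, the two invariants differ by the factor 4.\<close>

definition list_invariant :: "tri list \<Rightarrow> int" where
  "list_invariant T =
    (let ds = map (\<lambda>v. int (length (link v T))) [0..<10] in
     sum_list (map (\<lambda>v. (pair_sum (corner ds T) (link v T))\<^sup>2) [0..<10]))"

text \<open>For increasing triples the bound \<open>c < 10\<close> covers all entries, and nonempty
  links make all ten labels occur. Distinctness lets the length of a link list count its
  edges.\<close>

definition valid_complex :: "tri list \<Rightarrow> bool" where
  "valid_complex T \<longleftrightarrow> list_all sorted3 T \<and> distinct T \<and> list_all (\<lambda>(a, b, c). c < 10) T \<and>
    list_all (\<lambda>v. link v T \<noteq> []) [0..<10]"

lemma sum_pair_sum:
  assumes "distinct xs" "\<And>x. x \<in> set xs \<Longrightarrow> F x x = 0"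
    "\<And>x y. x \<in> set xs \<Longrightarrow> y \<in> set xs \<Longrightarrow> F x y = F y x"
  shows "(\<Sum>x\<in>set xs. \<Sum>y\<in>set xs. F x y) = 2 * pair_sum F xs"
  using assms
proof (induction xs)
  case (Cons x xs)
  have IH: "(\<Sum>x\<in>set xs. \<Sum>y\<in>set xs. F x y) = 2 * pair_sum F xs"
    using Cons by simp
  have "(\<Sum>u\<in>set (x # xs). \<Sum>y\<in>set (x # xs). F u y) =
      (F x x + (\<Sum>y\<in>set xs. F x y)) + (\<Sum>u\<in>set xs. F u x + (\<Sum>y\<in>set xs. F u y))"
    using Cons.prems(1) by simp
  also have "(\<Sum>u\<in>set xs. F u x + (\<Sum>y\<in>set xs. F u y)) = (\<Sum>u\<in>set xs. F x u) + 2 * pair_sum F xs"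
    unfolding sum.distrib IH using Cons.prems(3) by (intro arg_cong2[of _ _ _ _ "(+)"] sum.cong refl) simp_all
  finally show ?case
    using Cons.prems(1,2) by (simp add: sum_list_distinct_conv_sum_set)
qed simp

text \<open>Agreement is asked only off the diagonal, because on a pair of equal edges
  \<open>corner\<close> gives a product of degrees while \<open>corner_weight\<close> is 0.\<close>

lemma pair_sum_cong:
  assumes "distinct xs" "\<And>x y. x \<in> set xs \<Longrightarrow> y \<in> set xs \<Longrightarrow> x \<noteq> y \<Longrightarrow> F x y = G x y"
  shows "pair_sum F xs = pair_sum G xs"
  using assms
proof (induction xs)
  case (Cons x xs)
  then have m: "map (F x) xs = map (G x) xs" by auto
  have "pair_sum F xs = pair_sum G xs" using Cons by simp
  then show ?case by (simp only: pair_sum.simps m)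
qed simp

section \<open>The complex of a valid triangle list and its invariant\<close>

context
  fixes T :: "tri list"
  assumes valid: "valid_complex T"
begin

lemma sorted_T: "\<forall>t\<in>set T. sorted3 t" and distinct_T: "distinct T"
  using valid by (auto simp: valid_complex_def list_all_iff)

lemma tris_cases:
  assumes "t \<in> tris T"
  obtains a b c where "(a, b, c) \<in> set T" "t = {a, b, c}" "a < b" "b < c" "c < 10"
proof -
  obtain s where s: "s \<in> set T" "t = tri_set s" using assms unfolding tris_def by blast
  obtain a b c where abc: "s = (a, b, c)" by (cases s)
  then have "sorted3 (a, b, c)" using sorted_T s(1) by blast
  moreover have "c < 10" using valid s(1) abc unfolding valid_complex_def list_all_iff by blast
  ultimately show thesis using that s abc by simp
qed

lemma Union_tris: "\<Union>(tris T) = {0..<10}"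
proof (intro equalityI subsetI)
  fix v assume "v \<in> \<Union>(tris T)"
  then show "v \<in> {0..<10}" by (auto elim!: tris_cases)
next
  fix v :: nat assume "v \<in> {0..<10}"
  then have "link v T \<noteq> []" using valid unfolding valid_complex_def list_all_iff set_upt by blast
  then obtain x y where "(x, y) \<in> set (link v T)" by (metis list.set_intros(1) neq_Nil_conv surj_pair)
  then have "{v, x, y} \<in> tris T" using set_link[OF sorted_T] by simp
  then show "v \<in> \<Union>(tris T)" by blast
qed

lemma card_tris: "t \<in> tris T \<Longrightarrow> card t = 3"
  by (erule tris_cases) simp

lemma two_dim_generated: "two_dim_complex (generated_complex (tris T))"
proof -
  have face: "finite \<sigma> \<and> card \<sigma> \<le> 3" if "t \<in> tris T" "\<sigma> \<subseteq> t" for t \<sigma>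
    using card_tris[OF that(1)] that(2) by (metis card.infinite card_mono finite_subset zero_neq_numeral)
  have fin: "finite (generated_complex (tris T))"
    by (rule finite_subset[of _ "Pow (\<Union>(tris T))"]) (auto simp: generated_complex_def finite_Union_tris)
  obtain t where t: "t \<in> tris T" using Union_tris by fastforce
  then have "t \<in> generated_complex (tris T)" using card_tris[OF t] unfolding generated_complex_def by fastforce
  then have "\<exists>\<sigma>\<in>generated_complex (tris T). card \<sigma> = 3" using card_tris[OF t] by blast
  moreover have "finite \<sigma> \<and> \<sigma> \<noteq> {} \<and> card \<sigma> \<le> 3" if "\<sigma> \<in> generated_complex (tris T)" for \<sigma>
    using that face unfolding generated_complex_def by blast
  moreover have "\<tau> \<in> generated_complex (tris T)"
    if "\<sigma> \<in> generated_complex (tris T)" "\<tau> \<subseteq> \<sigma>" "\<tau> \<noteq> {}" for \<sigma> \<tau>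
    using that unfolding generated_complex_def by blast
  ultimately show ?thesis using fin unfolding two_dim_complex_def by blast
qed

text \<open>A two-element set together with \<open>v\<close> has as many vertices as a facet, so the
  face \<open>insert v e\<close> is itself a listed triangle.\<close>

lemma link_of_eq: "link_of (generated_complex (tris T)) v = (\<lambda>(a, b). {a, b}) ` set (link v T)"
proof (intro equalityI subsetI)
  fix e assume e: "e \<in> link_of (generated_complex (tris T)) v"
  then obtain t where t: "v \<notin> e" "card e = 2" "insert v e \<subseteq> t" "t \<in> tris T"
    unfolding link_of_def generated_complex_def by blast
  have "finite t" "finite e" using card_tris[OF t(4)] t(2) by (metis card.infinite zero_neq_numeral)+
  then have "insert v e = t" using t card_tris[OF t(4)] by (intro card_subset_eq) auto
  moreover obtain a b where ab: "e = {a, b}" "a < b"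
  proof -
    obtain p q where "e = {p, q}" "p \<noteq> q" using t(2) by (auto simp: card_2_iff)
    then show thesis using that[of p q] that[of q p] by (cases "p < q") auto
  qed
  ultimately have "(a, b) \<in> set (link v T)" using set_link[OF sorted_T, of a b v] t by auto
  then show "e \<in> (\<lambda>(a, b). {a, b}) ` set (link v T)" using ab(1) by force
next
  fix e assume "e \<in> (\<lambda>(a, b). {a, b}) ` set (link v T)"
  then obtain a b where "e = {a, b}" "(a, b) \<in> set (link v T)" by auto
  then show "e \<in> link_of (generated_complex (tris T)) v"
    using set_link[OF sorted_T, of a b v] by (auto simp: link_of_def generated_complex_def)
qed

lemma inj_link: "inj_on (\<lambda>(a, b). {a, b}) (set (link v T))"
  using set_link[OF sorted_T] by (auto simp: inj_on_def doubleton_eq_iff)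

text \<open>An increasing triple is determined by its vertex set, so a repeated link edge would come
  from a repeated triangle.\<close>

lemma distinct_link: "distinct (link v T)"
proof -
  have "distinct (link v U)" if "set U \<subseteq> set T" "distinct U" for U
    using that
  proof (induction U)
    case (Cons t U)
    obtain a b c where t: "t = (a, b, c)" by (cases t)
    have s: "\<forall>u\<in>set U. sorted3 u" "sorted3 t" using Cons.prems sorted_T by auto
    have "(x, y) \<notin> set (link v U)" if "{v, x, y} = {a, b, c}" for x y
    proof
      assume "(x, y) \<in> set (link v U)"
      then have "{a, b, c} \<in> tris U" using set_link[OF s(1)] that by simp
      then obtain u where u: "u \<in> set U" "tri_set u = {a, b, c}" unfolding tris_def by force
      obtain a' b' c' where u': "u = (a', b', c')" by (cases u)
      have lt: "a < b" "b < c" "a' < b'" "b' < c'" using s u(1) u' t by auto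
      have eq: "{a', b', c'} = {a, b, c}" using u(2) u' by simp
      have "a' = a \<or> a' = b \<or> a' = c" "b' = a \<or> b' = b \<or> b' = c" "c' = a \<or> c' = b \<or> c' = c"
        using eq by blast+
      then have "a' = a \<and> b' = b \<and> c' = c" using lt by (elim disjE) simp_all
      then have "u = t" using u' t by simp
      then show False using u(1) Cons.prems(2) by simp
    qed
    then show ?case using Cons by (auto simp: t insert_commute)
  qed simp
  then show ?thesis using distinct_T by blast
qed

lemma card_link_of: "card (link_of (generated_complex (tris T)) v) = length (link v T)"
  unfolding link_of_eq card_image[OF inj_link] using distinct_link by (rule distinct_card)

lemma pair_mem_generated: "{x, y} \<in> generated_complex (tris T) \<longleftrightarrow> list_ex (\<lambda>t. mem x t \<and> mem y t) T"
  unfolding list_ex_iff mem_iff generated_complex_def tris_def by auto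

lemma corner_weight_eq:
  assumes "(a, b) \<in> set (link v T)" "(c, d) \<in> set (link v T)" "(a, b) \<noteq> (c, d)"
  shows "corner_weight (generated_complex (tris T)) {a, b} {c, d} =
    corner (map (\<lambda>v. int (length (link v T))) [0..<10]) T (a, b) (c, d)"
proof -
  let ?ds = "map (\<lambda>v. int (length (link v T))) [0..<10]"
  have ab: "a < b" "{v, a, b} \<in> tris T" and cd: "c < d" "{v, c, d} \<in> tris T"
    using assms set_link[OF sorted_T] by auto
  have "{a, b, c, d} \<subseteq> {0..<10}" using ab(2) cd(2) Union_tris by blast
  then have lt: "a < 10" "b < 10" "c < 10" "d < 10" by auto
  have w: "(if {x, y} \<in> generated_complex (tris T) then 2 else 1) *
      (\<Prod>w\<in>{x, y}. int (card (link_of (generated_complex (tris T)) w))) =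
      (if list_ex (\<lambda>t. mem x t \<and> mem y t) T then 2 else 1) * ?ds ! x * ?ds ! y"
    if "x \<noteq> y" "x < 10" "y < 10" for x y
    using that by (simp add: pair_mem_generated card_link_of)
  consider "a = c" "b \<noteq> d" | "a = d" "b \<noteq> c" | "b = c" "a \<noteq> d" | "b = d" "a \<noteq> c"
    | "a \<noteq> c" "a \<noteq> d" "b \<noteq> c" "b \<noteq> d"
    using assms(3) ab(1) cd(1) by fastforce
  then show ?thesis
  proof cases
    case 1
    then have "{a, b} \<inter> {c, d} = {a}" "({a, b} - {c, d}) \<union> ({c, d} - {a, b}) = {b, d}" using ab cd by auto
    then show ?thesis using 1 w[of b d] lt by (simp add: corner_weight_def Let_def)
  next
    case 2
    then have "{a, b} \<inter> {c, d} = {a}" "({a, b} - {c, d}) \<union> ({c, d} - {a, b}) = {b, c}" using ab cd by auto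
    then show ?thesis using 2 w[of b c] lt ab cd by (simp add: corner_weight_def Let_def)
  next
    case 3
    then have "{a, b} \<inter> {c, d} = {b}" "({a, b} - {c, d}) \<union> ({c, d} - {a, b}) = {a, d}" using ab cd by auto
    then show ?thesis using 3 w[of a d] lt ab cd by (simp add: corner_weight_def Let_def)
  next
    case 4
    then have "{a, b} \<inter> {c, d} = {b}" "({a, b} - {c, d}) \<union> ({c, d} - {a, b}) = {a, c}" using ab cd by auto
    then show ?thesis using 4 w[of a c] lt ab cd by (simp add: corner_weight_def Let_def)
  next
    case 5
    then have "{a, b} \<inter> {c, d} = {}" by auto
    then show ?thesis using 5 by (simp add: corner_weight_def Let_def)
  qed
qed

lemma complex_invariant_eq: "complex_invariant (generated_complex (tris T)) = 4 * list_invariant T"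
proof -
  let ?\<Delta> = "generated_complex (tris T)"
  let ?ds = "map (\<lambda>v. int (length (link v T))) [0..<10]"
  have sym: "corner_weight ?\<Delta> e f = corner_weight ?\<Delta> f e" for e f
    by (simp add: corner_weight_def Int_commute Un_commute)
  have "(\<Sum>e\<in>link_of ?\<Delta> v. \<Sum>f\<in>link_of ?\<Delta> v. corner_weight ?\<Delta> e f) = 2 * pair_sum (corner ?ds T) (link v T)" for v
  proof -
    let ?F = "\<lambda>p q. corner_weight ?\<Delta> (case p of (a, b) \<Rightarrow> {a, b}) (case q of (a, b) \<Rightarrow> {a, b})"
    have "?F p p = 0" if "p \<in> set (link v T)" for p
    proof -
      obtain a b where p: "p = (a, b)" by (cases p)
      then have "a \<noteq> b" using that set_link[OF sorted_T, of a b v] by simp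
      then have "card (case p of (a, b) \<Rightarrow> {a, b}) = 2" by (simp add: p)
      then show ?thesis by (simp add: corner_weight_def)
    qed
    then have "(\<Sum>p\<in>set (link v T). \<Sum>q\<in>set (link v T). ?F p q) = 2 * pair_sum ?F (link v T)"
      by (intro sum_pair_sum distinct_link sym)
    moreover have "pair_sum ?F (link v T) = pair_sum (corner ?ds T) (link v T)"
    proof (rule pair_sum_cong[OF distinct_link])
      fix p q assume pq: "p \<in> set (link v T)" "q \<in> set (link v T)" "p \<noteq> q"
      obtain a b c d where *: "p = (a, b)" "q = (c, d)" by (metis surj_pair)
      show "?F p q = corner ?ds T p q"
        using corner_weight_eq[of a b v c d] pq unfolding * prod.case by blast
    qed
    ultimately show ?thesis
      unfolding link_of_eq sum.reindex[OF inj_link] o_def by simp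
  qed
  then have "complex_invariant ?\<Delta> = (\<Sum>v\<in>{0..<10}. (2 * pair_sum (corner ?ds T) (link v T))\<^sup>2)"
    unfolding complex_invariant_def vertices_generated_complex Union_tris by simp
  also have "\<dots> = 4 * list_invariant T"
    unfolding list_invariant_def Let_def
    by (simp add: power_mult_distrib sum_list_distinct_conv_sum_set sum_distrib_left del: upt_rec)
  finally show ?thesis .
qed

end

text \<open>\<open>J\<close> is the claimed value of the invariant; \<open>\<alpha>\<close> and
  \<open>P\<close> list the images and the positions of the labels. Because the permutation is an
  involution, sending triangles to triangles already makes it an automorphism.\<close>

definition check :: "tri list \<Rightarrow> int \<Rightarrow> nat list \<Rightarrow> point list \<Rightarrow> bool" where
  "check T J \<alpha> P \<longleftrightarrow> valid_complex T \<and> list_all (\<lambda>v. star_ok ((!) P) v T) [0..<10] \<and>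
     list_all (\<lambda>v. \<alpha> ! v < 10 \<and> \<alpha> ! (\<alpha> ! v) = v \<and> P ! (\<alpha> ! v) = half_turn (P ! v)) [0..<10] \<and>
     list_ex (\<lambda>v. \<alpha> ! v \<noteq> v) [0..<10] \<and>
     list_all (\<lambda>(a, b, c). List.member T (sort3 (\<alpha> ! a) (\<alpha> ! b) (\<alpha> ! c))) T \<and> list_invariant T = J"

definition symmetric_triangulations :: "nat set set set" where
  "symmetric_triangulations = {\<Delta>. triangulates_N 4 \<Delta> \<and> card (vertices \<Delta>) = 10 \<and>
     (\<exists>\<psi>. polyhedral_realization \<Delta> \<psi> \<and> has_two_fold_rotational_symmetry \<Delta> \<psi>)}"

lemma check_symmetric_triangulation:
  assumes "check T J \<alpha> P" "polyhedron (tris N4_start) homeomorphic_space polyhedron (tris T)"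
  shows "4 * J \<in> complex_invariant ` symmetric_triangulations"
proof -
  from assms(1) have valid: "valid_complex T" and star: "\<forall>v\<in>{0..<10}. star_ok ((!) P) v T"
    and \<alpha>: "\<forall>v\<in>{0..<10}. \<alpha> ! v < 10 \<and> \<alpha> ! (\<alpha> ! v) = v \<and> P ! (\<alpha> ! v) = half_turn (P ! v)"
    and moved: "\<exists>v\<in>{0..<10}. \<alpha> ! v \<noteq> v"
    and aut: "\<forall>(a, b, c)\<in>set T. sort3 (\<alpha> ! a) (\<alpha> ! b) (\<alpha> ! c) \<in> set T"
    and J: "list_invariant T = J"
    unfolding check_def list_all_iff list_ex_iff set_upt List.member_iff by blast+
  let ?\<Delta> = "generated_complex (tris T)"
  note V = Union_tris[OF valid]
  \<comment> \<open>Extended by the identity, since \<open>has_symmetryI\<close> wants an involution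
    of all of \<open>nat\<close> and \<open>\<alpha> ! v\<close> says nothing beyond the ten
    labels.\<close>
  define f where "f v = (if v < 10 then \<alpha> ! v else v)" for v
  have "polyhedral_realization ?\<Delta> (\<lambda>w. vec3 (P ! w))"
    using star V by (intro polyhedral_realizationI sorted_T[OF valid]) auto
  moreover have "has_two_fold_rotational_symmetry ?\<Delta> (\<lambda>w. vec3 (P ! w))"
  proof -
    obtain v where v: "v \<in> {0..<10}" "\<alpha> ! v \<noteq> v" using moved by blast
    show ?thesis
    proof (rule has_symmetryI[where \<alpha> = f and ?v0.0 = v])
      show "f (f v) = v" for v using \<alpha> by (auto simp: f_def)
      show "f ` t \<in> tris T" if "t \<in> tris T" for t
      proof -
        obtain a b c where t: "(a, b, c) \<in> set T" "t = {a, b, c}" "a < b" "b < c" "c < 10"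
          using tris_cases[OF valid \<open>t \<in> tris T\<close>] by blast
        then have "tri_set (sort3 (\<alpha> ! a) (\<alpha> ! b) (\<alpha> ! c)) \<in> tris T" using aut unfolding tris_def by blast
        then have "{\<alpha> ! a, \<alpha> ! b, \<alpha> ! c} \<in> tris T" unfolding tri_set_sort3 .
        then show ?thesis using t by (simp add: f_def)
      qed
    qed (use \<alpha> v V in \<open>auto simp: f_def\<close>)
  qed
  moreover have "triangulates_N 4 ?\<Delta>"
    unfolding triangulates_N_def
    using two_dim_generated[OF valid] nonorientable_surface_N4_start assms(2) homeomorphic_space_sym by blast
  moreover have "card (vertices ?\<Delta>) = 10" by (simp add: vertices_generated_complex V)
  ultimately have "?\<Delta> \<in> symmetric_triangulations" unfolding symmetric_triangulations_def by blast
  then show ?thesis using complex_invariant_eq[OF valid] J by (metis imageI)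
qed

type_synonym certificate = "move list \<times> int \<times> nat list \<times> point list"

text \<open>Symmetry and realization are checked only at the end of each move list; the complexes in
  between merely have to admit the moves.\<close>

fun walk :: "tri list \<Rightarrow> certificate list \<Rightarrow> tri list option" where
  "walk T [] = Some T"
| "walk T ((ms, J, \<alpha>, P) # cs) =
    (case apply_moves ms T of None \<Rightarrow> None | Some T' \<Rightarrow> if check T' J \<alpha> P then walk T' cs else None)"

fun value_of :: "certificate \<Rightarrow> int" where
  "value_of (ms, J, \<alpha>, P) = J"

text \<open>The homeomorphism with \<open>N4_start\<close> is carried along the chain, and every
  passed check contributes its value.\<close>

lemma walk_symmetric_triangulations:
  assumes "walk T cs = Some T'" "polyhedron (tris N4_start) homeomorphic_space polyhedron (tris T)"
  shows "polyhedron (tris N4_start) homeomorphic_space polyhedron (tris T') \<and>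
    (\<lambda>c. 4 * value_of c) ` set cs \<subseteq> complex_invariant ` symmetric_triangulations"
  using assms
proof (induction cs arbitrary: T)
  case (Cons c cs)
  obtain ms J \<alpha> P where c: "c = (ms, J, \<alpha>, P)" by (cases c)
  with Cons.prems(1) obtain U where U: "apply_moves ms T = Some U" "check U J \<alpha> P" "walk U cs = Some T'"
    by (auto split: option.splits if_splits)
  have "polyhedron (tris N4_start) homeomorphic_space polyhedron (tris U)"
    using homeomorphic_space_trans[OF Cons.prems(2) apply_moves_homeomorphic[OF U(1)]] .
  then show ?case using Cons.IH[OF U(3)] check_symmetric_triangulation[OF U(2)] c by simp
qed simp

section \<open>The 112 triangulations\<close>

definition reduction :: "move list" where
  "reduction =
   [Flip 14 1 12 13, Flip 14 5 0 12, Flip 14 12 13 0, Remove 14 0 2 13, Flip 11 4 1 9, Flip 10 3 2 6, Flip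
   8 2 11 18, Flip 11 2 3 18, Flip 10 6 7 2, Flip 17 4 2 8, Remove 17 2 8 9, Flip 10 2 1 7, Remove 10 1 4
   7, Flip 6 7 15 2, Flip 16 3 6 7, Remove 16 4 6 7, Flip 11 1 3 9, Flip 11 9 8 3, Remove 11 3 18 8, Flip 9
   3 1 8, Flip 18 2 9 3, Flip 7 4 1 6, Flip 9 3 18 2, Flip 9 4 18 1, Flip 4 2 0 8, Flip 4 6 15 1, Flip 18 2
   9 3, Flip 18 1 9 4, Flip 15 1 4 6, Flip 15 3 4 7, Flip 6 15 2 4, Remove 15 2 4 7, Flip 9 3 18 2, Flip 4
   3 0 7, Flip 3 7 6 0, Flip 4 0 8 7, Flip 18 2 9 3, Flip 18 8 4 3, Remove 18 3 4 9, Flip 0 6 3 7, Flip 7 8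
   4 0, Flip 0 2 13 8, Flip 12 5 2 0, Flip 13 2 5 8, Flip 12 1 2 13, Remove 12 0 2 13, Flip 8 2 9 5, Flip
   13 0 8 2, Flip 7 3 0 6, Flip 5 2 0 9, Flip 13 1 5 2, Remove 13 2 5 8]"

definition N4_0 :: "tri list" where
  "N4_0 =
   [(2,5,8), (1,2,5), (0,5,9), (0,2,9), (0,6,7), (0,3,6), (0,2,8), (5,8,9), (0,4,7), (0,4,8), (3,4,9),
   (3,4,8), (2,3,9), (2,4,7), (2,4,6), (1,4,6), (1,4,9), (1,6,7), (1,8,9), (1,3,8), (1,2,7), (2,3,6),
   (0,1,3), (0,1,5)]"

lemma reduction: "apply_moves reduction N4_start = Some N4_0"
  by code_simp

text \<open>The involution is (0 3)(1 7)(2 9)(4 8)(5 6). From the second certificate of this block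
  on, each flip replaces an invariant edge by an invariant one and so keeps the symmetry.\<close>

definition certificates_1 :: "certificate list" where
  "certificates_1 =
   [([Flip 0 6 7 3, Flip 1 2 7 5, Flip 2 5 8 7], 5227734, [3,7,9,0,8,6,5,1,4,2], [(5,4,4), (4,-5,2),
     (-1,1,-1), (-5,-4,4), (-1,5,-4), (0,1,3), (0,-1,3), (-4,5,2), (1,-5,-4), (1,-1,-1)]),
    ([Flip 1 7 6 5], 4154948, [3,7,9,0,8,6,5,1,4,2], [(5,3,-1), (3,-2,-1), (1,4,1), (-5,-3,-1), (3,5,0),
     (2,4,4), (-2,-4,4), (-3,2,-1), (-3,-5,0), (-1,-4,1)]),
    ([Flip 0 3 1 7], 4166230, [3,7,9,0,8,6,5,1,4,2], [(-3,6,0), (3,2,-3), (0,-1,1), (3,-6,0), (-6,5,6),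
     (0,1,-2), (0,-1,-2), (-3,-2,-3), (6,-5,6), (0,1,1)]),
    ([Flip 2 9 3 0], 4641376, [3,7,9,0,8,6,5,1,4,2], [(5,4,1), (-5,0,6), (1,0,1), (-5,-4,1), (5,2,-3),
     (1,1,4), (-1,-1,4), (5,0,6), (-5,-2,-3), (-1,0,1)])]"

definition N4_1 :: "tri list" where
  "N4_1 =
   [(0,2,3), (0,3,9), (0,1,7), (1,3,7), (1,5,6), (5,6,7), (2,7,8), (5,7,8), (3,6,7), (0,5,9), (0,2,8),
   (5,8,9), (0,4,7), (0,4,8), (3,4,9), (3,4,8), (2,4,7), (2,4,6), (1,4,6), (1,4,9), (1,8,9), (1,3,8),
   (2,3,6), (0,1,5)]"

text \<open>Each block of four starts from an explicitly recorded complex, so no evaluation repeats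
  the chain before it.\<close>

lemma walk_1: "walk N4_0 certificates_1 = Some N4_1"
  by code_simp

text \<open>An edge that is not invariant is flipped together with its image, as in
  \<open>Flip 1 5 0 6\<close> and \<open>Flip 6 7 3 5\<close>.\<close>

definition certificates_2 :: "certificate list" where
  "certificates_2 =
   [([Flip 1 5 0 6, Flip 6 7 3 5], 4787496, [3,7,9,0,8,6,5,1,4,2], [(5,5,-3), (4,-6,6), (-2,-1,-3),
     (-5,-5,-3), (2,4,-6), (-1,0,3), (1,0,3), (-4,6,6), (-2,-4,-6), (2,1,-3)]),
    ([Flip 0 3 2 9], 3578916, [3,7,9,0,8,6,5,1,4,2], [(-3,3,4), (3,3,-6), (2,5,1), (3,-3,4), (-5,-5,3),
     (1,2,-1), (-1,-2,-1), (-3,-3,-6), (5,5,3), (-2,-5,1)]),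
    ([Flip 4 8 3 0], 3958506, [3,7,9,0,8,6,5,1,4,2], [(5,-5,-5), (-2,3,-3), (5,3,6), (-5,5,-5), (1,-5,-2),
     (2,1,1), (-2,-1,1), (2,-3,-3), (-1,5,-2), (-5,-3,6)]),
    ([Flip 0 3 4 8, Flip 5 6 0 3], 5306246, [3,7,9,0,8,6,5,1,4,2], [(-4,4,3), (1,5,6), (-2,1,0), (4,-4,3),
     (-4,-1,-5), (1,-2,3), (-1,2,3), (-1,-5,6), (4,1,-5), (2,-1,0)])]"

definition N4_2 :: "tri list" where
  "N4_2 =
   [(0,3,5), (0,3,6), (0,4,8), (3,4,8), (0,2,9), (2,3,9), (3,5,7), (0,1,6), (0,1,7), (1,3,7), (2,7,8),
   (5,7,8), (0,5,9), (0,2,8), (5,8,9), (0,4,7), (3,4,9), (2,4,7), (2,4,6), (1,4,6), (1,4,9), (1,8,9),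
   (1,3,8), (2,3,6)]"

lemma walk_2: "walk N4_1 certificates_2 = Some N4_2"
  by code_simp

definition certificates_3 :: "certificate list" where
  "certificates_3 =
   [([Flip 0 1 7 6, Flip 3 7 1 5], 4328668, [3,7,9,0,8,6,5,1,4,2], [(-4,-4,2), (4,-4,1), (-1,1,0),
     (4,4,2), (-5,1,-2), (1,-2,1), (-1,2,1), (-4,4,1), (5,-1,-2), (1,-1,0)]),
    ([Flip 0 3 5 6], 3919834, [3,7,9,0,8,6,5,1,4,2], [(6,-1,-3), (1,6,-4), (1,-1,-2), (-6,1,-3),
     (1,-3,-1), (-3,0,-3), (3,0,-3), (-1,-6,-4), (-1,3,-1), (-1,1,-2)]),
    ([Flip 2 9 0 3], 4698360, [3,7,9,0,8,6,5,1,4,2], [(-6,-3,3), (-5,3,1), (2,-1,3), (6,3,3), (1,-3,6),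
     (-6,1,-3), (6,-1,-3), (5,-3,1), (-1,3,6), (-2,1,3)]),
    ([Flip 4 6 1 2, Flip 5 8 9 7], 4397278, [3,7,9,0,8,6,5,1,4,2], [(4,4,3), (-1,1,-2), (-2,-4,3),
     (-4,-4,3), (-4,3,-3), (-2,-1,0), (2,1,0), (1,-1,-2), (4,-3,-3), (2,4,3)])]"

definition N4_3 :: "tri list" where
  "N4_3 =
   [(5,7,9), (7,8,9), (1,2,4), (1,2,6), (0,2,3), (0,3,9), (0,5,6), (3,5,6), (1,3,5), (1,5,7), (0,6,7),
   (1,6,7), (0,4,8), (3,4,8), (2,7,8), (0,5,9), (0,2,8), (0,4,7), (3,4,9), (2,4,7), (1,4,9), (1,8,9),
   (1,3,8), (2,3,6)]"

lemma walk_3: "walk N4_2 certificates_3 = Some N4_3"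
  by code_simp

definition certificates_4 :: "certificate list" where
  "certificates_4 =
   [([Flip 0 7 4 6, Flip 1 3 8 5], 3630734, [3,7,9,0,8,6,5,1,4,2], [(-5,4,6), (1,-2,0), (-5,-4,-3),
     (5,-4,6), (2,1,-6), (-1,1,4), (1,-1,4), (-1,2,0), (-2,-1,-6), (5,4,-3)]),
    ([Flip 0 3 2 9], 3811736, [3,7,9,0,8,6,5,1,4,2], [(0,5,1), (-1,-1,-3), (4,4,-5), (0,-5,1), (-4,4,5),
     (1,3,-2), (-1,-3,-2), (1,1,-3), (4,-4,5), (-4,-4,-5)]),
    ([Flip 5 6 0 3], 4274392, [3,7,9,0,8,6,5,1,4,2], [(-4,-1,3), (1,2,-1), (-1,-4,-4), (4,1,3), (-2,4,4),
     (-1,-1,-1), (1,1,-1), (-1,-2,-1), (2,-4,4), (1,4,-4)]),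
    ([Flip 1 7 6 5], 3717656, [3,7,9,0,8,6,5,1,4,2], [(1,-5,-2), (-4,-1,4), (5,1,5), (-1,5,-2),
     (-3,-5,-3), (1,-1,2), (-1,1,2), (4,1,4), (3,5,-3), (-5,-1,5)])]"

definition N4_4 :: "tri list" where
  "N4_4 =
   [(1,5,6), (5,6,7), (0,3,5), (0,3,6), (0,2,9), (2,3,9), (1,5,8), (3,5,8), (0,4,6), (4,6,7), (5,7,9),
   (7,8,9), (1,2,4), (1,2,6), (0,4,8), (3,4,8), (2,7,8), (0,5,9), (0,2,8), (3,4,9), (2,4,7), (1,4,9),
   (1,8,9), (2,3,6)]"

lemma walk_4: "walk N4_3 certificates_4 = Some N4_4"
  by code_simp

definition certificates_5 :: "certificate list" where
  "certificates_5 =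
   [([Flip 2 6 3 1, Flip 5 9 0 7], 4170990, [3,7,9,0,8,6,5,1,4,2], [(5,-2,3), (-1,3,-2), (1,-5,-3),
     (-5,2,3), (4,2,4), (1,-1,-1), (-1,1,-1), (1,-3,-2), (-4,-2,4), (-1,5,-3)]),
    ([Flip 5 6 1 7], 4898228, [3,7,9,0,8,6,5,1,4,2], [(2,6,-5), (1,1,1), (-3,-5,-6), (-2,-6,-5), (4,-5,6),
     (0,-4,0), (0,4,0), (-1,-1,1), (-4,5,6), (3,5,-6)]),
    ([Flip 0 5 3 7, Flip 3 6 0 1], 6586376, [3,7,9,0,8,6,5,1,4,2], [(-6,6,5), (-3,2,0), (2,-6,6),
     (6,-6,5), (5,1,-5), (2,1,-4), (-2,-1,-4), (3,-2,0), (-5,-1,-5), (-2,6,6)]),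
    ([Flip 1 7 5 6], 4482660, [3,7,9,0,8,6,5,1,4,2], [(-1,5,3), (0,1,-2), (6,1,4), (1,-5,3), (-6,-6,-6),
     (-4,-3,-4), (4,3,-4), (0,-1,-2), (6,6,-6), (-6,-1,4)])]"

definition N4_5 :: "tri list" where
  "N4_5 =
   [(1,5,6), (5,6,7), (0,1,3), (0,1,6), (0,3,7), (3,5,7), (0,7,9), (1,2,3), (0,2,9), (2,3,9), (1,5,8),
   (3,5,8), (0,4,6), (4,6,7), (7,8,9), (1,2,4), (0,4,8), (3,4,8), (2,7,8), (0,2,8), (3,4,9), (2,4,7),
   (1,4,9), (1,8,9)]"

lemma walk_5: "walk N4_4 certificates_5 = Some N4_5"
  by code_simp

definition certificates_6 :: "certificate list" where
  "certificates_6 =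
   [([Flip 0 3 7 1], 5103294, [3,7,9,0,8,6,5,1,4,2], [(6,-7,4), (1,2,-7), (7,3,5), (-6,7,4), (-2,2,3),
     (0,-1,1), (0,1,1), (-1,-2,-7), (2,-2,3), (-7,-3,5)]),
    ([Flip 2 9 0 3], 5465272, [3,7,9,0,8,6,5,1,4,2], [(9,6,-6), (-3,5,-5), (-5,10,-5), (-9,-6,-6),
     (0,-6,8), (4,-6,1), (-4,6,1), (3,-5,-5), (0,6,8), (5,-10,-5)]),
    ([Flip 1 8 9 5, Flip 4 7 2 6], 4170662, [3,7,9,0,8,6,5,1,4,2], [(-3,4,-2), (5,5,-5), (5,-3,-1),
     (3,-4,-2), (4,-1,2), (1,-1,6), (-1,1,6), (-5,-5,-5), (-4,1,2), (-5,3,-1)]),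
    ([Flip 1 5 6 9, Flip 6 7 5 2], 4242880, [3,7,9,0,8,6,5,1,4,2], [(-4,3,-5), (4,5,6), (5,3,-1),
     (4,-3,-5), (1,-4,-2), (2,1,-1), (-2,-1,-1), (-4,-5,6), (-1,4,-2), (-5,-3,-1)])]"

definition N4_6 :: "tri list" where
  "N4_6 =
   [(2,5,6), (2,5,7), (1,6,9), (5,6,9), (2,4,6), (5,8,9), (0,2,3), (0,3,9), (0,1,7), (1,3,7), (0,1,6),
   (3,5,7), (0,7,9), (1,2,3), (3,5,8), (0,4,6), (7,8,9), (1,2,4), (0,4,8), (3,4,8), (2,7,8), (0,2,8),
   (3,4,9), (1,4,9)]"

lemma walk_6: "walk N4_5 certificates_6 = Some N4_6"
  by code_simp

definition certificates_7 :: "certificate list" where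
  "certificates_7 =
   [([Flip 5 6 9 2], 6024726, [3,7,9,0,8,6,5,1,4,2], [(5,-4,-1), (-2,-5,4), (1,-4,1), (-5,4,-1), (-1,1,0),
     (-1,-4,3), (1,4,3), (2,5,4), (1,-1,0), (-1,4,1)]),
    ([Flip 2 9 5 6, Flip 0 3 2 9], 4661502, [3,7,9,0,8,6,5,1,4,2], [(3,-4,-4), (-3,-1,5), (-5,-1,-3),
     (-3,4,-4), (5,5,-2), (1,1,0), (-1,-1,0), (3,1,5), (-5,-5,-2), (5,1,-3)]),
    ([Flip 1 7 0 3], 5210584, [3,7,9,0,8,6,5,1,4,2], [(2,5,4), (0,-1,1), (5,2,6), (-2,-5,4), (-1,-1,-3),
     (-1,-1,-2), (1,1,-2), (0,1,1), (1,1,-3), (-5,-2,6)]),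
    ([Flip 0 1 6 3, Flip 3 7 5 0], 5336148, [3,7,9,0,8,6,5,1,4,2], [(-3,-2,-2), (-1,1,2), (3,-4,3),
     (3,2,-2), (-4,-1,-3), (-1,-1,-1), (1,1,-1), (1,-1,2), (4,1,-3), (-3,4,3)])]"

definition N4_7 :: "tri list" where
  "N4_7 =
   [(0,3,5), (0,5,7), (0,3,6), (1,3,6), (0,2,9), (2,3,9), (2,5,6), (5,6,9), (2,5,7), (1,6,9), (2,4,6),
   (5,8,9), (0,7,9), (1,2,3), (3,5,8), (0,4,6), (7,8,9), (1,2,4), (0,4,8), (3,4,8), (2,7,8), (0,2,8),
   (3,4,9), (1,4,9)]"

lemma walk_7: "walk N4_6 certificates_7 = Some N4_7"
  by code_simp

definition certificates_8 :: "certificate list" where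
  "certificates_8 =
   [([Flip 2 5 7 6, Flip 6 9 1 5], 4395248, [3,7,9,0,8,6,5,1,4,2], [(-4,5,-1), (3,3,2), (2,1,6),
     (4,-5,-1), (2,-1,3), (-3,6,-4), (3,-6,-4), (-3,-3,2), (-2,1,3), (-2,-1,6)]),
    ([Flip 0 4 8 6, Flip 3 8 4 5], 4409916, [3,7,9,0,8,6,5,1,4,2], [(2,-1,-2), (-1,3,1), (-1,1,1),
     (-2,1,-2), (-1,-4,5), (5,0,-4), (-5,0,-4), (1,-3,1), (1,4,5), (1,-1,1)]),
    ([Flip 5 6 7 1], 3981574, [3,7,9,0,8,6,5,1,4,2], [(5,-2,-5), (-2,-5,-2), (-5,-4,2), (-5,2,-5),
     (-1,-1,0), (-1,1,-3), (1,-1,-3), (2,5,-2), (1,1,0), (5,4,2)]),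
    ([Flip 0 3 6 5], 4890436, [3,7,9,0,8,6,5,1,4,2], [(-2,5,6), (-2,-1,2), (4,3,6), (2,-5,6), (-5,-2,-2),
     (-3,-1,-3), (3,1,-3), (2,1,2), (5,2,-2), (-4,-3,6)])]"

definition N4_8 :: "tri list" where
  "N4_8 =
   [(0,5,6), (3,5,6), (1,5,7), (1,6,7), (3,4,5), (4,5,8), (0,6,8), (4,6,8), (1,5,9), (2,6,7), (0,5,7),
   (1,3,6), (0,2,9), (2,3,9), (2,4,6), (5,8,9), (0,7,9), (1,2,3), (7,8,9), (1,2,4), (2,7,8), (0,2,8),
   (3,4,9), (1,4,9)]"

lemma walk_8: "walk N4_7 certificates_8 = Some N4_8"
  by code_simp

definition certificates_9 :: "certificate list" where
  "certificates_9 =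
   [([Flip 2 9 0 3], 3904742, [3,7,9,0,8,6,5,1,4,2], [(-5,-6,-5), (-5,0,2), (-1,1,-2), (5,6,-5), (-2,0,1),
     (5,1,5), (-5,-1,5), (5,0,2), (2,0,1), (1,-1,-2)]),
    ([Flip 1 6 3 7, Flip 5 7 0 1], 3591282, [3,7,9,0,8,6,5,1,4,2], [(5,-1,6), (-1,-1,3), (2,0,6),
     (-5,1,6), (-4,-5,1), (-2,-5,-3), (2,5,-3), (1,1,3), (4,5,1), (-2,0,6)]),
    ([Flip 0 5 6 1, Flip 3 6 5 7], 3616838, [3,7,9,0,8,6,5,1,4,2], [(5,-4,2), (5,2,-5), (-2,3,1),
     (-5,4,2), (-1,1,-1), (-1,0,-4), (1,0,-4), (-5,-2,-5), (1,-1,-1), (2,-3,1)]),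
    ([Flip 0 3 2 9], 4282216, [3,7,9,0,8,6,5,1,4,2], [(-5,-6,4), (-6,5,-2), (2,6,5), (5,6,4), (-2,-1,3),
     (1,1,2), (-1,-1,2), (6,-5,-2), (2,1,3), (-2,-6,5)])]"

definition N4_9 :: "tri list" where
  "N4_9 =
   [(0,2,9), (2,3,9), (3,5,7), (5,6,7), (0,1,6), (1,5,6), (0,1,7), (1,3,7), (3,4,5), (4,5,8), (0,6,8),
   (4,6,8), (1,5,9), (2,6,7), (2,4,6), (5,8,9), (0,7,9), (1,2,3), (7,8,9), (1,2,4), (2,7,8), (0,2,8),
   (3,4,9), (1,4,9)]"

lemma walk_9: "walk N4_8 certificates_9 = Some N4_9"
  by code_simp

definition certificates_10 :: "certificate list" where
  "certificates_10 =
   [([Flip 1 7 3 0], 3875776, [3,7,9,0,8,6,5,1,4,2], [(2,-6,4), (-6,4,-3), (-2,5,3), (-2,6,4), (-1,2,2),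
     (2,-1,-4), (-2,1,-4), (6,-4,-3), (1,-2,2), (2,-5,3)]),
    ([Flip 5 6 1 7], 4550684, [3,7,9,0,8,6,5,1,4,2], [(5,1,6), (1,-6,-4), (-3,-2,3), (-5,-1,6), (-1,-1,1),
     (-1,1,-3), (1,-1,-3), (-1,6,-4), (1,1,1), (3,2,3)]),
    ([Flip 4 8 6 5], 4433776, [3,7,9,0,8,6,5,1,4,2], [(-1,6,5), (0,2,2), (3,-4,6), (1,-6,5), (-4,-3,-2),
     (-2,-4,-6), (2,4,-6), (0,-2,2), (4,3,-2), (-3,4,6)]),
    ([Flip 4 6 2 5, Flip 5 8 9 6], 5673648, [3,7,9,0,8,6,5,1,4,2], [(-1,0,6), (7,5,-1), (3,-2,-1),
     (1,0,6), (-7,4,-7), (-3,-2,-2), (3,2,-2), (-7,-5,-1), (7,-4,-7), (-3,2,-1)])]"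

definition N4_10 :: "tri list" where
  "N4_10 =
   [(5,6,9), (6,8,9), (2,4,5), (2,5,6), (1,5,7), (1,6,7), (0,1,3), (0,3,7), (0,2,9), (2,3,9), (3,5,7),
   (0,1,6), (3,4,5), (0,6,8), (1,5,9), (2,6,7), (0,7,9), (1,2,3), (7,8,9), (1,2,4), (2,7,8), (0,2,8),
   (3,4,9), (1,4,9)]"

lemma walk_10: "walk N4_9 certificates_10 = Some N4_10"
  by code_simp

text \<open>The last two certificates use another involution, (0 5)(1 8)(2 9)(3 6)(4 7); the next
  block returns to the former one.\<close>

definition certificates_11 :: "certificate list" where
  "certificates_11 =
   [([Flip 0 1 6 3, Flip 3 7 5 0], 5343556, [3,7,9,0,8,6,5,1,4,2], [(5,1,1), (1,1,-2), (-1,-6,-6),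
     (-5,-1,1), (6,4,6), (1,-1,0), (-1,1,0), (-1,-1,-2), (-6,-4,6), (1,6,-6)]),
    ([Flip 0 6 8 3, Flip 3 5 4 0], 4912824, [3,7,9,0,8,6,5,1,4,2], [(-3,5,-4), (1,-3,-2), (-6,-5,-5),
     (3,-5,-4), (-1,2,-2), (2,-1,6), (-2,1,6), (-1,3,-2), (1,-2,-2), (6,5,-5)]),
    ([Flip 0 3 8 4, Flip 2 9 0 3], 3670192, [5,8,9,6,7,0,3,4,1,2], [(-3,-5,5), (3,4,-1), (2,5,0),
     (5,3,-2), (-2,5,1), (3,5,5), (-5,-3,-2), (2,-5,1), (-3,-4,-1), (-2,-5,0)]),
    ([Flip 0 5 7 4], 4062218, [5,8,9,6,7,0,3,4,1,2], [(-5,-1,-2), (-4,3,-1), (2,3,1), (1,2,5), (4,2,-2),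
     (5,1,-2), (-1,-2,5), (-4,-2,-2), (4,-3,-1), (-2,-3,1)])]"

definition N4_11 :: "tri list" where
  "N4_11 =
   [(0,4,7), (4,5,7), (0,2,3), (0,3,9), (0,4,8), (3,4,8), (3,6,8), (1,3,6), (5,6,9), (6,8,9), (2,4,5),
   (2,5,6), (1,5,7), (1,6,7), (1,5,9), (2,6,7), (0,7,9), (1,2,3), (7,8,9), (1,2,4), (2,7,8), (0,2,8),
   (3,4,9), (1,4,9)]"

lemma walk_11: "walk N4_10 certificates_11 = Some N4_11"
  by code_simp

definition certificates_12 :: "certificate list" where
  "certificates_12 =
   [([Flip 3 6 1 8], 4543040, [3,7,9,0,8,6,5,1,4,2], [(-4,4,4), (1,0,-3), (4,1,-5), (4,-4,4), (4,-5,0),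
     (5,4,-4), (-5,-4,-4), (-1,0,-3), (-4,5,0), (-4,-1,-5)]),
    ([Flip 0 3 2 9], 6117196, [3,7,9,0,8,6,5,1,4,2], [(5,-4,-1), (2,-4,-4), (-5,1,5), (-5,4,-1), (-2,1,1),
     (0,1,-3), (0,-1,-3), (-2,4,-4), (2,-1,1), (5,-1,5)]),
    ([Flip 4 8 0 3], 5410602, [3,7,9,0,8,6,5,1,4,2], [(-5,-5,3), (-4,6,1), (2,6,5), (5,5,3), (0,4,3),
     (-2,4,-5), (2,-4,-5), (4,-6,1), (0,-4,3), (-2,-6,5)]),
    ([Flip 2 5 4 6, Flip 6 9 5 8], 4961216, [3,7,9,0,8,6,5,1,4,2], [(-2,5,-3), (-6,-4,2), (-1,-3,-6),
     (2,-5,-3), (0,-1,-3), (2,3,0), (-2,-3,0), (6,4,2), (0,1,-3), (1,3,-6)])]"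

definition N4_12 :: "tri list" where
  "N4_12 =
   [(5,6,8), (5,8,9), (2,4,6), (4,5,6), (0,3,4), (0,3,8), (0,2,9), (2,3,9), (1,3,8), (1,6,8), (0,4,7),
   (4,5,7), (1,5,7), (1,6,7), (1,5,9), (2,6,7), (0,7,9), (1,2,3), (7,8,9), (1,2,4), (2,7,8), (0,2,8),
   (3,4,9), (1,4,9)]"

lemma walk_12: "walk N4_11 certificates_12 = Some N4_12"
  by code_simp

definition certificates_13 :: "certificate list" where
  "certificates_13 =
   [([Flip 0 3 4 8], 6038284, [3,7,9,0,8,6,5,1,4,2], [(-5,2,0), (2,5,4), (5,3,-4), (5,-2,0), (1,0,1),
     (-1,-1,3), (1,1,3), (-2,-5,4), (-1,0,1), (-5,-3,-4)]),
    ([Flip 2 9 0 3], 4991078, [3,7,9,0,8,6,5,1,4,2], [(2,-3,3), (-5,-2,-5), (-2,1,4), (-2,3,3), (-1,0,0),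
     (4,1,-4), (-4,-1,-4), (5,2,-5), (1,0,0), (2,-1,4)]),
    ([Flip 0 9 7 3, Flip 2 3 1 0], 5717952, [3,7,9,0,8,6,5,1,4,2], [(-2,-1,1), (-1,-1,3), (-1,-3,6),
     (2,1,1), (-6,-2,0), (6,-6,-2), (-6,6,-2), (1,1,3), (6,2,0), (1,3,6)]),
    ([Flip 1 8 3 6, Flip 4 7 0 5], 3622248, [3,7,9,0,8,6,5,1,4,2], [(2,1,-2), (4,-3,4), (-2,3,2),
     (-2,-1,-2), (-5,-3,-3), (-5,-4,-4), (5,4,-4), (-4,3,4), (5,3,-3), (2,-3,2)])]"

definition N4_13 :: "tri list" where
  "N4_13 =
   [(0,4,5), (0,5,7), (1,3,6), (3,6,8), (0,1,2), (0,1,3), (0,3,7), (3,7,9), (0,4,8), (3,4,8), (5,6,8),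
   (5,8,9), (2,4,6), (4,5,6), (1,5,7), (1,6,7), (1,5,9), (2,6,7), (7,8,9), (1,2,4), (2,7,8), (0,2,8),
   (3,4,9), (1,4,9)]"

lemma walk_13: "walk N4_12 certificates_13 = Some N4_13"
  by code_simp

definition certificates_14 :: "certificate list" where
  "certificates_14 =
   [([Flip 0 2 8 1, Flip 3 9 4 7], 5870660, [3,7,9,0,8,6,5,1,4,2], [(-5,1,4), (-1,-1,-4), (2,5,-3),
     (5,-1,4), (-3,1,-2), (0,3,-6), (0,-3,-6), (1,1,-4), (3,-1,-2), (-2,-5,-3)]),
    ([Flip 4 5 6 0, Flip 6 8 5 3], 4914364, [3,7,9,0,8,6,5,1,4,2], [(-4,5,0), (-1,0,2), (5,5,1), (4,-5,0),
     (-3,4,1), (2,4,6), (-2,-4,6), (1,0,2), (3,-4,1), (-5,-5,1)]),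
    ([Flip 4 6 2 0, Flip 5 8 9 3], 5361992, [3,7,9,0,8,6,5,1,4,2], [(3,3,4), (-4,5,-2), (0,2,-1),
     (-3,-3,4), (-2,-3,2), (2,1,-1), (-2,-1,-1), (4,-5,-2), (2,3,2), (0,-2,-1)]),
    ([Flip 1 9 4 5, Flip 2 7 8 6], 5270152, [3,7,9,0,8,6,5,1,4,2], [(-2,-1,5), (-4,-5,6), (-3,3,-6),
     (2,1,5), (-2,0,0), (-4,1,3), (4,-1,3), (4,5,6), (2,0,0), (3,-3,-6)])]"

definition N4_14 :: "tri list" where
  "N4_14 =
   [(2,6,8), (6,7,8), (1,4,5), (4,5,9), (3,5,9), (3,8,9), (0,2,4), (0,2,6), (3,5,6), (0,5,6), (3,4,7),
   (4,7,9), (0,1,8), (1,2,8), (0,5,7), (1,3,6), (0,1,3), (0,3,7), (0,4,8), (3,4,8), (1,5,7), (1,6,7),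
   (7,8,9), (1,2,4)]"

lemma walk_14: "walk N4_13 certificates_14 = Some N4_14"
  by code_simp

definition certificates_15 :: "certificate list" where
  "certificates_15 =
   [([Flip 0 2 4 6, Flip 3 9 5 8], 6411920, [3,7,9,0,8,6,5,1,4,2], [(-5,-3,0), (-2,1,2), (2,-5,3),
     (5,3,0), (-3,-2,1), (2,-2,5), (-2,2,5), (2,-1,2), (3,2,1), (-2,5,3)]),
    ([Flip 1 8 0 2, Flip 4 7 3 9], 4876460, [3,7,9,0,8,6,5,1,4,2], [(6,2,3), (-2,-1,-1), (-3,-6,3),
     (-6,-2,3), (1,-6,6), (3,6,-5), (-3,-6,-5), (2,1,-1), (-1,6,6), (3,6,3)]),
    ([Flip 1 4 2 5, Flip 7 8 9 6], 5095512, [3,7,9,0,8,6,5,1,4,2], [(-5,-4,-1), (2,1,3), (5,-1,-1),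
     (5,4,-1), (4,-4,-4), (-5,0,5), (5,0,5), (-2,-1,3), (-4,4,-4), (-5,1,-1)]),
    ([Flip 0 2 1 8, Flip 3 9 4 7], 5109644, [3,7,9,0,8,6,5,1,4,2], [(-3,2,-4), (1,-1,-5), (-1,-1,-4),
     (3,-2,-4), (0,-2,4), (-2,6,-6), (2,-6,-6), (-1,1,-5), (0,2,4), (1,1,-4)])]"

definition N4_15 :: "tri list" where
  "N4_15 =
   [(3,4,7), (4,7,9), (0,1,8), (1,2,8), (6,7,9), (6,8,9), (1,2,5), (2,4,5), (3,5,8), (5,8,9), (0,4,6),
   (2,4,6), (2,6,8), (4,5,9), (3,5,6), (0,5,6), (0,5,7), (1,3,6), (0,1,3), (0,3,7), (0,4,8), (3,4,8),
   (1,5,7), (1,6,7)]"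

lemma walk_15: "walk N4_14 certificates_15 = Some N4_15"
  by code_simp

text \<open>The third certificate passes to the involution (0 7)(1 3)(2 9)(4 6)(5 8), which takes
  four flips.\<close>

definition certificates_16 :: "certificate list" where
  "certificates_16 =
   [([Flip 4 6 0 2, Flip 5 8 3 9], 4260656, [3,7,9,0,8,6,5,1,4,2], [(0,1,-4), (-1,6,-5), (2,5,3),
     (0,-1,-4), (1,3,0), (2,6,-3), (-2,-6,-3), (1,-6,-5), (-1,-3,0), (-2,-5,3)]),
    ([Flip 0 8 4 1, Flip 3 4 8 7], 3948336, [3,7,9,0,8,6,5,1,4,2], [(-4,-1,4), (4,4,-3), (-4,-1,1),
     (4,1,4), (1,0,1), (4,-5,5), (-4,5,5), (-4,-4,-3), (-1,0,1), (4,1,1)]),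
    ([Flip 0 1 3 4, Flip 2 6 8 0, Flip 5 7 1 0, Flip 4 9 5 7], 4667478, [7,3,9,1,6,8,4,0,5,2],
     [(-4,-4,-6), (-3,6,2), (-3,-1,4), (3,-6,2), (4,4,-2), (-5,-1,2), (-4,-4,-2), (4,4,-6), (5,1,2),
     (3,1,4)]),
    ([Flip 4 5 2 7, Flip 6 8 9 0], 5122652, [7,3,9,1,6,8,4,0,5,2], [(-4,-1,2), (5,5,-3), (1,2,-4),
     (-5,-5,-3), (4,1,1), (-2,3,-6), (-4,-1,1), (4,1,2), (2,-3,-6), (-1,-2,-4)])]"

definition N4_16 :: "tri list" where
  "N4_16 =
   [(0,6,9), (0,8,9), (2,4,7), (2,5,7), (5,7,9), (0,1,5), (0,1,7), (0,2,8), (0,3,4), (1,3,4), (3,7,8),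
   (4,7,8), (1,4,8), (3,5,9), (3,8,9), (0,2,4), (1,2,8), (6,7,9), (1,2,5), (3,5,6), (0,5,6), (1,3,6),
   (0,3,7), (1,6,7)]"

lemma walk_16: "walk N4_15 certificates_16 = Some N4_16"
  by code_simp

definition certificates_17 :: "certificate list" where
  "certificates_17 =
   [([Flip 1 3 6 4], 4444496, [7,3,9,1,6,8,4,0,5,2], [(-3,4,-4), (-2,-5,4), (4,-2,2), (2,5,4), (5,-3,2),
     (-5,1,4), (-5,3,2), (3,-4,-4), (5,-1,4), (-4,2,2)]),
    ([Flip 0 7 3 1], 4064908, [7,3,9,1,6,8,4,0,5,2], [(-6,-2,1), (1,5,4), (2,-5,-6), (-1,-5,4), (6,-6,-3),
     (-1,4,1), (-6,6,-3), (6,2,1), (1,-4,1), (-2,5,-6)]),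
    ([Flip 0 4 2 3, Flip 6 7 1 9], 4327326, [7,3,9,1,6,8,4,0,5,2], [(4,5,5), (4,0,-4), (-2,-1,5),
     (-4,0,-4), (-4,-3,4), (3,2,0), (4,3,4), (-4,-5,5), (-3,-2,0), (2,1,5)]),
    ([Flip 1 3 0 7], 4022560, [7,3,9,1,6,8,4,0,5,2], [(5,-1,-6), (-4,-6,2), (-2,1,-1), (4,6,2), (-4,0,-1),
     (3,-2,4), (4,0,-1), (-5,1,-6), (-3,2,4), (2,-1,-1)])]"

definition N4_17 :: "tri list" where
  "N4_17 =
   [(0,1,7), (0,3,7), (1,6,9), (1,7,9), (0,2,3), (2,3,4), (1,4,6), (3,4,6), (0,6,9), (0,8,9), (2,4,7),
   (2,5,7), (5,7,9), (0,1,5), (0,2,8), (3,7,8), (4,7,8), (1,4,8), (3,5,9), (3,8,9), (1,2,8), (1,2,5),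
   (3,5,6), (0,5,6)]"

lemma walk_17: "walk N4_16 certificates_17 = Some N4_17"
  by code_simp

definition certificates_18 :: "certificate list" where
  "certificates_18 =
   [([Flip 1 4 8 6, Flip 3 6 5 4], 3928250, [7,3,9,1,6,8,4,0,5,2], [(3,1,-4), (-1,-6,-5), (-1,-3,1),
     (1,6,-5), (-1,5,-1), (5,-6,4), (1,-5,-1), (-3,-1,-4), (-5,6,4), (1,3,1)]),
    ([Flip 0 7 1 3], 3961814, [7,3,9,1,6,8,4,0,5,2], [(-1,-4,1), (5,6,5), (2,6,-3), (-5,-6,5), (-4,-3,2),
     (4,-3,-5), (4,3,2), (1,4,1), (-4,3,-5), (-2,-6,-3)]),
    ([Flip 0 8 2 9, Flip 0 9 6 2, Flip 3 9 5 8, Flip 1 7 9 3, Flip 1 3 0 9], 5198716,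
     [4,7,5,6,0,2,3,1,9,8], [(1,-1,3), (-3,1,3), (-6,-4,-3), (-1,-1,6), (-1,1,3), (6,4,-3), (1,1,6),
     (3,-1,3), (3,5,-4), (-3,-5,-4)]),
    ([Flip 2 5 1 7], 3972020, [4,7,5,6,0,2,3,1,9,8], [(3,3,2), (-2,4,4), (3,5,3), (-4,1,-1), (-3,-3,2),
     (-3,-5,3), (4,-1,-1), (2,-4,4), (-4,1,-4), (4,-1,-4)])]"

definition N4_18 :: "tri list" where
  "N4_18 =
   [(1,2,7), (1,5,7), (0,1,9), (0,3,9), (3,7,9), (3,5,8), (5,8,9), (0,2,6), (2,6,9), (2,8,9), (3,4,5),
   (4,5,6), (1,6,8), (4,6,8), (1,6,9), (0,2,3), (2,3,4), (2,4,7), (5,7,9), (0,1,5), (3,7,8), (4,7,8),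
   (1,2,8), (0,5,6)]"

lemma walk_18: "walk N4_17 certificates_18 = Some N4_18"
  by code_simp

definition certificates_19 :: "certificate list" where
  "certificates_19 =
   [([Flip 8 9 2 5], 4393998, [4,7,5,6,0,2,3,1,9,8], [(-2,3,2), (5,-2,-4), (-2,-5,2), (4,1,1), (2,-3,2),
     (2,5,2), (-4,-1,1), (-5,2,-4), (4,-5,3), (-4,5,3)]),
    ([Flip 1 5 0 7, Flip 2 7 4 1], 3485932, [4,7,5,6,0,2,3,1,9,8], [(1,-1,-5), (-6,1,-6), (3,6,4),
     (-2,-1,-1), (-1,1,-5), (-3,-6,4), (2,1,-1), (6,-1,-6), (1,3,3), (-1,-3,3)]),
    ([Flip 2 5 8 9], 3836828, [4,7,5,6,0,2,3,1,9,8], [(-1,1,-3), (1,3,-5), (3,-4,-3), (0,1,-2), (1,-1,-3),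
     (-3,4,-3), (0,-1,-2), (-1,-3,-5), (1,2,5), (-1,-2,5)]),
    ([Flip 1 7 0 4], 4270070, [4,7,5,6,0,2,3,1,9,8], [(2,1,6), (-4,-6,5), (-5,3,3), (-1,-2,3), (-2,-1,6),
     (5,-3,3), (1,2,3), (4,6,5), (-1,-1,-4), (1,1,-4)])]"

definition N4_19 :: "tri list" where
  "N4_19 =
   [(0,1,4), (0,4,7), (2,8,9), (5,8,9), (1,2,4), (0,5,7), (0,1,9), (0,3,9), (3,7,9), (3,5,8), (0,2,6),
   (2,6,9), (3,4,5), (4,5,6), (1,6,8), (4,6,8), (1,6,9), (0,2,3), (2,3,4), (5,7,9), (3,7,8), (4,7,8),
   (1,2,8), (0,5,6)]"

lemma walk_19: "walk N4_18 certificates_19 = Some N4_19"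
  by code_simp

definition certificates_20 :: "certificate list" where
  "certificates_20 =
   [([Flip 8 9 2 5], 4004558, [4,7,5,6,0,2,3,1,9,8], [(1,5,2), (-5,-3,-2), (5,-4,-4), (-2,-1,-2),
     (-1,-5,2), (-5,4,-4), (2,1,-2), (5,3,-2), (1,-1,-3), (-1,1,-3)]),
    ([Flip 2 8 1 5, Flip 5 9 7 2], 3768712, [4,7,5,6,0,2,3,1,9,8], [(0,3,4), (-4,-5,-1), (5,-1,-5),
     (-2,-2,-1), (0,-3,4), (-5,1,-5), (2,2,-1), (4,5,-1), (1,-1,-3), (-1,1,-3)]),
    ([Flip 0 4 1 7], 3774358, [4,7,5,6,0,2,3,1,9,8], [(6,1,-3), (4,-5,-5), (-3,-4,6), (0,-3,-3),
     (-6,-1,-3), (3,4,6), (0,3,-3), (-4,5,-5), (-2,1,-3), (2,-1,-3)]),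
    ([Flip 0 5 6 7, Flip 2 4 3 1], 5000408, [4,7,5,6,0,2,3,1,9,8], [(-3,3,0), (2,5,1), (1,0,-3), (4,2,0),
     (3,-3,0), (-1,0,-3), (-4,-2,0), (-2,-5,1), (2,0,0), (-2,0,0)])]"

definition N4_20 :: "tri list" where
  "N4_20 =
   [(1,2,3), (1,3,4), (0,6,7), (5,6,7), (0,1,7), (1,4,7), (2,5,7), (2,7,9), (1,2,5), (1,5,8), (0,1,9),
   (0,3,9), (3,7,9), (3,5,8), (0,2,6), (2,6,9), (3,4,5), (4,5,6), (1,6,8), (4,6,8), (1,6,9), (0,2,3),
   (3,7,8), (4,7,8)]"

lemma walk_20: "walk N4_19 certificates_20 = Some N4_20"
  by code_simp

definition certificates_21 :: "certificate list" where
  "certificates_21 =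
   [([Flip 1 7 0 4], 4204356, [4,7,5,6,0,2,3,1,9,8], [(1,6,6), (-5,2,-1), (4,-6,-1), (-3,-6,3), (-1,-6,6),
     (-4,6,-1), (3,6,3), (5,-2,-1), (0,3,2), (0,-3,2)]),
    ([Flip 0 1 9 4, Flip 4 7 8 0], 3725712, [4,7,5,6,0,2,3,1,9,8], [(-2,4,-5), (-4,-5,-4), (-1,-4,4),
     (-1,-1,-1), (2,-4,-5), (1,4,4), (1,1,-1), (4,5,-4), (0,1,-5), (0,-1,-5)]),
    ([Flip 0 4 9 8], 4487370, [4,7,5,6,0,2,3,1,9,8], [(-4,6,-3), (4,6,-1), (3,2,-1), (-1,2,-4), (4,-6,-3),
     (-3,-2,-1), (1,-2,-4), (-4,-6,-1), (-3,1,-6), (3,-1,-6)]),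
    ([Flip 2 5 1 7], 4975040, [4,7,5,6,0,2,3,1,9,8], [(6,2,-1), (5,-6,0), (-5,-2,0), (1,0,-4), (-6,-2,-1),
     (5,2,0), (-1,0,-4), (-5,6,0), (0,1,-6), (0,-1,-6)])]"

definition N4_21 :: "tri list" where
  "N4_21 =
   [(1,2,7), (1,5,7), (0,8,9), (4,8,9), (0,7,8), (1,4,9), (1,2,3), (1,3,4), (0,6,7), (5,6,7), (2,7,9),
   (1,5,8), (0,3,9), (3,7,9), (3,5,8), (0,2,6), (2,6,9), (3,4,5), (4,5,6), (1,6,8), (4,6,8), (1,6,9),
   (0,2,3), (3,7,8)]"

lemma walk_21: "walk N4_20 certificates_21 = Some N4_21"
  by code_simp

text \<open>From the last certificate on, the involutions have two fixed vertices, here 3 and 6.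
  Invariance under the half turn forces these onto the axis, hence positions of the form
  (0,0,z).\<close>

definition certificates_22 :: "certificate list" where
  "certificates_22 =
   [([Flip 8 9 0 4], 4102654, [4,7,5,6,0,2,3,1,9,8], [(-4,-4,3), (6,-1,-5), (3,5,5), (4,-6,-6), (4,4,3),
     (-3,-5,5), (-4,6,-6), (-6,1,-5), (-6,-5,-4), (6,5,-4)]),
    ([Flip 2 3 0 1, Flip 5 6 4 7], 5408300, [4,7,5,6,0,2,3,1,9,8], [(-5,3,3), (6,3,4), (-3,3,-3),
     (-4,-6,5), (5,-3,3), (3,-3,-3), (4,6,5), (-6,-3,4), (-3,2,-4), (3,-2,-4)]),
    ([Flip 1 7 2 5], 4337126, [4,7,5,6,0,2,3,1,9,8], [(5,4,1), (-4,-1,0), (3,4,4), (1,-5,-2), (-5,-4,1),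
     (-3,-4,4), (-1,5,-2), (4,1,0), (3,3,5), (-3,-3,5)]),
    ([Flip 0 1 2 3, Flip 2 7 9 5, Flip 0 6 2 7, Flip 4 9 1 0], 4013064, [5,7,8,3,9,0,6,1,2,4], [(-1,-5,6),
     (5,2,-5), (-2,-1,-3), (0,0,3), (0,-2,4), (1,5,6), (0,0,1), (-5,-2,-5), (2,1,-3), (0,2,4)])]"

definition N4_22 :: "tri list" where
  "N4_22 =
   [(0,1,4), (0,1,9), (0,2,7), (2,6,7), (2,5,9), (5,7,9), (0,2,3), (1,2,3), (1,2,5), (4,5,7), (4,6,7),
   (0,4,8), (0,7,8), (1,3,4), (1,5,8), (0,3,9), (3,7,9), (3,5,8), (2,6,9), (3,4,5), (1,6,8), (4,6,8),
   (1,6,9), (3,7,8)]"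

lemma walk_22: "walk N4_21 certificates_22 = Some N4_22"
  by code_simp

definition certificates_23 :: "certificate list" where
  "certificates_23 =
   [([Flip 1 3 4 2, Flip 3 7 8 9], 3781440, [5,7,8,3,9,0,6,1,2,4], [(-3,-3,-5), (-3,0,-4), (-2,3,-2),
     (0,0,-1), (-2,-1,2), (3,3,-5), (0,0,-3), (3,0,-4), (2,-3,-2), (2,1,2)]),
    ([Flip 2 4 1 3, Flip 2 9 6 5, Flip 4 8 6 0, Flip 8 9 3 7], 4941312, [0,7,4,6,2,5,3,1,9,8], [(0,0,1),
     (-5,2,-1), (-1,-1,2), (-4,-5,4), (1,1,2), (0,0,0), (4,5,4), (5,-2,-1), (2,-1,0), (-2,1,0)]),
    ([Flip 0 1 4 9, Flip 0 3 9 2, Flip 1 5 8 2, Flip 3 5 4 8, Flip 6 8 1 0, Flip 7 9 5 3], 3689400,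
     [8,7,2,6,4,9,3,1,0,5], [(-1,-1,-3), (5,-1,-1), (0,0,-6), (4,-3,1), (0,0,-1), (-1,5,4), (-4,3,1),
     (-5,1,-1), (1,1,-3), (1,-5,4)]),
    ([Flip 0 8 7 1], 4079890, [8,7,2,6,4,9,3,1,0,5], [(0,-1,0), (-4,5,0), (0,0,4), (-4,1,-2), (0,0,-2),
     (2,3,-4), (4,-1,-2), (4,-5,0), (0,1,0), (-2,-3,-4)])]"

definition N4_23 :: "tri list" where
  "N4_23 =
   [(0,1,7), (1,7,8), (3,5,7), (3,5,9), (0,1,6), (3,4,8), (4,5,8), (1,2,8), (2,5,8), (0,2,9), (2,3,9),
   (0,4,9), (1,4,9), (3,7,8), (0,4,6), (2,5,6), (5,6,9), (1,2,3), (1,3,4), (0,2,7), (2,6,7), (4,5,7),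
   (4,6,7), (1,6,9)]"

lemma walk_23: "walk N4_22 certificates_23 = Some N4_23"
  by code_simp

definition certificates_24 :: "certificate list" where
  "certificates_24 =
   [([Flip 5 9 6 3], 4561472, [8,7,2,6,4,9,3,1,0,5], [(0,-1,0), (1,3,0), (0,0,-5), (5,-2,3), (0,0,1),
     (-2,5,5), (-5,2,3), (-1,-3,0), (0,1,0), (2,-5,5)]),
    ([Flip 0 2 7 9, Flip 2 8 1 5], 5779340, [8,7,2,6,4,9,3,1,0,5], [(0,4,6), (-5,-3,5), (0,0,-2),
     (-3,2,3), (0,0,4), (-1,-6,1), (3,-2,3), (5,3,5), (0,-4,6), (1,6,1)]),
    ([Flip 1 7 0 8], 4670370, [8,7,2,6,4,9,3,1,0,5], [(-2,3,6), (-6,-6,6), (0,0,-3), (-5,4,1), (0,0,4),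
     (2,-6,0), (5,-4,1), (6,6,6), (2,-3,6), (-2,6,0)]),
    ([Flip 3 6 5 9], 4650178, [8,7,2,6,4,9,3,1,0,5], [(5,0,-1), (-4,-2,0), (0,0,5), (1,-5,2), (0,0,0),
     (-4,2,2), (-1,5,2), (4,2,0), (-5,0,-1), (4,-2,2)])]"

definition N4_24 :: "tri list" where
  "N4_24 =
   [(3,5,9), (5,6,9), (0,1,8), (0,7,8), (1,2,5), (1,5,8), (0,7,9), (2,7,9), (3,5,7), (0,1,6), (3,4,8),
   (4,5,8), (2,3,9), (0,4,9), (1,4,9), (3,7,8), (0,4,6), (2,5,6), (1,2,3), (1,3,4), (2,6,7), (4,5,7),
   (4,6,7), (1,6,9)]"

lemma walk_24: "walk N4_23 certificates_24 = Some N4_24"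
  by code_simp

definition certificates_25 :: "certificate list" where
  "certificates_25 =
   [([Flip 0 8 1 7], 5743796, [8,7,2,6,4,9,3,1,0,5], [(-3,-4,-2), (1,4,-3), (0,0,4), (-4,-1,0), (0,0,1),
     (1,1,3), (4,1,0), (-1,-4,-3), (3,4,-2), (-1,-1,3)]),
    ([Flip 1 7 0 8, Flip 0 7 9 8, Flip 1 8 5 0], 4899378, [8,7,2,6,4,9,3,1,0,5], [(0,1,2), (-6,-2,-1),
     (0,0,5), (-1,4,-2), (0,0,0), (-3,-6,-2), (1,-4,-2), (6,2,-1), (0,-1,2), (3,6,-2)]),
    ([Flip 5 9 3 6], 4613960, [8,7,2,6,4,9,3,1,0,5], [(5,4,-4), (2,-6,1), (0,0,5), (4,2,2), (0,0,1),
     (-1,-6,2), (-4,-2,2), (-2,6,1), (-5,-4,-4), (1,6,2)]),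
    ([Flip 0 8 9 5], 5800480, [8,7,2,6,4,9,3,1,0,5], [(1,-1,-3), (3,-2,1), (0,0,-6), (6,-5,2), (0,0,-1),
     (6,3,-4), (-6,5,2), (-3,2,1), (-1,1,-3), (-6,-3,-4)])]"

definition N4_25 :: "tri list" where
  "N4_25 =
   [(0,5,9), (5,8,9), (3,5,6), (3,6,9), (0,1,5), (7,8,9), (1,2,5), (2,7,9), (3,5,7), (0,1,6), (3,4,8),
   (4,5,8), (2,3,9), (0,4,9), (1,4,9), (3,7,8), (0,4,6), (2,5,6), (1,2,3), (1,3,4), (2,6,7), (4,5,7),
   (4,6,7), (1,6,9)]"

lemma walk_25: "walk N4_24 certificates_25 = Some N4_25"
  by code_simp

definition certificates_26 :: "certificate list" where
  "certificates_26 =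
   [([Flip 1 5 2 0, Flip 7 9 2 8], 4837248, [8,7,2,6,4,9,3,1,0,5], [(1,0,-1), (2,-1,-4), (0,0,6),
     (5,-1,-5), (0,0,-3), (2,-6,-1), (-5,1,-5), (-2,1,-4), (-1,0,-1), (-2,6,-1)]),
    ([Flip 5 9 0 8], 4425404, [8,7,2,6,4,9,3,1,0,5], [(1,-1,-1), (-2,-4,1), (0,0,-4), (3,-4,2), (0,0,1),
     (-5,-4,2), (-3,4,2), (2,4,1), (-1,1,-1), (5,4,2)]),
    ([Flip 3 6 5 9], 4285856, [8,7,2,6,4,9,3,1,0,5], [(1,0,1), (-2,-4,-1), (0,0,6), (3,-3,-3), (0,0,-1),
     (-6,-4,-4), (-3,3,-3), (2,4,-1), (-1,0,1), (6,4,-4)]),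
    ([Flip 1 2 3 0, Flip 2 7 6 8], 5094928, [8,7,2,6,4,9,3,1,0,5], [(1,-1,1), (2,1,-3), (0,0,4),
     (5,-3,-3), (0,0,-2), (4,6,-5), (-5,3,-3), (-2,-1,-3), (-1,1,1), (-4,-6,-5)])]"

definition N4_26 :: "tri list" where
  "N4_26 =
   [(2,6,8), (6,7,8), (0,1,3), (0,2,3), (3,5,9), (5,6,9), (0,5,8), (0,8,9), (2,8,9), (0,2,5), (3,5,7),
   (0,1,6), (3,4,8), (4,5,8), (2,3,9), (0,4,9), (1,4,9), (3,7,8), (0,4,6), (2,5,6), (1,3,4), (4,5,7),
   (4,6,7), (1,6,9)]"

lemma walk_26: "walk N4_25 certificates_26 = Some N4_26"
  by code_simp

definition certificates_27 :: "certificate list" where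
  "certificates_27 =
   [([Flip 5 9 3 6], 5681020, [8,7,2,6,4,9,3,1,0,5], [(-1,2,1), (3,1,-3), (0,0,5), (-2,6,-4), (0,0,-2),
     (6,0,-3), (2,-6,-4), (-3,-1,-3), (1,-2,1), (-6,0,-3)]),
    ([Flip 0 8 5 9, Flip 3 4 1 8, Flip 4 6 7 0], 4287232, [8,7,2,6,4,9,3,1,0,5], [(-2,2,2), (-1,2,-1),
     (0,0,6), (-6,3,-3), (0,0,-1), (6,5,1), (6,-3,-3), (1,-2,-1), (2,-2,2), (-6,-5,1)]),
    ([Flip 5 9 0 8], 4651852, [8,7,2,6,4,9,3,1,0,5], [(3,-5,-2), (0,-1,2), (0,0,-4), (5,-2,4), (0,0,2),
     (-3,-3,4), (-5,2,4), (0,1,2), (-3,5,-2), (3,3,4)]),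
    ([Flip 3 6 5 9], 4338814, [8,7,2,6,4,9,3,1,0,5], [(1,-1,4), (-1,-1,1), (0,0,-5), (4,1,0), (0,0,1),
     (-4,-2,0), (-4,-1,0), (1,1,1), (-1,1,4), (4,2,0)])]"

definition N4_27 :: "tri list" where
  "N4_27 =
   [(3,5,9), (5,6,9), (0,5,8), (0,8,9), (0,4,7), (0,6,7), (1,3,8), (1,4,8), (2,6,8), (6,7,8), (0,1,3),
   (0,2,3), (2,8,9), (0,2,5), (3,5,7), (0,1,6), (4,5,8), (2,3,9), (0,4,9), (1,4,9), (3,7,8), (2,5,6),
   (4,5,7), (1,6,9)]"

lemma walk_27: "walk N4_26 certificates_27 = Some N4_27"
  by code_simp

definition certificates_28 :: "certificate list" where
  "certificates_28 =
   [([Flip 0 3 1 2, Flip 6 8 2 7], 3960980, [8,7,2,6,4,9,3,1,0,5], [(-1,1,2), (-2,3,-2), (0,0,6),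
     (-3,1,-3), (0,0,-2), (4,6,-6), (3,-1,-3), (2,-3,-2), (1,-1,2), (-4,-6,-6)]),
    ([Flip 5 9 3 6], 3898232, [8,7,2,6,4,9,3,1,0,5], [(1,-1,1), (4,-2,-2), (0,0,6), (-2,-3,-5), (0,0,-3),
     (5,2,-5), (2,3,-5), (-4,2,-2), (-1,1,1), (-5,-2,-5)]),
    ([Flip 0 2 5 1, Flip 2 8 9 7], 4199088, [8,7,2,6,4,9,3,1,0,5], [(-1,3,4), (-2,5,-3), (0,0,-5),
     (1,4,-4), (0,0,-2), (-4,-1,-4), (-1,-4,-4), (2,-5,-3), (1,-3,4), (4,1,-4)]),
    ([Flip 0 8 5 9], 4829632, [8,7,2,6,4,9,3,1,0,5], [(-1,-2,-1), (-2,1,1), (0,0,0), (1,-1,4), (0,0,-5),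
     (4,2,-3), (-1,1,4), (2,-1,1), (1,2,-1), (-4,-2,-3)])]"

definition N4_28 :: "tri list" where
  "N4_28 =
   [(0,5,9), (5,8,9), (2,7,9), (7,8,9), (0,1,5), (1,2,5), (3,5,6), (3,6,9), (2,6,7), (1,2,3), (0,4,7),
   (0,6,7), (1,3,8), (1,4,8), (3,5,7), (0,1,6), (4,5,8), (2,3,9), (0,4,9), (1,4,9), (3,7,8), (2,5,6),
   (4,5,7), (1,6,9)]"

lemma walk_28: "walk N4_27 certificates_28 = Some N4_28"
  by code_simp

text \<open>Composes the 28 separately evaluated blocks into one chain.\<close>

lemma walk_append:
  "walk T (cs @ ds) = (case walk T cs of None \<Rightarrow> None | Some U \<Rightarrow> walk U ds)"
  by (induction T cs rule: walk.induct) (auto split: option.splits)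

definition certificates :: "certificate list" where
  "certificates =
     certificates_1 @ certificates_2 @ certificates_3 @ certificates_4 @ certificates_5 @
     certificates_6 @ certificates_7 @ certificates_8 @ certificates_9 @ certificates_10 @
     certificates_11 @ certificates_12 @ certificates_13 @ certificates_14 @ certificates_15 @
     certificates_16 @ certificates_17 @ certificates_18 @ certificates_19 @ certificates_20 @
     certificates_21 @ certificates_22 @ certificates_23 @ certificates_24 @ certificates_25 @
     certificates_26 @ certificates_27 @ certificates_28"

lemma walk_all: "walk N4_0 certificates = Some N4_28"
  by (simp add: certificates_def walk_append
      walk_1 walk_2 walk_3 walk_4 walk_5 walk_6 walk_7 walk_8 walk_9 walk_10 walk_11 walk_12 walk_13
      walk_14 walk_15 walk_16 walk_17 walk_18 walk_19 walk_20 walk_21 walk_22 walk_23 walk_24 walk_25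
      walk_26 walk_27 walk_28)

lemma certificates_distinct: "distinct (map value_of certificates)" "length certificates = 112"
  by code_simp+

theorem theorem5p5:
  shows "112 \<le> card ({\<Delta> :: nat set set.
             triangulates_N 4 \<Delta> \<and> card (vertices \<Delta>) = 10 \<and>
             (\<exists>\<psi>. polyhedral_realization \<Delta> \<psi> \<and> has_two_fold_rotational_symmetry \<Delta> \<psi>)} // iso_rel)"
proof -
  let ?N = "(\<lambda>c. 4 * value_of c) ` set certificates"
  have "?N \<subseteq> complex_invariant ` symmetric_triangulations"
    using walk_symmetric_triangulations[OF walk_all apply_moves_homeomorphic[OF reduction]] by blast
  then have "card ?N \<le> card (symmetric_triangulations // iso_rel)"
    by (intro card_le_card_quotient_iso_rel[where n = 10]) (auto simp: symmetric_triangulations_def)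
  \<comment> \<open>Multiplication by 4 is injective, so the 112 distinct recorded values stay
    distinct.\<close>
  moreover have "?N = (\<lambda>J. 4 * J) ` set (map value_of certificates)" by (simp add: image_image)
  then have "card ?N = 112"
    using distinct_card[OF certificates_distinct(1)] certificates_distinct(2)
    by (simp add: card_image inj_on_def del: set_map)
  ultimately show ?thesis unfolding symmetric_triangulations_def by simp
qed

end
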